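(* Let $\Gamma$ be an abstract polynomial portrait that has at least four postcritical vertices (counting $\infty$) and satisfies one of the following properties. (i) $\Gamma$ has a single non-attractor cycle, and it has length one. (ii) Every finite postcritical vertex of $\Gamma$ is in a single non-attractor cycle, this cycle has length $p^k$ for some prime number $p$ and some positive integer $k$, and the finite postcritical vertices can be enumerated as $\{v_i: 0\le i<p^k\}$ such that $\tau(v_i)=v_{i+1}$ (indices mod $p^k$) for every $i\in\{0,\dots,p^k-1\}$, and if $v_j$ is a critical value then $j$ is a multiple of $p^{k-1}$. Then every Thurston map with ramification portrait isomorphic to $\Gamma$ is unobstructed.
   Context: **Abstract portraits.** Let $\Gamma$ be a finite directed graph whose edges are weighted by positive integers, such that each vertex is the source of exactly one edge. For a vertex $v$, let $\tau(v)$ be the target of the edge with source $v$, and let $\deg(v)$ be the weight of that edge. A vertex $v$ is *critical* if $\deg(v)>1$, in which case $\tau(v)$ is called a *critical value*; $v$ is *postcritical* if there are a critical vertex $w$ and an integer $k\ge 1$ with $\tau^{\circ k}(w)=v$. Let $C_\Gamma$ denote the set of critical vertices. $\Gamma$ is an *abstract portrait* if: (a) every vertex is critical or postcritical; (b) there is an integer $d\ge2$ (the *degree* of $\Gamma$) with $\sum_{v\in C_\Gamma}(\deg(v)-1)=2d-2$; (c) for each vertex $v$ the sum of the weights of the edges with target $v$ is at most $d$. An abstract portrait of degree $d$ is an *abstract polynomial portrait* if there is a vertex $v$ with $\tau(v)=v$ and $\deg(v)=d$; one such vertex is chosen and called $\infty$, and all other vertices are called *finite*. A cycle means a cycle of the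 action of $\tau$ on the vertices; an *attractor* is a cycle containing a critical vertex, and a *non-attractor* is a cycle containing no critical vertex. **Thurston maps.** A *Thurston map* is an orientation-preserving branched cover $f:S^2\to S^2$ of degree $d\ge2$ of the oriented topological 2-sphere whose postcritical set $P_f$ (the smallest forward invariant set containing the critical values) is finite. With $C_f$ the set of critical points, its *ramification portrait* is the weighted directed graph with vertex set $C_f\cup P_f$ and, for each vertex $v$, exactly one edge with source $v$, going to $f(v)$, with weight the local degree of $f$ at $v$. Isomorphism of portraits means isomorphism of weighted directed graphs. **Obstructions.** A *multicurve* $\Delta$ is a finite collection of pairwise disjoint simple closed curves in $S^2\setminus P_f$, no two homotopic in $S^2\setminus P_f$, each *essential* (not bounding a disk in $S^2\setminus P_f$) and *nonperipheral* (not bounding a disk in $S^2$ containing exactly one point of $P_f$). It is *invariant* if for every $\delta\in\Delta$ every component of $f^{-1}(\delta)$ is either inessential, or peripheral, or homotopic in $S^2\setminus P_f$ to an element of $\Delta$. The associated Thurston linear map $\mathbb R^\Delta\to\mathbb R^\Delta$ sends $\delta$ to $\sum_{\delta'\in\Delta}\big(\sum_{\alpha}\frac{1}{\deg(f:\alpha\to\delta)}\big)\delta'$, where $\alpha$ ranges over the components of $f^{-1}(\delta)$ homotopic to $\delta'$ in $S^2\setminus P_f$. An invariant multicurve is an *obstruction* if the leading eigenvalue $\lambda\geq 0$ of this non-negative matrix satisfies $\lambda\ge1$. $f$ is *obstructed* if it admits an obstruction, and *unobstructed* otherwise. *)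

theory Defs
  imports "HOL-Complex_Analysis.Complex_Analysis"
begin

text \<open>
  Every vertex is the source of exactly one edge, so edges are identified with their sources:
  \<open>tau v\<close> is the target and \<open>deg v\<close> the weight of the edge with source \<open>v\<close>.
  Values of \<open>tau\<close> and \<open>deg\<close> outside \<open>verts\<close> carry no meaning.
\<close>

record 'v portrait =
  verts :: "'v set"
  tau :: "'v \<Rightarrow> 'v"
  deg :: "'v \<Rightarrow> nat"

definition weighted_graph :: "'v portrait \<Rightarrow> bool" where
  "weighted_graph G \<longleftrightarrow>
     finite (verts G) \<and> tau G ` verts G \<subseteq> verts G \<and> (\<forall>v\<in>verts G. deg G v > 0)"

definition critical_verts :: "'v portrait \<Rightarrow> 'v set" where
  "critical_verts G = {v \<in> verts G. deg G v > 1}"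

definition critical_values :: "'v portrait \<Rightarrow> 'v set" where
  "critical_values G = tau G ` critical_verts G"

definition postcritical_verts :: "'v portrait \<Rightarrow> 'v set" where
  "postcritical_verts G = {v. \<exists>w\<in>critical_verts G. \<exists>k\<ge>1. (tau G ^^ k) w = v}"

definition abstract_portrait :: "'v portrait \<Rightarrow> nat \<Rightarrow> bool" where
  "abstract_portrait G d \<longleftrightarrow>
     weighted_graph G \<and>
     verts G \<subseteq> critical_verts G \<union> postcritical_verts G \<and>
     d \<ge> 2 \<and> (\<Sum>v\<in>critical_verts G. deg G v - 1) = 2 * d - 2 \<and>
     (\<forall>v\<in>verts G. (\<Sum>w | w \<in> verts G \<and> tau G w = v. deg G w) \<le> d)"

definition abstract_polynomial_portrait :: "'v portrait \<Rightarrow> nat \<Rightarrow> 'v \<Rightarrow> bool" where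
  "abstract_polynomial_portrait G d vinf \<longleftrightarrow>
     abstract_portrait G d \<and> vinf \<in> verts G \<and> tau G vinf = vinf \<and> deg G vinf = d"

definition is_cycle :: "'v portrait \<Rightarrow> 'v set \<Rightarrow> bool" where
  "is_cycle G Z \<longleftrightarrow>
     (\<exists>v\<in>verts G. \<exists>n>0. (tau G ^^ n) v = v \<and> Z = {(tau G ^^ i) v | i. i < n})"

definition non_attractor :: "'v portrait \<Rightarrow> 'v set \<Rightarrow> bool" where
  "non_attractor G Z \<longleftrightarrow> is_cycle G Z \<and> Z \<inter> critical_verts G = {}"

definition portrait_isomorphic :: "'u portrait \<Rightarrow> 'v portrait \<Rightarrow> bool" where
  "portrait_isomorphic G H \<longleftrightarrow>
     (\<exists>h. bij_betw h (verts G) (verts H) \<and>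
          (\<forall>v\<in>verts G. h (tau G v) = tau H (h v) \<and> deg G v = deg H (h v)))"

abbreviation S2 :: "(real^3) set" where
  "S2 \<equiv> sphere 0 1"

text \<open>
  Inverse stereographic projections. Both omit one pole, and \<open>par_south w = par_north (1 / w)\<close>
  for \<open>w \<noteq> 0\<close>, so the transition map is holomorphic and the two parametrizations define
  an orientation of the sphere. Whether a self-map of the sphere preserves orientation does not
  depend on which of the two orientations is used.
\<close>

definition par_north :: "complex \<Rightarrow> real^3" where
  "par_north w = (1 / ((cmod w)\<^sup>2 + 1)) *\<^sub>R vector [2 * Re w, 2 * Im w, (cmod w)\<^sup>2 - 1]"

definition par_south :: "complex \<Rightarrow> real^3" where
  "par_south w = (1 / ((cmod w)\<^sup>2 + 1)) *\<^sub>R vector [2 * Re w, - 2 * Im w, 1 - (cmod w)\<^sup>2]"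

text \<open>
  Orientation of a topological chart is tested with winding numbers: the chart must carry small
  positively oriented circles around a point to loops winding once, positively, around its image.
\<close>

definition oriented_disk_chart :: "(real^3) set \<Rightarrow> (real^3 \<Rightarrow> complex) \<Rightarrow> bool" where
  "oriented_disk_chart U \<phi> \<longleftrightarrow>
     openin (top_of_set S2) U \<and>
     (\<exists>\<phi>'. homeomorphism U (ball 0 1) \<phi> \<phi>') \<and>
     (\<forall>par\<in>{par_north, par_south}. \<forall>z r. 0 < r \<and> par ` cball z r \<subseteq> U \<longrightarrow>
        winding_number (\<phi> \<circ> par \<circ> circlepath z r) (\<phi> (par z)) = 1)"

text \<open>
  Since local normal forms are required to use oriented charts, a map having a local degree at every
  point preserves orientation away from its critical points.
\<close>

definition has_local_degree :: "(real^3 \<Rightarrow> real^3) \<Rightarrow> real^3 \<Rightarrow> nat \<Rightarrow> bool" where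
  "has_local_degree f x k \<longleftrightarrow>
     k \<ge> 1 \<and>
     (\<exists>U V \<phi> \<psi>. oriented_disk_chart U \<phi> \<and> oriented_disk_chart V \<psi> \<and>
        x \<in> U \<and> \<phi> x = 0 \<and> f x \<in> V \<and> \<psi> (f x) = 0 \<and>
        f ` U \<subseteq> V \<and> (\<forall>u\<in>U. \<psi> (f u) = \<phi> u ^ k))"

definition local_degree :: "(real^3 \<Rightarrow> real^3) \<Rightarrow> real^3 \<Rightarrow> nat" where
  "local_degree f x = (THE k. has_local_degree f x k)"

text \<open>
  On the compact sphere the local normal forms already make all fibres finite and their size,
  counted with multiplicity, constant. The last condition serves to name that constant.
\<close>

definition oriented_branched_cover :: "(real^3 \<Rightarrow> real^3) \<Rightarrow> nat \<Rightarrow> bool" where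
  "oriented_branched_cover f d \<longleftrightarrow>
     continuous_on S2 f \<and> f ` S2 \<subseteq> S2 \<and>
     (\<forall>x\<in>S2. \<exists>k. has_local_degree f x k) \<and>
     (\<forall>y\<in>S2. finite {x\<in>S2. f x = y} \<and> (\<Sum>x | x \<in> S2 \<and> f x = y. local_degree f x) = d)"

definition critical_points :: "(real^3 \<Rightarrow> real^3) \<Rightarrow> (real^3) set" where
  "critical_points f = {x \<in> S2. local_degree f x > 1}"

definition postcritical_set :: "(real^3 \<Rightarrow> real^3) \<Rightarrow> (real^3) set" where
  "postcritical_set f = \<Inter> {X. X \<subseteq> S2 \<and> f ` critical_points f \<subseteq> X \<and> f ` X \<subseteq> X}"

definition thurston_map :: "(real^3 \<Rightarrow> real^3) \<Rightarrow> bool" where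
  "thurston_map f \<longleftrightarrow> (\<exists>d\<ge>2. oriented_branched_cover f d) \<and> finite (postcritical_set f)"

definition ramification_portrait :: "(real^3 \<Rightarrow> real^3) \<Rightarrow> (real^3) portrait" where
  "ramification_portrait f =
     \<lparr>verts = critical_points f \<union> postcritical_set f, tau = f, deg = local_degree f\<rparr>"

text \<open>Curves are unparametrized and unoriented: they are point sets.\<close>

definition closed_curve_param :: "(real \<Rightarrow> real^3) \<Rightarrow> (real^3) set \<Rightarrow> bool" where
  "closed_curve_param g \<gamma> \<longleftrightarrow>
     simple_path g \<and> pathfinish g = pathstart g \<and> path_image g = \<gamma>"

text \<open>
  Since the parametrizations are existentially quantified, they may run in either direction:
  this is free homotopy of unoriented curves.
\<close>

definition homotopic_curves :: "(real^3) set \<Rightarrow> (real^3) set \<Rightarrow> (real^3) set \<Rightarrow> bool" where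
  "homotopic_curves X \<alpha> \<beta> \<longleftrightarrow>
     (\<exists>g h. closed_curve_param g \<alpha> \<and> closed_curve_param h \<beta> \<and> homotopic_loops X g h)"

definition bounds_disk :: "(real^3) set \<Rightarrow> (real^3) set \<Rightarrow> bool" where
  "bounds_disk \<gamma> D \<longleftrightarrow>
     D \<subseteq> S2 \<and> (\<exists>h h'. homeomorphism (cball (0::complex) 1) D h h' \<and> h ` sphere 0 1 = \<gamma>)"

definition essential :: "(real^3) set \<Rightarrow> (real^3) set \<Rightarrow> bool" where
  "essential P \<gamma> \<longleftrightarrow> \<not> (\<exists>D. bounds_disk \<gamma> D \<and> D \<subseteq> S2 - P)"

definition peripheral :: "(real^3) set \<Rightarrow> (real^3) set \<Rightarrow> bool" where
  "peripheral P \<gamma> \<longleftrightarrow> (\<exists>D. bounds_disk \<gamma> D \<and> card (D \<inter> P) = 1)"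

definition multicurve :: "(real^3) set \<Rightarrow> (real^3) set set \<Rightarrow> bool" where
  "multicurve P \<Delta> \<longleftrightarrow>
     finite \<Delta> \<and>
     (\<forall>\<delta>\<in>\<Delta>. \<delta> \<subseteq> S2 - P \<and> (\<exists>g. closed_curve_param g \<delta>) \<and> essential P \<delta> \<and> \<not> peripheral P \<delta>) \<and>
     (\<forall>\<delta>\<in>\<Delta>. \<forall>\<delta>'\<in>\<Delta>. \<delta> \<noteq> \<delta>' \<longrightarrow> \<delta> \<inter> \<delta>' = {} \<and> \<not> homotopic_curves (S2 - P) \<delta> \<delta>')"

definition preimage_curves :: "(real^3 \<Rightarrow> real^3) \<Rightarrow> (real^3) set \<Rightarrow> (real^3) set set" where
  "preimage_curves f \<delta> = components {x \<in> S2. f x \<in> \<delta>}"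

definition invariant_multicurve :: "(real^3 \<Rightarrow> real^3) \<Rightarrow> (real^3) set set \<Rightarrow> bool" where
  "invariant_multicurve f \<Delta> \<longleftrightarrow>
     multicurve (postcritical_set f) \<Delta> \<and>
     (\<forall>\<delta>\<in>\<Delta>. \<forall>\<alpha>\<in>preimage_curves f \<delta>.
        \<not> essential (postcritical_set f) \<alpha> \<or>
        peripheral (postcritical_set f) \<alpha> \<or>
        (\<exists>\<delta>'\<in>\<Delta>. homotopic_curves (S2 - postcritical_set f) \<alpha> \<delta>'))"

text \<open>The degree of the covering \<open>f : \<alpha> \<rightarrow> \<delta>\<close>, as the common cardinality of its fibres.\<close>

definition curve_degree ::
    "(real^3 \<Rightarrow> real^3) \<Rightarrow> (real^3) set \<Rightarrow> (real^3) set \<Rightarrow> nat" where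
  "curve_degree f \<alpha> \<delta> =
     (THE n. \<forall>y\<in>\<delta>. finite {x\<in>\<alpha>. f x = y} \<and> card {x\<in>\<alpha>. f x = y} = n)"

text \<open>
  The coefficient of \<open>\<delta>'\<close> in the image of \<open>\<delta>\<close> under the Thurston linear map:
  rows are indexed by \<open>\<delta>'\<close>, columns by \<open>\<delta>\<close>.
\<close>

definition thurston_matrix ::
    "(real^3 \<Rightarrow> real^3) \<Rightarrow> (real^3) set \<Rightarrow> (real^3) set \<Rightarrow> real" where
  "thurston_matrix f \<delta>' \<delta> =
     (\<Sum>\<alpha> | \<alpha> \<in> preimage_curves f \<delta> \<and> homotopic_curves (S2 - postcritical_set f) \<alpha> \<delta>'.
        1 / real (curve_degree f \<alpha> \<delta>))"

definition matrix_eigenvalue :: "'i set \<Rightarrow> ('i \<Rightarrow> 'i \<Rightarrow> 'a::field) \<Rightarrow> 'a \<Rightarrow> bool" where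
  "matrix_eigenvalue I A \<mu> \<longleftrightarrow>
     (\<exists>v. (\<exists>i\<in>I. v i \<noteq> 0) \<and> (\<forall>i\<in>I. (\<Sum>j\<in>I. A i j * v j) = \<mu> * v i))"

text \<open>
  For a non-negative matrix with non-empty index set, a (necessarily unique) leading eigenvalue
  exists by the Perron-Frobenius theorem. For the empty index set there is none, so that the empty
  multicurve is never an obstruction.
\<close>

definition leading_eigenvalue :: "'i set \<Rightarrow> ('i \<Rightarrow> 'i \<Rightarrow> real) \<Rightarrow> real \<Rightarrow> bool" where
  "leading_eigenvalue I A \<rho> \<longleftrightarrow>
     0 \<le> \<rho> \<and> matrix_eigenvalue I A \<rho> \<and>
     (\<forall>\<mu>. matrix_eigenvalue I (\<lambda>i j. complex_of_real (A i j)) \<mu> \<longrightarrow> cmod \<mu> \<le> \<rho>)"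

definition obstruction :: "(real^3 \<Rightarrow> real^3) \<Rightarrow> (real^3) set set \<Rightarrow> bool" where
  "obstruction f \<Delta> \<longleftrightarrow>
     invariant_multicurve f \<Delta> \<and>
     (\<exists>\<rho>. leading_eigenvalue \<Delta> (thurston_matrix f) \<rho> \<and> \<rho> \<ge> 1)"

definition obstructed :: "(real^3 \<Rightarrow> real^3) \<Rightarrow> bool" where
  "obstructed f \<longleftrightarrow> (\<exists>\<Delta>. obstruction f \<Delta>)"

end

theory Submission
  imports Defs
begin

text \<open>
  Jordan curves on the sphere are handled by the Schoenflies theorem. It is derived from the Riemann map of the inside of
  the curve, which by the length-area method extends continuously and injectively to the boundary circle.

  Let \<open>q\<close> be the critical fixed point of local degree \<open>d\<close> that corresponds to \<open>\<infinity>\<close>. Cutting the sphere along rays from the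
  critical values to \<open>q\<close>, the sheets of \<open>f\<close> are glued together at the critical points that do not lie over \<open>q\<close>; since the
  sphere without the fibre of \<open>q\<close> is connected, the degree is at most \<open>1 + (d - 1)\<close>. Hence \<open>q\<close> is its own only preimage.
  So every Jordan curve \<open>\<gamma>\<close> that avoids \<open>q\<close> bounds a disk \<open>D \<gamma>\<close> without \<open>q\<close>, and \<open>f\<close> maps the disk of a component of the
  preimage of \<open>\<delta>\<close> into \<open>D \<delta>\<close>; the disks of different components are disjoint.

  Let \<open>u\<close> be the absolute value of an eigenvector for an eigenvalue \<open>\<ge> 1\<close> and \<open>L x = (\<Sum>\<delta>. u \<delta>)\<close>, summed over the \<open>\<delta>\<close> with
  \<open>x \<in> D \<delta>\<close>. At most one component of the preimage of \<open>\<delta>\<close> surrounds a given point, and it contributes at most \<open>1\<close> to the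
  matrix, so \<open>L x \<le> L (f x)\<close> for every postcritical point \<open>x \<noteq> q\<close>. Where \<open>L\<close> is maximal on a cycle, equality forces all
  these components to be mapped with degree \<open>1\<close>. The smallest sets \<open>D \<delta> \<inter> P\<close> that arise in this way are pairwise disjoint,
  have at least two elements, are permuted by \<open>f\<close>, and consist of points of local degree \<open>1\<close>: they lie in the
  non-attractor cycles. This contradicts (i). In case (ii) such a set is a union of cosets of the subgroup of order \<open>p\<close> of the cyclic group
  of order \<open>p ^ k\<close>, and one of its translates contains all finite critical values. But then the complement of \<open>D \<delta>\<close> contains no
  critical value other than \<open>q\<close>, so the preimage of \<open>\<delta>\<close> is connected and is mapped with degree \<open>d > 1\<close>.
\<close>

section \<open>The Schoenflies theorem\<close>

text \<open>Closed topological disks are unavoidable in two places. Essential and nonperipheral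
  curves are defined through them, so two postcritical points inside \<delta> are available only
  once the closure of \<open>D \<delta>\<close> is known to be such a disk. And over the exterior of
  \<delta> the preimages are controlled by a radial retraction of a disk centred at
  \<open>q\<close>, which is why the Schoenflies theorem is proved with a prescribed centre.

  The portrait speaks of local degrees only, not of the degree \<open>N\<close> of \<open>f\<close>.
  Its fixed vertex gives \<open>d \<le> N\<close>, and of its total \<open>2 * d - 2\<close> the
  part \<open>d - 1\<close> is left for the critical points other than \<open>q\<close>. The missing
  inequality \<open>N - 1 \<le> d - 1\<close> is the half of the Riemann-Hurwitz formula that rests
  on connectedness alone: joining \<open>N\<close> sheets into one piece takes at least
  \<open>N - 1\<close> gluings.\<close>

text \<open>The change of variables formula is applied on \<open>real^2\<close>, Tonelli's theorem
  on \<open>real \<times> real\<close>; this identifies the two measures.\<close>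

lemma lborel_prod_eq_distr_vec:
  "(lborel :: (real \<times> real) measure) = distr (lborel :: (real^2) measure) borel (\<lambda>x. (x$1, x$2))"
proof (rule lborel_eqI)
  have meas: "(\<lambda>x::real^2. (x$1, x$2)) \<in> borel_measurable borel"
    by (intro borel_measurable_continuous_onI continuous_intros)
  fix l u :: "real \<times> real"
  assume lu: "\<And>b. b \<in> Basis \<Longrightarrow> l \<bullet> b \<le> u \<bullet> b"
  have le: "fst l \<le> fst u" "snd l \<le> snd u"
    using lu[of "(1,0)"] lu[of "(0,1)"] by (auto simp: Basis_prod_def inner_prod_def)
  let ?l = "vector [fst l, snd l] :: real^2" and ?u = "vector [fst u, snd u] :: real^2"
  have vi: "(\<lambda>x::real^2. (x$1, x$2)) -` box l u = box ?l ?u"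
    by (auto simp: mem_box_cart forall_2 mem_box(1)[of "(_::real,_::real)"] Basis_prod_def inner_prod_def)
  have "emeasure (distr lborel borel (\<lambda>x::real^2. (x$1, x$2))) (box l u) = emeasure lborel (box ?l ?u)"
    using meas by (subst emeasure_distr) (auto simp: vi)
  also have "\<dots> = (\<Prod>b\<in>Basis. (?u - ?l) \<bullet> b)"
  proof (intro emeasure_lborel_box)
    have "?l $ i \<le> ?u $ i" for i using exhaust_2[of i] le by auto
    then show "?l \<bullet> b \<le> ?u \<bullet> b" if "b \<in> Basis" for b
      using that by (auto simp: Basis_vec_def inner_axis)
  qed
  also have "(\<Prod>b\<in>Basis. (?u - ?l) \<bullet> b) = (fst u - fst l) * (snd u - snd l)"
  proof -
    have B: "(Basis :: (real^2) set) = {axis 1 1, axis 2 1}"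
      unfolding Basis_vec_def UNIV_2 by auto
    have ne: "axis 1 1 \<noteq> (axis 2 1 :: real^2)"
      by (simp add: axis_eq_axis)
    show ?thesis unfolding B using ne by (simp add: inner_axis)
  qed
  also have "\<dots> = (\<Prod>b\<in>Basis. (u - l) \<bullet> b)"
    by (simp add: Basis_prod_def inner_prod_def)
  finally show "emeasure (distr lborel borel (\<lambda>x::real^2. (x$1, x$2))) (box l u) = (\<Prod>b\<in>Basis. (u - l) \<bullet> b)" .
qed auto

text \<open>The real Jacobian of a holomorphic map is the squared modulus of its derivative.\<close>

lemma det_complex_mult:
  "det (matrix (\<lambda>h::real^2. (vector [Re (c * Complex (h$1) (h$2)), Im (c * Complex (h$1) (h$2))] :: real^2)))
     = (cmod c)\<^sup>2"
  by (simp add: det_2 matrix_def axis_def cmod_power2 flip: power2_eq_square)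

lemma borel_measurable_deriv_square:
  fixes F :: "complex \<Rightarrow> complex"
  assumes S: "open S" and hol: "F holomorphic_on S"
  shows "(\<lambda>x::real\<times>real. ennreal ((cmod (deriv F (Complex (fst x) (snd x))))\<^sup>2) *
            indicator {x. Complex (fst x) (snd x) \<in> S} x) \<in> borel_measurable borel"
proof -
  have openP: "open {x::real\<times>real. Complex (fst x) (snd x) \<in> S}"
  proof -
    have "continuous_on UNIV (\<lambda>x::real\<times>real. Complex (fst x) (snd x))"
      unfolding complex_eq by (intro continuous_intros)
    from open_vimage[OF S this] show ?thesis by (simp add: vimage_def)
  qed
    have "continuous_on {x::real\<times>real. Complex (fst x) (snd x) \<in> S} (\<lambda>x. (cmod (deriv F (Complex (fst x) (snd x))))\<^sup>2)"
    proof (intro continuous_intros)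
      show "continuous_on {x::real\<times>real. Complex (fst x) (snd x) \<in> S} (\<lambda>x. deriv F (Complex (fst x) (snd x)))"
      proof (rule continuous_on_compose2[of S "deriv F"])
        show "continuous_on S (deriv F)"
          using hol S holomorphic_deriv holomorphic_on_imp_continuous_on by blast
        show "continuous_on {x::real\<times>real. Complex (fst x) (snd x) \<in> S} (\<lambda>x. Complex (fst x) (snd x))"
          unfolding complex_eq by (intro continuous_intros)
      qed auto
    qed
    then have "(\<lambda>x. indicator {x::real\<times>real. Complex (fst x) (snd x) \<in> S} x *\<^sub>R (cmod (deriv F (Complex (fst x) (snd x))))\<^sup>2) \<in> borel_measurable borel"
      using openP by (intro borel_measurable_continuous_on_indicator) auto
    then have "(\<lambda>x::real\<times>real. ennreal (indicator {x::real\<times>real. Complex (fst x) (snd x) \<in> S} x *\<^sub>R (cmod (deriv F (Complex (fst x) (snd x))))\<^sup>2)) \<in> borel_measurable borel"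
      by measurable
    also have "(\<lambda>x::real\<times>real. ennreal (indicator {x::real\<times>real. Complex (fst x) (snd x) \<in> S} x *\<^sub>R (cmod (deriv F (Complex (fst x) (snd x))))\<^sup>2)) =
      (\<lambda>x. ennreal ((cmod (deriv F (Complex (fst x) (snd x))))\<^sup>2) * indicator {x. Complex (fst x) (snd x) \<in> S} x)"
      by (auto simp: indicator_def fun_eq_iff)
    finally show ?thesis .
  qed

text \<open>The integral is the area of the image, because injectivity makes every value count once,
  and a bounded image has finite area.\<close>

lemma nn_integral_deriv_square_finite:
  fixes F :: "complex \<Rightarrow> complex"
  assumes S: "open S" and hol: "F holomorphic_on S" and inj: "inj_on F S" and bd: "bounded (F ` S)"
  shows "(\<integral>\<^sup>+x. ennreal ((cmod (deriv F (Complex (fst x) (snd x))))\<^sup>2) * indicator {x. Complex (fst x) (snd x) \<in> S} x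
            \<partial>(lborel :: (real \<times> real) measure)) < \<infinity>"
proof -
  define T where "T = (\<lambda>x::real^2. Complex (x$1) (x$2))"
  define T' where "T' = (\<lambda>z. vector [Re z, Im z] :: real^2)"
  have TT': "T (T' z) = z" "T' (T x) = x" for z x
    by (simp_all add: T_def T'_def vec_eq_iff forall_2)
  have linT: "bounded_linear T"
    unfolding T_def by (intro linear_conv_bounded_linear[THEN iffD1] linearI) (auto simp: complex_eq_iff)
  have linT': "bounded_linear T'"
    unfolding T'_def by (intro linear_conv_bounded_linear[THEN iffD1] linearI) (auto simp: vec_eq_iff forall_2)
  have contT: "continuous_on A T" for A
    using linT linear_continuous_on by blast
  define S' where "S' = T -` S"
  have openS': "open S'"
    unfolding S'_def using contT S open_vimage by blast
  define G where "G = T' \<circ> F \<circ> T"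
  have der: "(G has_derivative (\<lambda>h. T' (deriv F (T x) * T h))) (at x within S')" if "x \<in> S'" for x
  proof -
    have "(F has_field_derivative deriv F (T x)) (at (T x))"
      using that hol S by (auto simp: S'_def intro: holomorphic_derivI)
    then have "(F has_derivative (*) (deriv F (T x))) (at (T x))"
      by (simp add: has_field_derivative_def)
    moreover have "(T has_derivative T) (at x)"
      using linT by (simp add: bounded_linear_imp_has_derivative)
    ultimately have "((\<lambda>x. F (T x)) has_derivative (\<lambda>h. deriv F (T x) * T h)) (at x)"
      using has_derivative_compose by blast
    then have "((\<lambda>x. T' (F (T x))) has_derivative (\<lambda>h. T' (deriv F (T x) * T h))) (at x)"
      by (rule bounded_linear.has_derivative[OF linT'])
    then show ?thesis
      unfolding G_def comp_def by (rule has_derivative_at_withinI)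
  qed
  have injG: "inj_on G S'"
    unfolding G_def S'_def using inj TT' by (auto simp: inj_on_def) metis
  have im: "G ` S' = T -` (F ` S)"
  proof
    show "G ` S' \<subseteq> T -` (F ` S)" by (auto simp: G_def S'_def TT')
    show "T -` (F ` S) \<subseteq> G ` S'"
    proof
      fix x assume "x \<in> T -` (F ` S)"
      then obtain z where z: "z \<in> S" "T x = F z" by auto
      then have "x = G (T' z)" "T' z \<in> S'" by (auto simp: G_def S'_def TT' simp flip: z(2))
      then show "x \<in> G ` S'" by blast
    qed
  qed
  have "open (F ` S)" using open_mapping_thm3[OF hol S inj] .
  then have "open (G ` S')" unfolding im using contT open_vimage by blast
  moreover have "bounded (G ` S')"
  proof -
    have "G ` S' \<subseteq> T' ` (F ` S)" by (auto simp: G_def S'_def)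
    then show ?thesis using bounded_linear_image[OF bd linT'] bounded_subset by blast
  qed
  ultimately have lm: "G ` S' \<in> lmeasurable" by (simp add: lmeasurable_open)
  have S'm: "S' \<in> sets lebesgue" using openS' by auto
  have "(\<lambda>x. \<bar>det (matrix (\<lambda>h. T' (deriv F (T x) * T h)))\<bar>) integrable_on S'"
    using measurable_differentiable_image_eq[OF S'm der injG] lm by blast
  then have int: "(\<lambda>x. (cmod (deriv F (T x)))\<^sup>2) integrable_on S'"
    unfolding T_def T'_def det_complex_mult by simp
  then have "(\<lambda>x. (cmod (deriv F (T x)))\<^sup>2) absolutely_integrable_on S'"
    by (rule nonnegative_absolutely_integrable_1) auto
  then have "(\<integral>\<^sup>+x. ennreal (norm (indicator S' x *\<^sub>R (cmod (deriv F (T x)))\<^sup>2)) \<partial>lebesgue) < \<infinity>"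
    unfolding set_integrable_def integrable_iff_bounded by blast
  also have "(\<lambda>x. ennreal (norm (indicator S' x *\<^sub>R (cmod (deriv F (T x)))\<^sup>2)))
        = (\<lambda>x. ennreal ((cmod (deriv F (T x)))\<^sup>2) * indicator S' x)"
    by (auto simp: indicator_def fun_eq_iff)
  finally have 1: "(\<integral>\<^sup>+x. ennreal ((cmod (deriv F (T x)))\<^sup>2) * indicator S' x \<partial>lebesgue) < \<infinity>" .
  define k where "k = (\<lambda>x. ennreal ((cmod (deriv F (Complex (fst x) (snd x))))\<^sup>2) * indicator {x. Complex (fst x) (snd x) \<in> S} x)"
  have km: "k \<in> borel_measurable borel"
    unfolding k_def by (rule borel_measurable_deriv_square[OF S hol])
  have Qm: "(\<lambda>x::real^2. (x$1, x$2)) \<in> borel_measurable lborel"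
  proof -
    have "(\<lambda>x::real^2. (x$1, x$2)) \<in> borel_measurable borel"
      by (intro borel_measurable_continuous_onI continuous_intros)
    then show ?thesis by (subst measurable_cong_sets[OF sets_lborel refl])
  qed
  have "(\<integral>\<^sup>+x. k x \<partial>lborel) = (\<integral>\<^sup>+x. k (x$1, x$2) \<partial>(lborel :: (real^2) measure))"
    unfolding lborel_prod_eq_distr_vec by (rule nn_integral_distr[OF Qm]) (simp add: km)
  also have "\<dots> = (\<integral>\<^sup>+x. k (x$1, x$2) \<partial>(lebesgue :: (real^2) measure))"
    by (rule nn_integral_completion[symmetric])
  also have "(\<lambda>x. k (x$1, x$2)) = (\<lambda>x. ennreal ((cmod (deriv F (T x)))\<^sup>2) * indicator S' x)"
    by (auto simp: k_def T_def S'_def indicator_def)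
  finally show ?thesis using 1 unfolding k_def by simp
qed

text \<open>The Cauchy-Schwarz inequality along a segment: squared displacement is at most length
  times the integral of the squared speed.\<close>

lemma vertical_displacement_le:
  fixes F :: "complex \<Rightarrow> complex"
  assumes hol: "F holomorphic_on S" and S: "open S" and ab: "a < b"
    and sub: "\<And>t. t \<in> {a..b} \<Longrightarrow> Complex s t \<in> S"
  shows "ennreal ((dist (F (Complex s a)) (F (Complex s b)))\<^sup>2 / (b - a))
    \<le> (\<integral>\<^sup>+t. ennreal ((cmod (deriv F (Complex s t)))\<^sup>2) * indicator {a..b} t \<partial>lborel)"
proof -
  define v where "v = F (Complex s b) - F (Complex s a)"
  define L where "L = b - a"
  have L: "L > 0" using ab by (simp add: L_def)
  \<comment> \<open>Expanding the square of the modulus of \<open>\<i> * F' - v / L\<close>, which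
    is nonnegative, shows that \<open>q\<close> is a lower bound for the squared speed. The
    fundamental theorem of calculus gives \<open>q\<close> the integral
    \<open>(cmod v)^2 / L\<close>.\<close>
  define q where "q = (\<lambda>t. 2 * Re (cnj (v / of_real L) * (\<i> * deriv F (Complex s t))) - (cmod v)\<^sup>2 / L\<^sup>2)"
  have der: "((\<lambda>t. F (Complex s t)) has_vector_derivative \<i> * deriv F (Complex s t)) (at t within {a..b})"
    if "t \<in> {a..b}" for t
  proof -
    have 1: "(F has_field_derivative deriv F (Complex s t)) (at (Complex s t))"
      using that hol S sub by (auto intro: holomorphic_derivI)
    have 2: "((\<lambda>t. Complex s t) has_vector_derivative \<i>) (at t within {a..b})"
  proof -
    have "Complex s = (\<lambda>t. of_real s + \<i> * of_real t)" by (simp add: fun_eq_iff Complex_eq)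
    moreover have "((\<lambda>t. of_real s + \<i> * of_real t) has_vector_derivative \<i>) (at t within {a..b})"
      by (auto intro!: derivative_eq_intros)
    ultimately show ?thesis by simp
  qed
    have "(F \<circ> (\<lambda>t. Complex s t) has_vector_derivative \<i> * deriv F (Complex s t)) (at t within {a..b})"
      by (rule field_vector_diff_chain_within[OF 2 has_field_derivative_at_within[OF 1]])
    then show ?thesis by (simp add: comp_def)
  qed
  have "(q has_integral (2 * Re (cnj (v / of_real L) * F (Complex s b)) - (cmod v)\<^sup>2 / L\<^sup>2 * b)
        - (2 * Re (cnj (v / of_real L) * F (Complex s a)) - (cmod v)\<^sup>2 / L\<^sup>2 * a)) {a..b}"
  proof (rule fundamental_theorem_of_calculus)
    show "a \<le> b" using ab by simp
    fix t assume t: "t \<in> {a..b}"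
    have "((\<lambda>t. Re (cnj (v / of_real L) * F (Complex s t))) has_vector_derivative
            Re (cnj (v / of_real L) * (\<i> * deriv F (Complex s t)))) (at t within {a..b})"
      by (intro bounded_linear.has_vector_derivative[OF bounded_linear_Re] has_vector_derivative_mult_right der t)
    then show "((\<lambda>t. 2 * Re (cnj (v / of_real L) * F (Complex s t)) - (cmod v)\<^sup>2 / L\<^sup>2 * t) has_vector_derivative q t) (at t within {a..b})"
      unfolding q_def has_real_derivative_iff_has_vector_derivative[symmetric]
      by (intro DERIV_diff DERIV_cmult DERIV_cmult_Id)
  qed
  also have "(2 * Re (cnj (v / of_real L) * F (Complex s b)) - (cmod v)\<^sup>2 / L\<^sup>2 * b)
        - (2 * Re (cnj (v / of_real L) * F (Complex s a)) - (cmod v)\<^sup>2 / L\<^sup>2 * a)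
      = 2 * Re (cnj (v / of_real L) * v) - (cmod v)\<^sup>2 / L\<^sup>2 * L"
  proof -
    have gen: "(2 * Re (w * X) - K * b) - (2 * Re (w * Y) - K * a) = 2 * Re (w * (X - Y)) - K * (b - a)" for w X Y K
      by (simp add: algebra_simps)
    show ?thesis unfolding gen by (simp add: v_def L_def)
  qed
  also have "cnj (v / of_real L) * v = of_real ((cmod v)\<^sup>2 / L)"
    by (simp add: complex_norm_square[symmetric] mult.commute)
  also have "2 * Re (of_real ((cmod v)\<^sup>2 / L)) - (cmod v)\<^sup>2 / L\<^sup>2 * L = (cmod v)\<^sup>2 / L"
    using L by (simp add: power2_eq_square field_simps)
  finally have qint: "(q has_integral (cmod v)\<^sup>2 / L) {a..b}" .
  have contD: "continuous_on {a..b} (\<lambda>t. (cmod (deriv F (Complex s t)))\<^sup>2)"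
  proof (intro continuous_intros)
    have "continuous_on S (deriv F)"
      using hol S holomorphic_deriv holomorphic_on_imp_continuous_on by blast
    then show "continuous_on {a..b} (\<lambda>t. deriv F (Complex s t))"
    proof (rule continuous_on_compose2)
      show "continuous_on {a..b} (\<lambda>t. Complex s t)"
        unfolding Complex_eq[abs_def] by (intro continuous_intros)
    qed (use sub in auto)
  qed
  obtain I where I: "((\<lambda>t. (cmod (deriv F (Complex s t)))\<^sup>2) has_integral I) {a..b}"
    using integrable_continuous_interval[OF contD] by (auto simp: integrable_on_def)
  have le: "q t \<le> (cmod (deriv F (Complex s t)))\<^sup>2" for t
  proof -
    have "0 \<le> (cmod (\<i> * deriv F (Complex s t) - v / of_real L))\<^sup>2" by (rule zero_le_power2)
    moreover have "(cmod (\<i> * deriv F (Complex s t) - v / of_real L))\<^sup>2 = (cmod (\<i> * deriv F (Complex s t)))\<^sup>2 + (cmod (v / of_real L))\<^sup>2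
          - 2 * Re (cnj (v / of_real L) * (\<i> * deriv F (Complex s t)))"
    proof -
      have "(cmod (x - y))\<^sup>2 = (cmod x)\<^sup>2 + (cmod y)\<^sup>2 - 2 * Re (cnj y * x)" for x y :: complex
        unfolding cmod_power2 by (simp add: power2_eq_square algebra_simps)
      then show ?thesis by blast
    qed
    moreover have "(cmod (v / of_real L))\<^sup>2 = (cmod v)\<^sup>2 / L\<^sup>2"
      by (simp add: norm_divide power_divide)
    moreover have "(cmod (\<i> * deriv F (Complex s t)))\<^sup>2 = (cmod (deriv F (Complex s t)))\<^sup>2"
      by (simp add: norm_mult)
    ultimately show ?thesis
      unfolding q_def by linarith
  qed
  have vI: "(cmod v)\<^sup>2 / L \<le> I" using has_integral_le[OF qint I le] .
  have int_eq: "(\<integral>\<^sup>+t. ennreal ((cmod (deriv F (Complex s t)))\<^sup>2) * indicator {a..b} t \<partial>lborel) = ennreal I"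
  proof -
    let ?g = "\<lambda>t. indicator {a..b} t *\<^sub>R (cmod (deriv F (Complex s t)))\<^sup>2"
    have "((\<lambda>t. if t \<in> {a..b} then (cmod (deriv F (Complex s t)))\<^sup>2 else 0) has_integral I) UNIV"
      using I by (simp only: has_integral_restrict_UNIV)
    also have "(\<lambda>t. if t \<in> {a..b} then (cmod (deriv F (Complex s t)))\<^sup>2 else 0) = ?g"
      by (auto simp: indicator_def)
    finally have "(?g has_integral I) UNIV" .
    moreover have "?g \<in> borel_measurable borel"
      using contD by (intro borel_measurable_continuous_on_indicator) auto
    ultimately have "integral\<^sup>N lborel (\<lambda>t. ennreal (?g t)) = ennreal I"
      by (intro nn_integral_has_integral_lborel) auto
    moreover have "(\<lambda>t. ennreal (?g t)) = (\<lambda>t. ennreal ((cmod (deriv F (Complex s t)))\<^sup>2) * indicator {a..b} t)"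
      by (auto simp: indicator_def fun_eq_iff)
    ultimately show ?thesis by (simp only:)
  qed
  have dist_eq: "dist (F (Complex s a)) (F (Complex s b)) = cmod v"
    by (simp add: v_def dist_norm norm_minus_commute)
  show ?thesis unfolding dist_eq int_eq L_def[symmetric] using vI by (rule ennreal_leI)
qed

text \<open>The length-area argument: the energies of the vertical segments add up to a finite area,
  while the strip is infinitely long to the left, so arbitrarily far out there are segments with
  arbitrarily little energy.\<close>

lemma exists_short_vertical_segment:
  fixes F :: "complex \<Rightarrow> complex" and s0 e :: real
  defines "S \<equiv> {z. \<bar>Im z\<bar> < pi/2}"
  assumes hol: "F holomorphic_on S" and inj: "inj_on F S" and bd: "bounded (F ` S)" and "e > 0"
  obtains s where "s < s0"
    "\<And>a b. \<bar>a\<bar> < pi/2 \<Longrightarrow> \<bar>b\<bar> < pi/2 \<Longrightarrow> (dist (F (Complex s a)) (F (Complex s b)))\<^sup>2 \<le> e * \<bar>b - a\<bar>"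
proof -
  have S: "open S" unfolding S_def by (intro open_Collect_less continuous_intros)
  define k where "k = (\<lambda>x. ennreal ((cmod (deriv F (Complex (fst x) (snd x))))\<^sup>2) * indicator {x. Complex (fst x) (snd x) \<in> S} x)"
  have fin: "(\<integral>\<^sup>+x. k x \<partial>(lborel :: (real \<times> real) measure)) < \<infinity>"
    unfolding k_def by (rule nn_integral_deriv_square_finite[OF S hol inj bd])
  have km: "k \<in> borel_measurable (lborel \<Otimes>\<^sub>M lborel)"
    unfolding k_def lborel_prod using borel_measurable_deriv_square[OF S hol] by simp
  have fin2: "(\<integral>\<^sup>+s. (\<integral>\<^sup>+t. k (s,t) \<partial>lborel) \<partial>lborel) < \<infinity>"
    using lborel.nn_integral_fst[OF km] fin by (simp add: lborel_prod)
  have "\<exists>s<s0. (\<integral>\<^sup>+t. k (s,t) \<partial>lborel) \<le> ennreal e"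
  proof (rule ccontr)
    assume "\<not> ?thesis"
    then have gt: "ennreal e \<le> (\<integral>\<^sup>+t. k (s,t) \<partial>lborel)" if "s < s0" for s
      using that by (auto simp: not_le)
    \<comment> \<open>Energy at least \<open>e\<close> on every segment left of \<open>s0\<close>
      makes the area at least \<open>e * n\<close> for every \<open>n\<close>; the interval of
      length \<open>n\<close> ends at \<open>s0 - 1\<close> to stay strictly left of
      \<open>s0\<close>.\<close>
    have le: "ennreal (e * real n) \<le> (\<integral>\<^sup>+s. (\<integral>\<^sup>+t. k (s,t) \<partial>lborel) \<partial>lborel)" for n
    proof -
      have "ennreal (e * real n) = (\<integral>\<^sup>+s. ennreal e * indicator {s0 - real n - 1 .. s0 - 1} s \<partial>lborel)"
      proof -
        have "emeasure lborel {s0 - real n - 1 .. s0 - 1} = ennreal (real n)" by (subst emeasure_lborel_Icc) auto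
        then show ?thesis using \<open>e > 0\<close> by (subst nn_integral_cmult_indicator) (auto intro!: ennreal_mult)
      qed
      also have "\<dots> \<le> (\<integral>\<^sup>+s. (\<integral>\<^sup>+t. k (s,t) \<partial>lborel) \<partial>lborel)"
        by (intro nn_integral_mono) (auto simp: indicator_def intro!: gt)
      finally show ?thesis .
    qed
    obtain r where r: "(\<integral>\<^sup>+s. (\<integral>\<^sup>+t. k (s,t) \<partial>lborel) \<partial>lborel) = ennreal r" "r \<ge> 0"
      using fin2 by (cases "\<integral>\<^sup>+s. (\<integral>\<^sup>+t. k (s,t) \<partial>lborel) \<partial>lborel" rule: ennreal_cases) auto
    obtain n where "real n > r / e" using reals_Archimedean2 by blast
    then have "e * real n > r" using \<open>e > 0\<close> by (simp add: field_simps)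
    moreover have "e * real n \<le> r" using le[of n] r by (simp add: ennreal_le_iff)
    ultimately show False by simp
  qed
  then obtain s where s: "s < s0" "(\<integral>\<^sup>+t. k (s,t) \<partial>lborel) \<le> ennreal e" by blast
  have *: "(dist (F (Complex s a)) (F (Complex s b)))\<^sup>2 \<le> e * (b - a)"
    if ab: "\<bar>a\<bar> < pi/2" "\<bar>b\<bar> < pi/2" "a < b" for a b
  proof -
    have "ennreal ((dist (F (Complex s a)) (F (Complex s b)))\<^sup>2 / (b - a))
       \<le> (\<integral>\<^sup>+t. ennreal ((cmod (deriv F (Complex s t)))\<^sup>2) * indicator {a..b} t \<partial>lborel)"
      by (rule vertical_displacement_le[OF hol S]) (use that in \<open>auto simp: S_def\<close>)
    also have "\<dots> \<le> (\<integral>\<^sup>+t. k (s,t) \<partial>lborel)"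
      using ab by (intro nn_integral_mono) (auto simp: k_def S_def indicator_def)
    also note s(2)
    finally have "ennreal ((dist (F (Complex s a)) (F (Complex s b)))\<^sup>2 / (b - a)) \<le> ennreal e" .
    then have "(dist (F (Complex s a)) (F (Complex s b)))\<^sup>2 / (b - a) \<le> e"
      using \<open>e > 0\<close> ennreal_le_iff[of e] by (metis less_imp_le)
    then show ?thesis using ab by (simp add: field_simps)
  qed
  show ?thesis
  proof (rule that[OF s(1)])
    fix a b :: real assume ab: "\<bar>a\<bar> < pi/2" "\<bar>b\<bar> < pi/2"
    consider "a < b" | "a = b" | "b < a" by linarith
    then show "(dist (F (Complex s a)) (F (Complex s b)))\<^sup>2 \<le> e * \<bar>b - a\<bar>"
      by cases (use *[of a b] *[of b a] ab in \<open>auto simp: dist_commute\<close>)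
  qed
qed

section \<open>Crosscuts of a Jordan domain\<close>

lemma loop_freeD:
  "loop_free c \<Longrightarrow> c x = c y \<Longrightarrow> x \<in> {0..1} \<Longrightarrow> y \<in> {0..1} \<Longrightarrow> x = y \<or> x = 0 \<and> y = 1 \<or> x = 1 \<and> y = 0"
  by (simp add: loop_free_def)

text \<open>Compactness for the curve with a movable starting point: at parameters at least
  \<open>h\<close> away from the start on both sides, the distance to the starting point has a
  positive minimum, which serves as \<open>d\<close>. Points closer than \<open>d\<close> are thus
  within \<open>h\<close> in the parameter, and uniform continuity keeps the arc between them in the
  ball.\<close>

lemma closed_curve_short_arcs:
  fixes c :: "real \<Rightarrow> complex"
  assumes c: "simple_path c" "pathfinish c = pathstart c" and e: "e > 0"
  obtains d where "d > 0"
    "\<And>a b. a \<in> path_image c \<Longrightarrow> b \<in> path_image c \<Longrightarrow> a \<noteq> b \<Longrightarrow> dist a b < d \<Longrightarrow>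
       \<exists>u v. arc u \<and> arc v \<and> pathstart u = a \<and> pathfinish u = b \<and> pathstart v = a \<and> pathfinish v = b \<and>
         path_image u \<union> path_image v = path_image c \<and> path_image u \<inter> path_image v = {a, b} \<and> path_image u \<subseteq> ball a e"
proof -
  \<comment> \<open>\<open>G (t, s)\<close> is the point reached after time \<open>s\<close> by the
    curve started at time \<open>t\<close>; the two pieces of \<open>shiftpath\<close> fit together
    because the curve is closed.\<close>
  define G where "G = (\<lambda>x. shiftpath (fst x) c (snd x))"
  let ?Q = "{0..1::real} \<times> {0..1::real}"
  have contc: "continuous_on {0..1} c" using c(1) by (simp add: simple_path_def path_def)
  have contG: "continuous_on ?Q G"
    unfolding G_def shiftpath_def
  proof (rule continuous_on_cases_le)
    show "continuous_on {t \<in> ?Q. fst t + snd t \<le> 1} (\<lambda>x. c (fst x + snd x))"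
      by (rule continuous_on_compose2[OF contc]) (auto intro!: continuous_intros)
    show "continuous_on {t \<in> ?Q. 1 \<le> fst t + snd t} (\<lambda>x. c (fst x + snd x - 1))"
      by (rule continuous_on_compose2[OF contc]) (auto intro!: continuous_intros)
    show "continuous_on ?Q (\<lambda>t. fst t + snd t)" by (intro continuous_intros)
    show "c (fst t + snd t) = c (fst t + snd t - 1)" if "fst t + snd t = 1" for t :: "real \<times> real"
      using that c(2) by (simp add: pathstart_def pathfinish_def)
  qed
  have sh: "simple_path (shiftpath t c)" "pathstart (shiftpath t c) = c t" "pathfinish (shiftpath t c) = c t"
     "path_image (shiftpath t c) = path_image c" if "t \<in> {0..1}" for t
    using that c by (auto simp: simple_path_shiftpath pathstart_shiftpath pathfinish_shiftpath path_image_shiftpath)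
  have G01: "G (t, 0) = c t" "G (t, 1) = c t" if "t \<in> {0..1}" for t
    using sh(2,3)[OF that] by (auto simp: G_def pathstart_def pathfinish_def)
  have "uniformly_continuous_on ?Q G"
    using contG by (intro compact_uniformly_continuous compact_Times) auto
  then obtain \<eta> where \<eta>: "\<eta> > 0" "\<And>x x'. x \<in> ?Q \<Longrightarrow> x' \<in> ?Q \<Longrightarrow> dist x' x < \<eta> \<Longrightarrow> dist (G x') (G x) < e"
    unfolding uniformly_continuous_on_def using e by metis
  define h where "h = min \<eta> (1/4)"
  have h: "0 < h" "h \<le> \<eta>" "h \<le> 1/4" using \<eta>(1) by (auto simp: h_def)
  let ?K = "{0..1::real} \<times> {h..1 - h}"
  have KQ: "?K \<subseteq> ?Q" using h by auto
  have "\<exists>x\<in>?K. \<forall>y\<in>?K. dist (G x) (c (fst x)) \<le> dist (G y) (c (fst y))"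
  proof (rule continuous_attains_inf)
    show "compact ?K" by (intro compact_Times) auto
    show "?K \<noteq> {}" using h by auto
    have "continuous_on ?K (\<lambda>x. c (fst x))"
      by (rule continuous_on_compose2[OF contc]) (auto intro!: continuous_intros)
    then show "continuous_on ?K (\<lambda>x. dist (G x) (c (fst x)))"
      by (intro continuous_intros continuous_on_subset[OF contG KQ])
  qed
  then obtain x0 where x0: "x0 \<in> ?K" "\<And>y. y \<in> ?K \<Longrightarrow> dist (G x0) (c (fst x0)) \<le> dist (G y) (c (fst y))"
    by blast
  have ne: "G x \<noteq> c (fst x)" if "x \<in> ?K" for x
  proof
    assume eq: "G x = c (fst x)"
    have t: "fst x \<in> {0..1}" using that by auto
    have "shiftpath (fst x) c (snd x) = shiftpath (fst x) c 0"
      using eq sh(2)[OF t] by (simp add: G_def pathstart_def)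
    moreover have "0 < snd x" "snd x < 1" using that h by auto
    ultimately show False
      using loop_freeD[of "shiftpath (fst x) c" "snd x" 0] sh(1)[OF t] by (auto simp: simple_path_def)
  qed
  show ?thesis
  proof (rule that[of "dist (G x0) (c (fst x0))"])
    show "dist (G x0) (c (fst x0)) > 0" using ne[OF x0(1)] by simp
    fix a b assume ab: "a \<in> path_image c" "b \<in> path_image c" "a \<noteq> b" "dist a b < dist (G x0) (c (fst x0))"
    obtain t where t: "t \<in> {0..1}" "a = c t" using ab(1) by (auto simp: path_image_def)
    define c' where "c' = shiftpath t c"
    obtain s where s: "s \<in> {0..1}" "b = c' s"
    proof -
      have "b \<in> shiftpath t c ` {0..1}" using ab(2) sh(4)[OF t(1)] by (simp add: path_image_def)
      then show thesis using that by (auto simp: c'_def)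
    qed
    have c'0: "c' 0 = a" "c' 1 = a" using sh[OF t(1)] t by (auto simp: c'_def pathstart_def pathfinish_def)
    have sp: "simple_path c'" using sh t(1) by (simp add: c'_def)
    have s01: "0 < s" "s < 1" using s ab(3) c'0 by (auto simp: less_le)
    have cG: "c' r = G (t, r)" for r by (simp add: c'_def G_def)
    have sK: "s \<notin> {h..1-h}"
    proof
      assume "s \<in> {h..1-h}"
      then have "(t, s) \<in> ?K" using t by auto
      from x0(2)[OF this] show False using ab(4) t s by (simp add: cG dist_commute)
    qed
    define u where "u = subpath 0 s c'"
    define v where "v = subpath 1 s c'"
    have uv: "arc u" "arc v" "pathstart u = a" "pathfinish u = b" "pathstart v = a" "pathfinish v = b"
      using sp s s01 c'0 ab(3) by (auto simp: u_def v_def arc_simple_path_subpath)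
    have pu: "path_image u = c' ` {0..s}" and pv: "path_image v = c' ` {s..1}"
      using s01 by (auto simp: u_def v_def path_image_subpath)
    have un: "path_image u \<union> path_image v = path_image c"
    proof -
      have "path_image u \<union> path_image v = c' ` {0..1}"
        unfolding pu pv image_Un[symmetric] using s01 by (simp add: ivl_disj_un_two_touch)
      then show ?thesis using sh(4)[OF t(1)] by (simp add: c'_def path_image_def)
    qed
    have inter: "path_image u \<inter> path_image v = {a, b}"
    proof
      show "{a, b} \<subseteq> path_image u \<inter> path_image v"
        using s01 s c'0 unfolding pu pv by (auto simp: image_iff) (metis atLeastAtMost_iff less_imp_le order_refl)+
      show "path_image u \<inter> path_image v \<subseteq> {a, b}"
      proof
        fix z assume "z \<in> path_image u \<inter> path_image v"
        then obtain r r' where r: "r \<in> {0..s}" "r' \<in> {s..1}" "z = c' r" "z = c' r'" unfolding pu pv by blast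
        then have "r = r' \<or> r = 0 \<and> r' = 1 \<or> r = 1 \<and> r' = 0"
          using loop_freeD[of c' r r'] sp s01 by (auto simp: simple_path_def)
        then show "z \<in> {a, b}" using r s01 c'0 s by auto
      qed
    qed
    consider "s < h" | "s > 1 - h" using sK by fastforce
    then show "\<exists>u v. arc u \<and> arc v \<and> pathstart u = a \<and> pathfinish u = b \<and> pathstart v = a \<and> pathfinish v = b \<and>
         path_image u \<union> path_image v = path_image c \<and> path_image u \<inter> path_image v = {a, b} \<and> path_image u \<subseteq> ball a e"
    proof cases
      case 1
      have "path_image u \<subseteq> ball a e"
      proof
        fix z assume "z \<in> path_image u"
        then obtain r where r: "r \<in> {0..s}" "z = c' r" unfolding pu by blast
        have "dist (G (t, r)) (G (t, 0)) < e"
          by (rule \<eta>(2)) (use r t s01 1 h in \<open>auto simp: dist_Pair_Pair\<close>)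
        then show "z \<in> ball a e" using r G01[OF t(1)] t by (simp add: cG dist_commute)
      qed
      then show ?thesis using uv un inter by blast
    next
      case 2
      have "path_image v \<subseteq> ball a e"
      proof
        fix z assume "z \<in> path_image v"
        then obtain r where r: "r \<in> {s..1}" "z = c' r" unfolding pv by blast
        have "dist (G (t, r)) (G (t, 1)) < e"
          by (rule \<eta>(2)) (use r t s01 2 h in \<open>auto simp: dist_Pair_Pair dist_real_def\<close>)
        then show "z \<in> ball a e" using r G01[OF t(1)] t by (simp add: cG dist_commute)
      qed
      then show ?thesis using uv un inter by (metis Un_commute Int_commute)
    qed
  qed
qed

lemma connected_inside_or_outside:
  fixes j :: "real \<Rightarrow> complex"
  assumes "simple_path j" "pathfinish j = pathstart j" and "connected A" "A \<inter> path_image j = {}"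
  shows "A \<subseteq> inside (path_image j) \<or> A \<subseteq> outside (path_image j)"
proof -
  have J: "open (inside (path_image j))" "open (outside (path_image j))"
    "inside (path_image j) \<inter> outside (path_image j) = {}" "inside (path_image j) \<union> outside (path_image j) = - path_image j"
    using Jordan_inside_outside[OF assms(1,2)] by auto
  show ?thesis
    using connectedD[OF assms(3) J(1,2)] J(3,4) assms(4) by blast
qed

text \<open>The outside of \<open>c\<close> is connected, unbounded and disjoint from
  \<open>j\<close>, hence outside \<open>j\<close>. Points of \<open>c\<close> are limits of it, so
  they cannot lie in the open inside of \<open>j\<close> either.\<close>

lemma inside_curve_subset_inside:
  fixes c j :: "real \<Rightarrow> complex"
  assumes c: "simple_path c" "pathfinish c = pathstart c" and j: "simple_path j" "pathfinish j = pathstart j"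
    and sub: "path_image j \<subseteq> inside (path_image c) \<union> path_image c"
  shows "inside (path_image j) \<subseteq> inside (path_image c)"
proof -
  note C = Jordan_inside_outside[OF c] and J = Jordan_inside_outside[OF j]
  have "outside (path_image c) \<inter> path_image j = {}" using sub C by blast
  then have "outside (path_image c) \<subseteq> inside (path_image j) \<or> outside (path_image c) \<subseteq> outside (path_image j)"
    by (intro connected_inside_or_outside[OF j]) (use C in auto)
  then have out: "outside (path_image c) \<subseteq> outside (path_image j)"
    using C J bounded_subset[of "inside (path_image j)" "outside (path_image c)"] by metis
  have "inside (path_image j) \<inter> closure (outside (path_image c)) = {}"
  proof -
    have "open (inside (path_image j))" "inside (path_image j) \<inter> outside (path_image c) = {}"
      using out J by (metis, blast)
    then show ?thesis by (simp add: open_Int_closure_eq_empty)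
  qed
  moreover have "path_image c \<subseteq> closure (outside (path_image c))"
    using C by (metis closure_Un_frontier Un_upper2)
  ultimately have "inside (path_image j) \<inter> (outside (path_image c) \<union> path_image c) = {}"
    using closure_subset[of "outside (path_image c)"] by blast
  then show ?thesis using C by blast
qed

text \<open>The small side is the inside of the closed curve formed by the crosscut and the short arc of the boundary.\<close>

lemma crosscut_small_side:
  fixes c p :: "real \<Rightarrow> complex"
  assumes c: "simple_path c" "pathfinish c = pathstart c"
    and d: "\<And>a b. a \<in> path_image c \<Longrightarrow> b \<in> path_image c \<Longrightarrow> a \<noteq> b \<Longrightarrow> dist a b < d \<Longrightarrow>
       \<exists>u v. arc u \<and> arc v \<and> pathstart u = a \<and> pathfinish u = b \<and> pathstart v = a \<and> pathfinish v = b \<and>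
         path_image u \<union> path_image v = path_image c \<and> path_image u \<inter> path_image v = {a, b} \<and> path_image u \<subseteq> ball a e"
    and p: "path p" "p 0 \<in> path_image c" "p 1 \<in> path_image c" "p ` {0<..<1} \<subseteq> inside (path_image c)"
    and inj: "inj_on p {0<..<1}"
    and sm: "\<And>t. t \<in> {0..1} \<Longrightarrow> dist (p 0) (p t) < min d e"
    and AB: "connected A" "connected B" "A \<union> B = inside (path_image c) - p ` {0<..<1}"
    and z0: "z0 \<in> B" "dist (p 0) z0 \<ge> e"
  shows "A \<subseteq> ball (p 0) e"
proof -
  note C = Jordan_inside_outside[OF c]
  have img: "path_image p = insert (p 0) (insert (p 1) (p ` {0<..<1}))"
  proof -
    have "{0..1::real} = insert 0 (insert 1 {0<..<1})" by auto
    then show ?thesis by (simp add: path_image_def)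
  qed
  have pin: "p t \<in> inside (path_image c)" "p t \<noteq> p 0" "p t \<noteq> p 1" if "t \<in> {0<..<1}" for t
  proof -
    show "p t \<in> inside (path_image c)" using p(4) that by blast
    then have "p t \<notin> path_image c" using inside_no_overlap by blast
    then show "p t \<noteq> p 0" "p t \<noteq> p 1" using p(2,3) by auto
  qed
  have ballp: "path_image p \<subseteq> ball (p 0) e" using sm by (auto simp: path_image_def)
  have ABp: "A \<inter> path_image p = {}" "B \<inter> path_image p = {}"
  proof -
    have "A \<union> B \<subseteq> - path_image p"
      using AB(3) p(2,3) inside_no_overlap[of "path_image c"] unfolding img by blast
    then show "A \<inter> path_image p = {}" "B \<inter> path_image p = {}" by blast+
  qed
  have in_ball: "inside S \<subseteq> ball (p 0) e" if "S \<subseteq> ball (p 0) e" for S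
    using outside_subset_convex[OF convex_ball that] by (auto simp: outside_inside)
  show ?thesis
  proof (cases "p 0 = p 1")
    \<comment> \<open>Both ends of the crosscut may be the same boundary point. Then the crosscut is
      itself a closed curve and no arc of \<open>c\<close> is involved.\<close>
    case True
    have loop: "simple_path p" "pathfinish p = pathstart p"
      using True p(1) pin inj_onD[OF inj]
      unfolding simple_path_def loop_free_def pathstart_def pathfinish_def
      by (auto, (metis greaterThanLessThan_iff less_eq_real_def)+)
    note J = Jordan_inside_outside[OF loop]
    have inV: "inside (path_image p) \<subseteq> inside (path_image c)"
      by (rule inside_curve_subset_inside[OF c loop]) (use p img in auto)
    have small: "inside (path_image p) \<subseteq> ball (p 0) e" by (rule in_ball[OF ballp])
    have "z0 \<notin> inside (path_image p)" using small z0 by auto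
    then have "B \<inter> inside (path_image p) = {}"
      using connected_inside_or_outside[OF loop AB(2) ABp(2)] J z0(1) by blast
    moreover have "inside (path_image p) \<subseteq> A \<union> B"
    proof -
      have "p ` {0<..<1} \<inter> inside (path_image p) = {}"
        using inside_no_overlap[of "path_image p"] unfolding img by blast
      then show ?thesis using inV AB(3) by blast
    qed
    moreover have "inside (path_image p) \<noteq> {}" using J by (rule conjunct1)
    ultimately have "A \<inter> inside (path_image p) \<noteq> {}" by blast
    then have "A \<subseteq> inside (path_image p)"
      using connected_inside_or_outside[OF loop AB(1) ABp(1)] inside_Int_outside[of "path_image p"] by blast
    then show ?thesis using small by blast
  next
    case False
    have arcp: "arc p"
      unfolding arc_def inj_on_def
    proof (intro conjI ballI impI p(1))
      fix x y assume xy: "x \<in> {0..1}" "y \<in> {0..1}" "p x = p y"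
      have "x = 0 \<or> x = 1 \<or> x \<in> {0<..<1}" "y = 0 \<or> y = 1 \<or> y \<in> {0<..<1}" using xy by auto
      then show "x = y" using xy(3) False pin inj_onD[OF inj] by metis
    qed
    have "dist (p 0) (p 1) < d" using sm[of 1] by auto
    from d[OF p(2,3) False this] obtain u v where uv: "arc u" "arc v" "pathstart u = p 0" "pathfinish u = p 1"
      "pathstart v = p 0" "pathfinish v = p 1" "path_image u \<union> path_image v = path_image c"
      "path_image u \<inter> path_image v = {p 0, p 1}" "path_image u \<subseteq> ball (p 0) e" by metis
    have pi: "path_image c \<inter> path_image p = {p 0, p 1}" using p pin C unfolding img by blast
    have up: "path_image u \<inter> path_image p = {p 0, p 1}" "path_image v \<inter> path_image p = {p 0, p 1}"
      using pi uv(7,8) by blast+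
    have ends: "pathstart p = p 0" "pathfinish p = p 1" by (auto simp: pathstart_def pathfinish_def)
    have ne: "path_image p \<inter> inside (path_image u \<union> path_image v) \<noteq> {}"
    proof -
      have "p (1/2) \<in> path_image p \<inter> inside (path_image c)" using p by (auto simp: path_image_def)
      then show ?thesis using uv(7) by auto
    qed
    obtain split: "inside (path_image u \<union> path_image p) \<inter> inside (path_image v \<union> path_image p) = {}"
        "inside (path_image u \<union> path_image p) \<union> inside (path_image v \<union> path_image p) \<union> (path_image p - {p 0, p 1})
           = inside (path_image u \<union> path_image v)"
      by (rule split_inside_simple_closed_curve[of u "p 0" "p 1" v p])
        (use uv arcp up ne False ends in \<open>auto simp: arc_imp_simple_path\<close>)
    let ?U = "inside (path_image u \<union> path_image p)" and ?V = "inside (path_image v \<union> path_image p)"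
    have lu: "simple_path (u +++ reversepath p)" "pathfinish (u +++ reversepath p) = pathstart (u +++ reversepath p)"
       "path_image (u +++ reversepath p) = path_image u \<union> path_image p"
      using uv arcp up ends by (auto simp: simple_path_join_loop_eq arc_reversepath path_image_join)
    have lv: "simple_path (v +++ reversepath p)" "pathfinish (v +++ reversepath p) = pathstart (v +++ reversepath p)"
       "path_image (v +++ reversepath p) = path_image v \<union> path_image p"
      using uv arcp up ends by (auto simp: simple_path_join_loop_eq arc_reversepath path_image_join)
    have U: "open ?U" "?U \<noteq> {}" using Jordan_inside_outside[OF lu(1,2)] unfolding lu(3) by auto
    have V: "open ?V" using Jordan_inside_outside[OF lv(1,2)] unfolding lv(3) by auto
    have small: "?U \<subseteq> ball (p 0) e" using in_ball uv(9) ballp by blast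
    have pm: "path_image p - {p 0, p 1} = p ` {0<..<1}" unfolding img using pin by auto
    have disj: "p ` {0<..<1} \<inter> (?U \<union> ?V) = {}"
      unfolding pm[symmetric] by (simp add: inside_def, blast)
    have UV: "A \<union> B = ?U \<union> ?V" using AB(3) split(2) disj unfolding uv(7) pm by blast
    have one: "D \<subseteq> ?U \<or> D \<subseteq> ?V" if "connected D" "D \<subseteq> A \<union> B" for D
      using connectedD[OF that(1) U(1) V] split(1) that(2) UV by blast
    \<comment> \<open>The point \<open>z0\<close> is too far away to be on the small side, which
      puts \<open>B\<close> on the other side and leaves the small one to \<open>A\<close>.\<close>
    have "z0 \<notin> ?U" using small z0 by auto
    then have "B \<subseteq> ?V" using one[OF AB(2)] z0 by blast
    then have "A \<inter> ?U \<noteq> {}" using UV U(2) split(1) by blast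
    then have "A \<subseteq> ?U" using one[OF AB(1)] split(1) by blast
    then show ?thesis using small by blast
  qed
qed

section \<open>Boundary values of the Riemann map\<close>

text \<open>A vertical segment with little energy becomes a crosscut of small diameter. It separates
  the image of the end of the strip from \<open>F 0\<close>, which is far from the crosscut, so the
  image of the end is on the small side.\<close>

lemma strip_end_small:
  fixes F G :: "complex \<Rightarrow> complex" and c :: "real \<Rightarrow> complex"
  defines "S \<equiv> {z. \<bar>Im z\<bar> < pi/2}"
  assumes c: "simple_path c" "pathfinish c = pathstart c"
    and F: "F holomorphic_on S" "F ` S = inside (path_image c)"
    and G: "continuous_on (inside (path_image c)) G" "\<And>z. z \<in> S \<Longrightarrow> G (F z) = z"
    and e: "e > 0"
  obtains s a where "F ` {z \<in> S. Re z < s} \<subseteq> ball a e"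
proof -
  let ?V = "inside (path_image c)"
  have V: "open ?V" "bounded ?V" "frontier ?V = path_image c"
    using Jordan_inside_outside[OF c] by simp_all
  have inj: "inj_on F S" using G(2) by (metis inj_on_inverseI)
  have GS: "G w \<in> S" if "w \<in> ?V" for w using that G(2) F(2) by (metis imageE)
  have contF: "continuous_on S F" using F(1) holomorphic_on_imp_continuous_on by blast
  have "0 \<in> S" by (simp add: S_def)
  then have "F 0 \<in> ?V" using F(2) by blast
  then obtain r where r: "r > 0" "ball (F 0) r \<subseteq> ?V" using V(1) openE by blast
  \<comment> \<open>\<open>F 0\<close> has distance at least \<open>r\<close> from the boundary
    curve, so it is not in a ball of radius at most \<open>r\<close> around a boundary
    point.\<close>
  define e1 where "e1 = min e r"
  have e1: "e1 > 0" using e r by (simp add: e1_def)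
  obtain d where d: "d > 0"
    "\<And>a b. a \<in> path_image c \<Longrightarrow> b \<in> path_image c \<Longrightarrow> a \<noteq> b \<Longrightarrow> dist a b < d \<Longrightarrow>
       \<exists>u v. arc u \<and> arc v \<and> pathstart u = a \<and> pathfinish u = b \<and> pathstart v = a \<and> pathfinish v = b \<and>
         path_image u \<union> path_image v = path_image c \<and> path_image u \<inter> path_image v = {a, b} \<and> path_image u \<subseteq> ball a e1"
    using closed_curve_short_arcs[OF c e1] by blast
  define m where "m = min d e1"
  have m: "m > 0" using d e1 by (simp add: m_def)
  \<comment> \<open>The segments are shorter than \<open>4\<close>, so squared distances on the
    image are at most \<open>4 * K\<close>, the square of \<open>m / 2\<close>.\<close>
  define K where "K = m\<^sup>2/16"
  have K: "K > 0" using m by (simp add: K_def)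
  have bdF: "bounded (F ` S)" using V F by simp
  obtain s where s: "s < 0"
    "\<And>a b. \<bar>a\<bar> < pi/2 \<Longrightarrow> \<bar>b\<bar> < pi/2 \<Longrightarrow> (dist (F (Complex s a)) (F (Complex s b)))\<^sup>2 \<le> K * \<bar>b - a\<bar>"
    using exists_short_vertical_segment[of F K 0] F(1) inj bdF K unfolding S_def by blast
  define I where "I = {-(pi/2)<..<pi/2}"
  have I: "\<bar>a\<bar> < pi/2" if "a \<in> I" for a using that by (auto simp: I_def)
  have clI: "closure I = {-(pi/2)..pi/2}" unfolding I_def by (rule closure_greaterThanLessThan) simp
  define q where "q = (\<lambda>a. F (Complex s a))"
  \<comment> \<open>On the segment the map is Hoelder continuous with exponent \<open>1/2\<close>,
    so it extends to the two end points.\<close>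
  have "uniformly_continuous_on I q"
    unfolding uniformly_continuous_on_def
  proof (intro allI impI)
    fix \<epsilon> :: real assume \<epsilon>: "\<epsilon> > 0"
    have "dist (q b) (q a) < \<epsilon>" if ab: "a \<in> I" "b \<in> I" "dist b a < \<epsilon>\<^sup>2 / K" for a b
    proof -
      have "(dist (q b) (q a))\<^sup>2 \<le> K * \<bar>a - b\<bar>" unfolding q_def using s(2)[OF I I] ab by blast
      also have "\<dots> < K * (\<epsilon>\<^sup>2 / K)"
        using ab(3) K by (intro mult_strict_left_mono) (auto simp: dist_real_def abs_minus_commute)
      also have "\<dots> = \<epsilon>\<^sup>2" using K by simp
      finally show ?thesis using \<epsilon> by (simp add: power2_less_imp_less)
    qed
    then show "\<exists>d>0. \<forall>x\<in>I. \<forall>x'\<in>I. dist x' x < d \<longrightarrow> dist (q x') (q x) < \<epsilon>"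
      using \<epsilon> K by (intro exI[of _ "\<epsilon>\<^sup>2 / K"]) auto
  qed
  then obtain g where g: "uniformly_continuous_on (closure I) g" "\<And>x. x \<in> I \<Longrightarrow> q x = g x"
    using uniformly_continuous_on_extension_on_closure by metis
  have contg: "continuous_on (closure I) g" using g(1) uniformly_continuous_imp_continuous by blast
  have CS: "Complex s a \<in> S" if "a \<in> I" for a using I[OF that] by (simp add: S_def)
  have gV: "g a \<in> ?V" if "a \<in> I" for a using g(2)[OF that] imageI[OF CS[OF that], of F] unfolding F(2) q_def by simp
  have Gg: "G (g a) = Complex s a" if "a \<in> I" for a
    using G(2)[OF CS[OF that]] g(2)[OF that] by (simp add: q_def)
  \<comment> \<open>The continuous inverse \<open>G\<close> would carry an end point in the open
    domain to an end point of the segment, which is not in the strip.\<close>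
  have ends: "g x \<in> path_image c" if x: "\<bar>x\<bar> = pi/2" for x
  proof (rule ccontr)
    assume no: "g x \<notin> path_image c"
    have xc: "x \<in> closure I" using x by (auto simp: clI abs_if split: if_splits)
    have xI: "x \<notin> I" using x I by fastforce
    have "g ` closure I \<subseteq> closure ?V"
      by (rule image_closure_subset[OF contg closed_closure]) (use gV closure_subset in blast)
    then have "g x \<in> ?V" using xc no V(3) closure_Un_frontier[of ?V] by blast
    have "insert x I \<subseteq> closure I" using xc closure_subset by blast
    then have "continuous_on (insert x I) g" using contg continuous_on_subset by blast
    then have "continuous_on (insert x I) (\<lambda>a. G (g a))"
      by (rule continuous_on_compose2[OF G(1)]) (use gV \<open>g x \<in> ?V\<close> in auto)
    then have "((\<lambda>a. G (g a)) \<longlongrightarrow> G (g x)) (at x within I)"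
      by (meson continuous_on_def insertI1 subset_insertI tendsto_within_subset)
    moreover have "((\<lambda>a. G (g a)) \<longlongrightarrow> Complex s x) (at x within I)"
    proof (rule Lim_transform_within[of "\<lambda>a. Complex s a" _ _ _ 1])
      have "continuous_on UNIV (\<lambda>a. Complex s a)" unfolding Complex_eq[abs_def] by (intro continuous_intros)
      then show "((\<lambda>a. Complex s a) \<longlongrightarrow> Complex s x) (at x within I)"
        by (metis continuous_on_def UNIV_I subset_UNIV tendsto_within_subset)
    qed (use Gg in auto)
    moreover have "at x within I \<noteq> bot"
      using xc xI by (simp add: at_within_eq_bot_iff)
    ultimately have "G (g x) = Complex s x" using tendsto_unique by blast
    then show False using GS[OF \<open>g x \<in> ?V\<close>] x by (simp add: S_def)
  qed
  have small: "dist (g a) (g b) \<le> m/2" if ab: "a \<in> closure I" "b \<in> closure I" for a b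
  proof -
    have 1: "dist (g a) (g b) \<le> m/2" if "a \<in> I" "b \<in> I" for a b
    proof -
      have "(dist (g a) (g b))\<^sup>2 \<le> K * \<bar>b - a\<bar>"
        unfolding g(2)[OF that(1), symmetric] g(2)[OF that(2), symmetric] q_def
        by (rule s(2)[OF I I, OF that])
      also have "\<dots> \<le> K * 4"
        using I[OF that(1)] I[OF that(2)] pi_less_4 K by (intro mult_left_mono) auto
      also have "\<dots> = (m/2)\<^sup>2" by (simp add: K_def power_divide)
      finally show ?thesis by (rule power2_le_imp_le) (use m in simp)
    qed
    have 2: "dist (g a) (g b) \<le> m/2" if "a \<in> I" "b \<in> closure I" for a b
    proof (rule continuous_le_on_closure[of I "\<lambda>b. dist (g a) (g b)"])
      show "continuous_on (closure I) (\<lambda>b. dist (g a) (g b))" by (intro continuous_intros contg)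
    qed (use that 1 in auto)
    show ?thesis
    proof (rule continuous_le_on_closure[of I "\<lambda>a. dist (g a) (g b)"])
      show "continuous_on (closure I) (\<lambda>a. dist (g a) (g b))" by (intro continuous_intros contg)
    qed (use ab 2 in auto)
  qed
  define p where "p = (\<lambda>t. g (pi * (t - 1/2)))"
  have sc: "pi * (t - 1/2) \<in> closure I" if "t \<in> {0..1}" for t
  proof -
    have "pi * (t - 1/2) \<le> pi * (1/2)" "pi * (-1/2) \<le> pi * (t - 1/2)"
      using that by (auto simp del: mult_minus_right simp: field_simps)
    then show ?thesis by (simp add: clI)
  qed
  have sI: "pi * (t - 1/2) \<in> I" if "t \<in> {0<..<1}" for t
  proof -
    have "pi * (t - 1/2) < pi * (1/2)" "pi * (-1/2) < pi * (t - 1/2)"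
      using that by (auto simp: field_simps)
    then show ?thesis by (simp add: I_def)
  qed
  have pathp: "path p" unfolding path_def p_def
    by (rule continuous_on_compose2[OF contg]) (use sc in \<open>auto intro!: continuous_intros\<close>)
  have p0: "p 0 \<in> path_image c" "p 1 \<in> path_image c" by (auto simp: p_def intro!: ends)
  have pI: "p ` {0<..<1} = F ` {z \<in> S. Re z = s}"
  proof (intro equalityI subsetI)
    fix w assume "w \<in> p ` {0<..<1}"
    then obtain t where "t \<in> {0<..<1}" "w = p t" by blast
    then show "w \<in> F ` {z \<in> S. Re z = s}"
      using g(2)[OF sI] CS[OF sI] by (auto simp: p_def q_def intro!: image_eqI[of _ _ "Complex s (pi * (t - 1/2))"])
  next
    fix w assume "w \<in> F ` {z \<in> S. Re z = s}"
    then obtain z where z: "z \<in> S" "Re z = s" "w = F z" by blast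
    define t where "t = Im z / pi + 1/2"
    have t: "t \<in> {0<..<1}" "pi * (t - 1/2) = Im z"
      using z(1) by (auto simp: t_def S_def field_simps)
    have "p t = F (Complex s (Im z))" using g(2)[OF sI[OF t(1)]] t(2) by (simp add: p_def q_def)
    also have "Complex s (Im z) = z" using z(2) by (simp add: complex_eq_iff)
    finally show "w \<in> p ` {0<..<1}" using t(1) z(3) by (metis imageI)
  qed
  have pinj: "inj_on p {0<..<1}"
  proof (rule inj_onI)
    fix t t' assume tt: "t \<in> {0<..<1}" "t' \<in> {0<..<1}" "p t = p t'"
    have "Complex s (pi * (t - 1/2)) = G (p t)" unfolding p_def by (rule Gg[OF sI[OF tt(1)], symmetric])
    also have "\<dots> = Complex s (pi * (t' - 1/2))" unfolding tt(3) unfolding p_def by (rule Gg[OF sI[OF tt(2)]])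
    finally have "Im (Complex s (pi * (t - 1/2))) = Im (Complex s (pi * (t' - 1/2)))" by (rule arg_cong)
    then have "pi * (t - 1/2) = pi * (t' - 1/2)" unfolding complex.sel .
    then have "t - 1/2 = t' - 1/2" using mult_left_cancel[OF pi_neq_zero] by blast
    then show "t = t'" by linarith
  qed
  let ?A = "F ` {z \<in> S. Re z < s}" and ?B = "F ` {z \<in> S. Re z > s}"
  have cvxS: "convex S"
  proof -
    have "S = {z. Im z < pi/2} \<inter> {z. Im z > -(pi/2)}" by (auto simp: S_def)
    then show ?thesis by (simp only:) (intro convex_Int convex_halfspace_Im_lt convex_halfspace_Im_gt)
  qed
  have conA: "connected ?A" "connected ?B"
  proof -
    have "{z \<in> S. Re z < s} = S \<inter> {z. Re z < s}" "{z \<in> S. Re z > s} = S \<inter> {z. Re z > s}" by auto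
    then have cv: "convex {z \<in> S. Re z < s}" "convex {z \<in> S. Re z > s}"
      using cvxS by (simp_all add: convex_Int convex_halfspace_Re_lt convex_halfspace_Re_gt)
    have "continuous_on {z \<in> S. Re z < s} F" "continuous_on {z \<in> S. Re z > s} F"
      by (rule continuous_on_subset[OF contF], blast)+
    then show "connected ?A" "connected ?B"
      using connected_continuous_image convex_connected[OF cv(1)] convex_connected[OF cv(2)] by (blast, blast)
  qed
  have AB: "?A \<union> ?B = ?V - p ` {0<..<1}"
  proof -
    have "{z \<in> S. Re z < s} \<union> {z \<in> S. Re z > s} = S - {z \<in> S. Re z = s}" by auto
    then have "?A \<union> ?B = F ` (S - {z \<in> S. Re z = s})" by (metis image_Un)
    also have "\<dots> = F ` S - F ` {z \<in> S. Re z = s}" by (rule inj_on_image_set_diff[OF inj]) auto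
    finally show ?thesis using pI F(2) by simp
  qed
  have "?A \<subseteq> ball (p 0) e1"
  proof (rule crosscut_small_side[OF c d(2) pathp p0 _ pinj _ conA AB])
    show "p ` {0<..<1} \<subseteq> ?V" using pI F(2) by auto
    show "dist (p 0) (p t) < min d e1" if "t \<in> {0..1}" for t
    proof -
      have "dist (p 0) (p t) \<le> m/2" unfolding p_def by (rule small) (use sc[OF that] sc[of 0] in auto)
      then show ?thesis using m by (simp add: m_def)
    qed
    show "F 0 \<in> ?B" using s(1) \<open>0 \<in> S\<close> by auto
    have "p 0 \<notin> ball (F 0) r" using p0(1) r(2) inside_no_overlap by blast
    then show "e1 \<le> dist (p 0) (F 0)" by (simp add: e1_def dist_commute)
  qed auto
  then have "?A \<subseteq> ball (p 0) e" by (auto simp: e1_def)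
  then show ?thesis using that by blast
qed

text \<open>The images of the left ends of the strip are nested and become arbitrarily small; their
  common limit is located along the negative integers.\<close>

lemma strip_end_limit:
  fixes F G :: "complex \<Rightarrow> complex" and c :: "real \<Rightarrow> complex"
  defines "S \<equiv> {z. \<bar>Im z\<bar> < pi/2}"
  assumes c: "simple_path c" "pathfinish c = pathstart c"
    and F: "F holomorphic_on S" "F ` S = inside (path_image c)"
    and G: "continuous_on (inside (path_image c)) G" "\<And>z. z \<in> S \<Longrightarrow> G (F z) = z"
  obtains l where "\<And>e. e > 0 \<Longrightarrow> \<exists>s. \<forall>z\<in>S. Re z < s \<longrightarrow> dist (F z) l < e"
proof -
  have small: "\<exists>s a. \<forall>z\<in>S. Re z < s \<longrightarrow> dist a (F z) < e" if epos: "e > 0" for e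
  proof -
    obtain s a where "F ` {z \<in> S. Re z < s} \<subseteq> ball a e"
      using strip_end_small[OF c F[unfolded S_def] G(1) G(2)[unfolded S_def] epos] unfolding S_def by blast
    then show ?thesis by (intro exI[of _ s] exI[of _ a]) auto
  qed
  define x where "x = (\<lambda>n. F (of_real (- real n)))"
  have xS: "of_real (- real n) \<in> S" for n by (simp add: S_def)
  have "Cauchy x"
    unfolding Cauchy_altdef2
  proof (intro allI impI)
    fix e :: real assume "e > 0"
    then obtain s a where sa: "\<And>z. z \<in> S \<Longrightarrow> Re z < s \<Longrightarrow> dist a (F z) < e/2" using small[of "e/2"] by auto
    obtain n0 where n0: "real n0 > - s" using reals_Archimedean2 by blast
    have "dist a (x n) < e/2" if "n \<ge> n0" for n
    proof -
      have "real n \<ge> real n0" using that by simp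
      then have "Re (of_real (- real n)) < s" using n0 by simp
      then show ?thesis unfolding x_def using sa xS by blast
    qed
    then have "dist (x n) (x n0) < e" if "n \<ge> n0" for n
      using that dist_triangle2[of "x n" "x n0" a] by (smt (verit) dist_commute field_sum_of_halves order_refl)
    then show "\<exists>N. \<forall>n\<ge>N. dist (x n) (x N) < e" by blast
  qed
  then obtain l where l: "x \<longlonglongrightarrow> l" using Cauchy_convergent convergent_def by blast
  show ?thesis
  proof (rule that[of l])
    fix e :: real assume "e > 0"
    then obtain s a where sa: "\<And>z. z \<in> S \<Longrightarrow> Re z < s \<Longrightarrow> dist a (F z) < e/4" using small[of "e/4"] by auto
    obtain n0 where n0: "real n0 > - s" using reals_Archimedean2 by blast
    obtain n1 where n1: "\<And>n. n \<ge> n1 \<Longrightarrow> dist (x n) l < e/4" using l \<open>e > 0\<close> unfolding lim_sequentially by (metis divide_pos_pos zero_less_numeral)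
    define n where "n = max n0 n1"
    have "real n \<ge> real n0" by (simp add: n_def)
    then have "Re (of_real (- real n)) < s" using n0 by simp
    then have "dist a (x n) < e/4" unfolding x_def using sa xS by blast
    moreover have "dist (x n) l < e/4" using n1 by (simp add: n_def)
    ultimately have al: "dist a l < e/2" using dist_triangle[of a l "x n"] by simp
    have "dist (F z) l < e" if "z \<in> S" "Re z < s" for z
      using sa[OF that] al dist_triangle3[of "F z" l a] \<open>e > 0\<close> by linarith
    then show "\<exists>s. \<forall>z\<in>S. Re z < s \<longrightarrow> dist (F z) l < e" by blast
  qed
qed

text \<open>The logarithm of a Moebius map carries the disk to the strip in such a way that \<zeta>
  corresponds to the left end. So the limit at \<zeta> is the limit along that end.\<close>

lemma Riemann_map_boundary_limit:
  fixes f g :: "complex \<Rightarrow> complex" and c :: "real \<Rightarrow> complex"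
  assumes c: "simple_path c" "pathfinish c = pathstart c"
    and f: "f holomorphic_on ball 0 1" "f ` ball 0 1 = inside (path_image c)"
    and g: "continuous_on (inside (path_image c)) g" "\<And>z. z \<in> ball 0 1 \<Longrightarrow> g (f z) = z"
    and \<zeta>: "cmod \<zeta> = 1"
  obtains l where "(f \<longlongrightarrow> l) (at \<zeta> within ball 0 1)"
proof -
  define S where "S = {z::complex. \<bar>Im z\<bar> < pi/2}"
  define k where "k = (\<lambda>w. \<zeta> * (1 - exp w) / (1 + exp w))"
  define h where "h = (\<lambda>z. Ln ((\<zeta> - z) / (\<zeta> + z)))"
  have \<zeta>0: "\<zeta> \<noteq> 0" using \<zeta> by auto
  have expS: "Re (exp w) > 0" if "w \<in> S" for w
  proof -
    have "cos (Im w) > 0" by (rule cos_gt_zero_pi) (use that in \<open>auto simp: S_def\<close>)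
    then show ?thesis by (simp add: Re_exp)
  qed
  have nz: "1 + exp w \<noteq> 0" if "w \<in> S" for w
  proof
    assume "1 + exp w = 0"
    then have "Re (1 + exp w) = 0" by simp
    then show False using expS[OF that] by simp
  qed
  have k_ball: "k w \<in> ball 0 1" if "w \<in> S" for w
  proof -
    have "cmod (1 - exp w) < cmod (1 + exp w)"
    proof (rule power2_less_imp_less)
      show "(cmod (1 - exp w))\<^sup>2 < (cmod (1 + exp w))\<^sup>2"
        unfolding cmod_power2 using expS[OF that] by (simp add: power2_eq_square algebra_simps)
    qed simp
    then show ?thesis using \<zeta> nz[OF that] by (simp add: k_def norm_mult norm_divide)
  qed
  have nz2: "\<zeta> + z \<noteq> 0" "\<zeta> - z \<noteq> 0" if "z \<in> ball 0 1" for z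
    using that \<zeta> by (auto simp: add_eq_0_iff)
  have Repos: "Re ((\<zeta> - z) / (\<zeta> + z)) > 0" if "z \<in> ball 0 1" for z
  proof -
    have "Re ((\<zeta> - z) * cnj (\<zeta> + z)) = (cmod \<zeta>)\<^sup>2 - (cmod z)\<^sup>2"
      unfolding cmod_power2 by (simp add: power2_eq_square algebra_simps)
    also have "\<dots> > 0" using that \<zeta> by (simp add: power_less_one_iff)
    finally have "Re ((\<zeta> - z) * cnj (\<zeta> + z)) > 0" .
    moreover have "Re ((\<zeta> - z) / (\<zeta> + z)) = Re ((\<zeta> - z) * cnj (\<zeta> + z)) / (cmod (\<zeta> + z))\<^sup>2"
      by (metis Re_divide_of_real complex_div_cnj of_real_power)
    ultimately show ?thesis using nz2[OF that] by simp
  qed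
  have hS: "h z \<in> S" if "z \<in> ball 0 1" for z
    using Repos[OF that] Re_Ln_pos_lt[of "(\<zeta> - z) / (\<zeta> + z)"] nz2[OF that] by (simp add: S_def h_def)
  have hk: "h (k w) = w" if "w \<in> S" for w
  proof -
    let ?u = "exp w"
    have "\<zeta> - k w = 2 * \<zeta> * ?u / (1 + ?u)" "\<zeta> + k w = 2 * \<zeta> / (1 + ?u)"
      using nz[OF that] by (simp_all add: k_def field_simps)
    then have "(\<zeta> - k w) / (\<zeta> + k w) = ?u" using \<zeta>0 nz[OF that] by simp
    moreover have "- pi < Im w" "Im w \<le> pi" using that pi_gt_zero unfolding S_def by auto
    ultimately show ?thesis by (simp add: h_def)
  qed
  have kh: "k (h z) = z" if "z \<in> ball 0 1" for z
  proof -
    have "exp (h z) = (\<zeta> - z) / (\<zeta> + z)" using nz2[OF that] by (simp add: h_def)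
    moreover have "1 - (\<zeta> - z) / (\<zeta> + z) = 2 * z / (\<zeta> + z)" "1 + (\<zeta> - z) / (\<zeta> + z) = 2 * \<zeta> / (\<zeta> + z)"
      using nz2[OF that] by (simp_all add: field_simps)
    ultimately show ?thesis using nz2[OF that] \<zeta>0 by (simp add: k_def)
  qed
  have kS: "k ` S = ball 0 1" using k_ball hS kh by (metis image_eqI image_subsetI subsetI subset_antisym)
  have holk: "k holomorphic_on S" unfolding k_def by (intro holomorphic_intros) (use nz in auto)
  have F: "(f \<circ> k) holomorphic_on S" "(f \<circ> k) ` S = inside (path_image c)"
    using holomorphic_on_compose_gen[OF holk f(1)] k_ball
    by (blast, simp only: image_comp[symmetric] kS f(2))
  have gball: "g w \<in> ball 0 1" if "w \<in> inside (path_image c)" for w using that f(2) g(2) by (metis imageE)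
  have conth: "continuous_on (ball 0 1) h"
    unfolding h_def
  proof (rule continuous_on_Ln')
    show "continuous_on (ball 0 1) (\<lambda>z. (\<zeta> - z) / (\<zeta> + z))"
      by (intro continuous_intros) (use nz2 in blast)
    show "(\<zeta> - z) / (\<zeta> + z) \<notin> \<real>\<^sub>\<le>\<^sub>0" if "z \<in> ball 0 1" for z
      using Repos[OF that] by (auto simp: complex_nonpos_Reals_iff)
  qed
  have G: "continuous_on (inside (path_image c)) (h \<circ> g)"
    unfolding comp_def by (rule continuous_on_compose2[OF conth g(1)]) (use gball in blast)
  have GF: "(h \<circ> g) ((f \<circ> k) w) = w" if "w \<in> S" for w using g(2)[OF k_ball[OF that]] hk[OF that] by simp
  obtain l where l: "\<And>e. e > 0 \<Longrightarrow> \<exists>s. \<forall>z\<in>S. Re z < s \<longrightarrow> dist ((f \<circ> k) z) l < e"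
    using strip_end_limit[OF c, of "f \<circ> k" "h \<circ> g"] F G GF unfolding S_def by blast
  have "(f \<longlongrightarrow> l) (at \<zeta> within ball 0 1)"
    unfolding Lim_within
  proof (intro allI impI)
    fix e :: real assume "e > 0"
    then obtain s where s: "\<And>w. w \<in> S \<Longrightarrow> Re w < s \<Longrightarrow> dist ((f \<circ> k) w) l < e" using l by blast
    \<comment> \<open>Within distance \<open>1\<close> of \<zeta> the denominator
      \<open>\<zeta> + z\<close> has modulus above \<open>1\<close>, so the quotient is below
      \<open>exp s\<close> and its logarithm has real part below \<open>s\<close>.\<close>
    have "dist (f z) l < e" if z: "z \<in> ball 0 1" "dist z \<zeta> < min 1 (exp s)" for z
    proof -
      have "cmod (\<zeta> - z) < 1" "cmod (\<zeta> - z) < exp s" using z(2) by (auto simp: dist_norm norm_minus_commute)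
      moreover have "cmod (2 * \<zeta>) \<le> cmod (\<zeta> + z) + cmod (\<zeta> - z)" by (rule order_trans[OF _ norm_triangle_ineq]) simp
      ultimately have "1 < cmod (\<zeta> + z)" using \<zeta> by (simp add: norm_mult)
      have "cmod ((\<zeta> - z) / (\<zeta> + z)) < exp s"
      proof -
        have "cmod (\<zeta> - z) / cmod (\<zeta> + z) \<le> cmod (\<zeta> - z) / 1"
          using \<open>1 < cmod (\<zeta> + z)\<close> by (intro divide_left_mono) auto
        then show ?thesis using \<open>cmod (\<zeta> - z) < exp s\<close> by (simp add: norm_divide)
      qed
      moreover have "(\<zeta> - z) / (\<zeta> + z) \<noteq> 0" using nz2[OF z(1)] by simp
      ultimately have "Re (h z) < s" unfolding h_def
        by (metis Re_Ln exp_less_cancel_iff exp_ln zero_less_norm_iff)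
      then have "dist ((f \<circ> k) (h z)) l < e" using s hS[OF z(1)] by blast
      then show ?thesis using kh[OF z(1)] by simp
    qed
    then show "\<exists>d>0. \<forall>x\<in>ball 0 1. 0 < dist x \<zeta> \<and> dist x \<zeta> < d \<longrightarrow> dist (f x) l < e"
      by (intro exI[of _ "min 1 (exp s)"]) auto
  qed
  then show ?thesis using that by blast
qed

text \<open>Finitely many rotations of the arc cover the circle. The product of the functions
  \<open>h - w\<close>, rotated accordingly, vanishes on the whole circle, hence by the maximum
  principle at \<open>0\<close>, where all factors are equal.\<close>

lemma constant_on_arc_imp_value_at_0:
  fixes h :: "complex \<Rightarrow> complex"
  assumes hol: "h holomorphic_on ball 0 1" and cont: "continuous_on (cball 0 1) h"
    and \<zeta>: "cmod \<zeta> = 1" and \<eta>: "\<eta> > 0"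
    and eq: "\<And>z. cmod z = 1 \<Longrightarrow> dist z \<zeta> < \<eta> \<Longrightarrow> h z = w"
  shows "h 0 = w"
proof -
  have "uniformly_continuous_on {0..2*pi} (\<lambda>t. exp (\<i> * complex_of_real t))"
    by (intro compact_uniformly_continuous continuous_intros) auto
  then obtain \<delta> where \<delta>: "\<delta> > 0"
    "\<And>s t. s \<in> {0..2*pi} \<Longrightarrow> t \<in> {0..2*pi} \<Longrightarrow> dist s t < \<delta> \<Longrightarrow> dist (exp (\<i> * complex_of_real s)) (exp (\<i> * complex_of_real t)) < \<eta>"
    unfolding uniformly_continuous_on_def using \<eta> by metis
  obtain n where n: "real n > 2 * pi / \<delta>" using reals_Archimedean2 by blast
  have n0: "real n > 0" using n \<delta> pi_gt_zero by (metis divide_pos_pos mult_pos_pos order.strict_trans zero_less_numeral)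
  have step: "2 * pi / real n < \<delta>" using n n0 \<delta> by (simp add: field_simps)
  define rot where "rot = (\<lambda>j::nat. exp (\<i> * complex_of_real (2 * pi * real j / real n)))"
  have rot1: "cmod (rot j) = 1" for j unfolding rot_def by (rule norm_exp_i_times)
  define H where "H = (\<lambda>z. \<Prod>j<n. h (rot j * z) - w)"
  have "norm (H 0) \<le> 0"
  proof (rule maximum_modulus_frontier[of H "cball 0 1"])
    show "H holomorphic_on interior (cball 0 1)"
      unfolding H_def
    proof (intro holomorphic_on_prod holomorphic_intros)
      show "(\<lambda>z. h (rot j * z)) holomorphic_on interior (cball 0 1)" for j
        using rot1 by (intro holomorphic_on_compose_gen[OF _ hol, of "\<lambda>z. rot j * z", unfolded comp_def] holomorphic_intros)
          (auto simp: norm_mult)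
    qed
    show "continuous_on (closure (cball 0 1)) H"
      unfolding H_def
    proof (intro continuous_intros)
      show "continuous_on (closure (cball 0 1)) (\<lambda>z. h (rot j * z))" for j
        by (rule continuous_on_compose2[OF cont]) (auto intro!: continuous_intros simp: norm_mult rot1)
    qed
    fix z :: complex assume "z \<in> frontier (cball 0 1)"
    then have z: "cmod z = 1" by simp
    define u where "u = \<zeta> / z"
    have u: "cmod u = 1" using z \<zeta> by (simp add: u_def norm_divide)
    define t where "t = Arg2pi u"
    have t: "0 \<le> t" "t < 2 * pi" "u = exp (\<i> * complex_of_real t)"
      using Arg2pi[of u] u by (auto simp: t_def is_Arg_def)
    \<comment> \<open>The last of the \<open>n\<close> rotations whose angle does not exceed the
      angle \<open>t\<close> that turns \<open>z\<close> into \<zeta>.\<close>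
    define j where "j = nat \<lfloor>t * real n / (2 * pi)\<rfloor>"
    have j: "real j \<le> t * real n / (2 * pi)" "t * real n / (2 * pi) < real j + 1"
    proof -
      have "0 \<le> t * real n / (2 * pi)" using t(1) by simp
      then have "real j = of_int \<lfloor>t * real n / (2 * pi)\<rfloor>" unfolding j_def by simp
      then show "real j \<le> t * real n / (2 * pi)" "t * real n / (2 * pi) < real j + 1" by linarith+
    qed
    have "t * real n / (2 * pi) < real n" using t(2) n0 pi_gt_zero by (simp add: field_simps)
    then have jn: "j < n" using j(1) by linarith
    define s where "s = 2 * pi * real j / real n"
    have "2 * pi * real j \<le> t * real n" "t * real n < 2 * pi * (real j + 1)"
      using j pi_gt_zero by (simp_all add: field_simps)
    then have st: "s \<le> t" "t < s + 2 * pi / real n" using n0 by (simp_all add: s_def field_simps)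
    have "dist s t < \<delta>" using st step by (simp add: dist_real_def)
    moreover have "s \<ge> 0" using n0 by (simp add: s_def)
    ultimately have "dist (exp (\<i> * complex_of_real s)) (exp (\<i> * complex_of_real t)) < \<eta>"
      using st t by (intro \<delta>(2)) auto
    then have "dist (rot j) u < \<eta>" using t(3) by (simp add: rot_def s_def)
    moreover have "dist (rot j * z) \<zeta> = dist (rot j) u"
    proof -
      have "z \<noteq> 0" using z by auto
      then have "rot j * z - \<zeta> = (rot j - u) * z" by (simp add: u_def field_simps)
      then show ?thesis using z by (simp add: dist_norm norm_mult)
    qed
    ultimately have "h (rot j * z) = w" using z rot1 by (intro eq) (auto simp: norm_mult)
    then have "H z = 0" unfolding H_def using jn by (intro prod_zero) auto
    then show "norm (H z) \<le> 0" by simp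
  qed auto
  then have "(h 0 - w) ^ n = 0" by (simp add: H_def)
  then show ?thesis by simp
qed

text \<open>Boundary values near \<open>x\<close> are close to \<open>L x\<close> as well, since
  each of them is approximated by values of \<open>f\<close> at nearby points of the open
  disk.\<close>

lemma continuous_on_boundary_extension:
  fixes f :: "complex \<Rightarrow> complex"
  assumes cont: "continuous_on (ball 0 1) f"
    and lim: "\<And>z. cmod z = 1 \<Longrightarrow> (f \<longlongrightarrow> L z) (at z within ball 0 1)"
  shows "continuous_on (cball 0 1) (\<lambda>z. if z \<in> ball 0 1 then f z else L z)"
  unfolding continuous_on_iff
proof (intro ballI allI impI)
  let ?h = "\<lambda>z. if z \<in> ball 0 1 then f z else L z"
  fix x :: complex and e :: real assume x: "x \<in> cball 0 1" and e: "e > 0"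
  show "\<exists>d>0. \<forall>x'\<in>cball 0 1. dist x' x < d \<longrightarrow> dist (?h x') (?h x) < e"
  proof (cases "x \<in> ball 0 1")
    case True
    obtain r where r: "r > 0" "ball x r \<subseteq> ball 0 1" using True open_ball openE by blast
    obtain d where d: "d > 0" "\<And>x'. x' \<in> ball 0 1 \<Longrightarrow> dist x' x < d \<Longrightarrow> dist (f x') (f x) < e"
      using cont True e unfolding continuous_on_iff by blast
    have "dist (?h x') (?h x) < e" if "dist x' x < min r d" for x'
    proof -
      have "x' \<in> ball x r" using that by (simp add: dist_commute)
      then have "x' \<in> ball 0 1" using r by blast
      then show ?thesis using d(2) that True by auto
    qed
    then show ?thesis using r d by (intro exI[of _ "min r d"]) auto
  next
    case False
    then have x1: "cmod x = 1" using x by simp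
    obtain d where d: "d > 0" "\<And>z. z \<in> ball 0 1 \<Longrightarrow> 0 < dist z x \<Longrightarrow> dist z x < d \<Longrightarrow> dist (f z) (L x) < e/2"
      using lim[OF x1] e unfolding Lim_within by (metis half_gt_zero)
    have d2: "dist (f z) (L x) < e/2" if "z \<in> ball 0 1" "dist z x < d" for z
    proof -
      have "z \<noteq> x" using that(1) x1 by auto
      then show ?thesis using d(2)[OF that(1) _ that(2)] by simp
    qed
    have "dist (?h x') (?h x) < e" if x': "x' \<in> cball 0 1" "dist x' x < d" for x'
    proof (cases "x' \<in> ball 0 1")
      case True
      then show ?thesis using d2[OF True x'(2)] False e by simp
    next
      case F: False
      then have x'1: "cmod x' = 1" using x' by simp
      obtain d' where d': "d' > 0" "\<And>z. z \<in> ball 0 1 \<Longrightarrow> 0 < dist z x' \<Longrightarrow> dist z x' < d' \<Longrightarrow> dist (f z) (L x') < e/2"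
        using lim[OF x'1] e unfolding Lim_within by (metis half_gt_zero)
      define r where "r = min d' (d - dist x' x)"
      have r: "r > 0" using d' x' by (simp add: r_def)
      have "x' \<in> closure (ball 0 1)" using x' by simp
      then obtain z where z: "z \<in> ball 0 1" "dist z x' < r" using r unfolding closure_approachable by blast
      have "z \<noteq> x'" using z F by blast
      then have "dist (f z) (L x') < e/2" using d'(2) z by (simp add: r_def)
      moreover have "dist z x < d" using z(2) dist_triangle[of z x x'] by (simp add: r_def)
      then have "dist (f z) (L x) < e/2" using d2 z(1) by blast
      ultimately have "dist (L x') (L x) < e" using dist_triangle3[of "L x'" "L x" "f z"] by linarith
      then show ?thesis using F False by simp
    qed
    then show ?thesis using d(1) by blast
  qed
qed

text \<open>Injectivity on the circle is the crux. If two boundary points have the same image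
  \<open>w\<close>, their chord becomes a closed curve that meets the boundary curve only in
  \<open>w\<close>, and one of the caps cut off by the chord is mapped inside it. On the circular
  arc of this cap the extension can only take the value \<open>w\<close>, which forces
  \<open>w\<close> to be the image of \<open>0\<close> too, an interior point.\<close>

theorem Schoenflies:
  fixes c :: "real \<Rightarrow> complex"
  assumes c: "simple_path c" "pathfinish c = pathstart c" and p: "p \<in> inside (path_image c)"
  obtains h h' where "homeomorphism (cball (0::complex) 1) (inside (path_image c) \<union> path_image c) h h'"
    "h ` sphere 0 1 = path_image c" "h ` ball 0 1 = inside (path_image c)" "h 0 = p"
proof -
  let ?C = "path_image c"
  let ?V = "inside ?C"
  have V: "open ?V" "bounded ?V" "frontier ?V = ?C" "?V \<noteq> {}"
    using Jordan_inside_outside[OF c] by simp_all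
  have clV: "closure ?V = ?V \<union> ?C" using V(3) closure_Un_frontier[of ?V] by simp
  have VC: "?V \<inter> ?C = {}" by (rule inside_no_overlap)
  have "?V \<noteq> UNIV" using V(2) by (metis not_bounded_UNIV)
  then obtain g1 f1 where gf1: "g1 holomorphic_on ?V" "f1 holomorphic_on ball 0 1"
    "\<And>z. z \<in> ?V \<Longrightarrow> g1 z \<in> ball 0 1 \<and> f1 (g1 z) = z" "\<And>z. z \<in> ball 0 1 \<Longrightarrow> f1 z \<in> ?V \<and> g1 (f1 z) = z"
    using Riemann_mapping_theorem[of ?V] V(1,4) simply_connected_inside_simple_path[OF c(1)] by blast
  have "g1 p \<in> ball 0 1" using gf1(3)[OF p] by blast
  \<comment> \<open>An automorphism of the disk normalizes the Riemann map to send \<open>0\<close>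
    to \<open>p\<close>.\<close>
  then obtain F G where FG: "F (g1 p) = 0" "F holomorphic_on ball 0 1" "F ` ball 0 1 \<subseteq> ball 0 1"
    "G holomorphic_on ball 0 1" "G ` ball 0 1 \<subseteq> ball 0 1"
    "\<And>z. z \<in> ball 0 1 \<Longrightarrow> F (G z) = z" "\<And>z. z \<in> ball 0 1 \<Longrightarrow> G (F z) = z"
    by (rule ball_biholomorphism_exists) blast
  define g where "g = F \<circ> g1"
  define f where "f = f1 \<circ> G"
  have gf: "g holomorphic_on ?V" "f holomorphic_on ball 0 1"
    unfolding g_def f_def
    by (rule holomorphic_on_compose_gen[OF gf1(1) FG(2)], use gf1(3) in blast)
      (rule holomorphic_on_compose_gen[OF FG(4) gf1(2) FG(5)])
  have gf3: "g z \<in> ball 0 1 \<and> f (g z) = z" if "z \<in> ?V" for z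
  proof -
    have "g1 z \<in> ball 0 1" using gf1(3)[OF that] by blast
    then have "F (g1 z) \<in> ball 0 1" "G (F (g1 z)) = g1 z" using FG(3,7) by blast+
    then show ?thesis using gf1(3)[OF that] unfolding f_def g_def by simp
  qed
  have gf4: "f z \<in> ?V \<and> g (f z) = z" if "z \<in> ball 0 1" for z
  proof -
    have "G z \<in> ball 0 1" using FG(5) that by blast
    then show ?thesis using FG(6)[OF that] gf1(4)[of "G z"] unfolding f_def g_def by simp
  qed
  have "G 0 = g1 p" using FG(7)[OF \<open>g1 p \<in> ball 0 1\<close>] FG(1) by simp
  then have f0: "f 0 = p" using gf1(3)[OF p] by (simp add: f_def)
  have fim: "f ` ball 0 1 = ?V" using gf3 gf4 by (metis image_eqI image_subsetI subsetI subset_antisym)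
  have contg: "continuous_on ?V g" and contf: "continuous_on (ball 0 1) f"
    using gf holomorphic_on_imp_continuous_on by blast+
  have "\<exists>l. (f \<longlongrightarrow> l) (at z within ball 0 1)" if "cmod z = 1" for z
    using Riemann_map_boundary_limit[OF c gf(2) fim contg _ that] gf4 by metis
  then obtain L where L: "\<And>z. cmod z = 1 \<Longrightarrow> (f \<longlongrightarrow> L z) (at z within ball 0 1)" by metis
  define h where "h = (\<lambda>z. if z \<in> ball 0 1 then f z else L z)"
  have conth: "continuous_on (cball 0 1) h"
    unfolding h_def by (rule continuous_on_boundary_extension[OF contf L])
  have hb: "h z = f z" if "z \<in> ball 0 1" for z using that by (simp add: h_def)
  have hs: "h z = L z" if "cmod z = 1" for z using that by (simp add: h_def)
  have hbim: "h ` ball 0 1 = ?V" using fim hb by auto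
  have ntriv: "at z within ball 0 1 \<noteq> bot" if "cmod z = 1" for z :: complex
  proof -
    have "z \<notin> ball 0 1" using that by simp
    then have "ball 0 1 - {z} = ball 0 1" by blast
    then show ?thesis using that by (simp add: at_within_eq_bot_iff)
  qed
  have hsC: "h z \<in> ?C" if z: "cmod z = 1" for z
  proof (rule ccontr)
    assume no: "h z \<notin> ?C"
    have "h ` closure (ball 0 1) \<subseteq> closure ?V"
      by (rule image_closure_subset) (use conth hbim closure_subset in auto)
    then have "h z \<in> closure ?V" using z by auto
    then have hzV: "L z \<in> ?V" using no clV hs[OF z] by auto
    have "((\<lambda>x. g (f x)) \<longlongrightarrow> g (L z)) (at z within ball 0 1)"
      by (rule continuous_on_tendsto_compose[OF contg L[OF z] hzV]) (use gf4 in \<open>auto simp: eventually_at_filter\<close>)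
    moreover have "((\<lambda>x. g (f x)) \<longlongrightarrow> z) (at z within ball 0 1)"
    proof (rule Lim_transform_within[of "\<lambda>x. x" _ _ _ 1])
      show "((\<lambda>x. x) \<longlongrightarrow> z) (at z within ball 0 1)" by (rule tendsto_ident_at)
    qed (use gf4 in auto)
    ultimately have "g (L z) = z" using tendsto_unique ntriv[OF z] by blast
    then show False using gf3[OF hzV] z by simp
  qed
  have injb: "inj_on h (ball 0 1)" using gf4 hb by (metis inj_onI)
  have injs: "z1 = z2" if z12: "cmod z1 = 1" "cmod z2 = 1" "h z1 = h z2" for z1 z2
  proof (rule ccontr)
    assume ne: "z1 \<noteq> z2"
    define w where "w = h z1"
    have wC: "w \<in> ?C" using hsC z12 by (simp add: w_def)
    have seg: "linepath z1 z2 t \<in> ball 0 1" if "t \<in> {0<..<1}" for t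
    proof -
      have "linepath z1 z2 t \<in> open_segment z1 z2"
        using that ne by (auto simp: in_segment linepath_def)
      then have "dist 0 (linepath z1 z2 t) < dist 0 z1 \<or> dist 0 (linepath z1 z2 t) < dist 0 z2"
        by (rule dist_decreases_open_segment[rule_format])
      then show ?thesis using z12 by auto
    qed
    define j where "j = h \<circ> linepath z1 z2"
    have j01: "j 0 = w" "j 1 = w" using z12 by (auto simp: j_def w_def linepath_def)
    have jV: "j t \<in> ?V" if "t \<in> {0<..<1}" for t using seg[OF that] hbim by (auto simp: j_def)
    have jw: "j t \<noteq> w" if "t \<in> {0<..<1}" for t using jV[OF that] wC VC by blast
    have "closed_segment z1 z2 \<subseteq> cball 0 1" using z12 by (intro closed_segment_subset) auto
    then have "path j" unfolding j_def
      using conth continuous_on_subset by (intro path_continuous_image) auto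
    moreover have "loop_free j"
      unfolding loop_free_def
    proof (intro ballI impI)
      fix s t :: real assume st: "s \<in> {0..1}" "t \<in> {0..1}" "j s = j t"
      have cs: "s = 0 \<or> s = 1 \<or> s \<in> {0<..<1}" "t = 0 \<or> t = 1 \<or> t \<in> {0<..<1}" using st by auto
      show "s = t \<or> s = 0 \<and> t = 1 \<or> s = 1 \<and> t = 0"
      proof (cases "s \<in> {0<..<1} \<and> t \<in> {0<..<1}")
        case True
        then have "linepath z1 z2 s = linepath z1 z2 t"
          using inj_onD[OF injb] seg st(3) unfolding j_def comp_def by blast
        then show ?thesis using ne inj_on_linepath[OF ne] st by (metis inj_onD)
      next
        case False
        then show ?thesis using cs j01 jw st(3) by metis
      qed
    qed
    ultimately have jl: "simple_path j" "pathfinish j = pathstart j"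
      using j01 by (auto simp: simple_path_def pathfinish_def pathstart_def)
    let ?J = "path_image j"
    have Jsub: "?J \<subseteq> insert w ?V"
    proof
      fix x assume "x \<in> ?J"
      then obtain t where t: "t \<in> {0..1}" "x = j t" by (auto simp: path_image_def)
      have "t = 0 \<or> t = 1 \<or> t \<in> {0<..<1}" using t by auto
      then show "x \<in> insert w ?V" using jV j01 t(2) by blast
    qed
    have inJV: "inside ?J \<subseteq> ?V"
      by (rule inside_curve_subset_inside[OF c jl]) (use Jsub wC in blast)
    have inJ: "inside ?J \<noteq> {}" "open (inside ?J)" "frontier (inside ?J) = ?J"
      using Jordan_inside_outside[OF jl] by simp_all
    define nn where "nn = \<i> * (z2 - z1)"
    have "nn \<noteq> 0" using ne by (simp add: nn_def)
    have onl: "nn \<bullet> linepath z1 z2 t = nn \<bullet> z1" for t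
      by (simp add: nn_def linepath_def inner_complex_def algebra_simps)
    \<comment> \<open>The preimage of the inside is open and nonempty, so it is not contained in the
      line through the chord: a point \<open>z0\<close> of it off that line tells which cap is
      mapped inside.\<close>
    have "open (ball 0 1 \<inter> f -` inside ?J)"
      by (rule continuous_open_preimage[OF contf open_ball inJ(2)])
    moreover have "ball 0 1 \<inter> f -` inside ?J \<noteq> {}"
    proof -
      obtain x where x: "x \<in> inside ?J" using inJ(1) by blast
      then have "g x \<in> ball 0 1 \<and> f (g x) = x" using inJV gf3 by blast
      then show ?thesis using x by auto
    qed
    ultimately have "\<not> ball 0 1 \<inter> f -` inside ?J \<subseteq> {x. nn \<bullet> x = nn \<bullet> z1}"
      using interior_hyperplane[OF \<open>nn \<noteq> 0\<close>] interior_maximal by blast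
    then obtain z0 where z0: "z0 \<in> ball 0 1" "f z0 \<in> inside ?J" "nn \<bullet> z0 \<noteq> nn \<bullet> z1" by blast
    define n where "n = (if nn \<bullet> z0 < nn \<bullet> z1 then nn else - nn)"
    have n: "n \<noteq> 0" "n \<bullet> z0 < n \<bullet> z1" "n \<bullet> linepath z1 z2 t = n \<bullet> z1" for t
      using \<open>nn \<noteq> 0\<close> z0(3) onl by (auto simp: n_def)
    define A where "A = ball 0 1 \<inter> {z. n \<bullet> z < n \<bullet> z1}"
    have "connected (f ` A)"
    proof (rule connected_continuous_image)
      show "continuous_on A f" using contf continuous_on_subset unfolding A_def by blast
      show "connected A" unfolding A_def
        by (intro convex_connected convex_Int convex_halfspace_lt convex_ball)
    qed
    moreover have "f ` A \<inter> ?J = {}"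
    proof -
      have False if xA: "x \<in> A" and fx: "f x \<in> ?J" for x
      proof -
        obtain t where t: "t \<in> {0..1}" "f x = j t" using fx by (auto simp: path_image_def)
        have xb: "x \<in> ball 0 1" using xA by (simp add: A_def)
        have "f x \<noteq> w" using gf4[OF xb] wC VC by blast
        then have "t \<in> {0<..<1}" using t j01 by (cases "t = 0 \<or> t = 1") auto
        then have "x = linepath z1 z2 t"
          using inj_onD[OF injb, of x "linepath z1 z2 t"] seg t(2) xb hb[OF xb] by (simp add: j_def)
        then show False using n(3)[of t] xA by (simp add: A_def)
      qed
      then show ?thesis by blast
    qed
    ultimately have "f ` A \<subseteq> inside ?J \<or> f ` A \<subseteq> outside ?J"
      by (rule connected_inside_or_outside[OF jl])
    moreover have "f z0 \<in> f ` A" using z0 n(2) by (auto simp: A_def)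
    ultimately have fA: "f ` A \<subseteq> inside ?J" using z0(2) inside_Int_outside[of ?J] by blast
    have arc: "h z = w" if z: "cmod z = 1" "n \<bullet> z < n \<bullet> z1" for z
    proof -
      have "L z \<in> closure (inside ?J)"
      proof (rule Lim_in_closed_set[OF closed_closure _ ntriv[OF z(1)] L[OF z(1)]])
        have "open {x. n \<bullet> x < n \<bullet> z1}" by (rule open_halfspace_lt)
        then have "eventually (\<lambda>x. x \<in> {x. n \<bullet> x < n \<bullet> z1}) (at z within ball 0 1)"
          using z(2) by (intro topological_tendstoD[OF tendsto_ident_at]) auto
        moreover have "eventually (\<lambda>x. x \<in> ball 0 1) (at z within ball 0 1)"
          by (auto simp: eventually_at_filter)
        ultimately show "eventually (\<lambda>x. f x \<in> closure (inside ?J)) (at z within ball 0 1)"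
        proof eventually_elim
          case (elim x)
          then have "x \<in> A" unfolding A_def by blast
          then show ?case using fA closure_subset[of "inside ?J"] by blast
        qed
      qed
      then have "L z \<in> inside ?J \<union> ?J" using inJ(3) closure_Un_frontier[of "inside ?J"] by simp
      moreover have "L z \<in> ?C" using hsC[OF z(1)] unfolding hs[OF z(1)] .
      ultimately have "L z = w" using inJV Jsub VC by blast
      then show ?thesis unfolding hs[OF z(1)] .
    qed
    \<comment> \<open>The midpoint of the circular arc of the cap: the point of the circle where the
      inner product with \<open>n\<close> is least.\<close>
    define \<zeta> where "\<zeta> = - n / of_real (cmod n)"
    have \<zeta>: "cmod \<zeta> = 1" using n(1) by (simp add: \<zeta>_def norm_divide)
    have "n \<bullet> \<zeta> = - cmod n"
    proof -
      have "\<zeta> = (- 1 / cmod n) *\<^sub>R n" by (simp add: \<zeta>_def scaleR_conv_of_real)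
      then show ?thesis using n(1) by (simp add: power2_norm_eq_inner[symmetric] power2_eq_square)
    qed
    also have "\<dots> \<le> n \<bullet> z0"
    proof -
      have "\<bar>n \<bullet> z0\<bar> \<le> cmod n * cmod z0" by (rule Cauchy_Schwarz_ineq2)
      also have "\<dots> \<le> cmod n * 1" using z0(1) by (intro mult_left_mono) auto
      finally show ?thesis by simp
    qed
    also note n(2)
    finally have "\<zeta> \<in> {x. n \<bullet> x < n \<bullet> z1}" by simp
    then obtain \<eta> where \<eta>: "\<eta> > 0" "ball \<zeta> \<eta> \<subseteq> {x. n \<bullet> x < n \<bullet> z1}"
      using open_halfspace_lt openE by blast
    have holh: "h holomorphic_on ball 0 1" using gf(2) hb holomorphic_cong by metis
    have "h 0 = w"
    proof (rule constant_on_arc_imp_value_at_0[OF holh conth \<zeta> \<eta>(1)])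
      fix z assume z: "cmod z = 1" "dist z \<zeta> < \<eta>"
      then have "z \<in> ball \<zeta> \<eta>" by (simp add: dist_commute)
      then have "n \<bullet> z < n \<bullet> z1" using \<eta>(2) by blast
      then show "h z = w" using arc z(1) by blast
    qed
    moreover have "h 0 \<in> ?V" using hbim by auto
    ultimately show False using wC VC by blast
  qed
  have inj: "inj_on h (cball 0 1)"
  proof (rule inj_onI)
    fix x y assume xy: "x \<in> cball (0::complex) 1" "y \<in> cball (0::complex) 1" "h x = h y"
    have c: "x \<in> ball 0 1 \<or> cmod x = 1" "y \<in> ball 0 1 \<or> cmod y = 1" using xy by auto
    have V: "z \<in> ball 0 1 \<Longrightarrow> h z \<notin> ?C" for z using hbim VC by blast
    show "x = y"
      using c xy(3) inj_onD[OF injb] injs hsC V by metis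
  qed
  have im: "h ` cball 0 1 = ?V \<union> ?C"
  proof
    have "cball (0::complex) 1 = ball 0 1 \<union> sphere 0 1" by auto
    then show "h ` cball 0 1 \<subseteq> ?V \<union> ?C" using hbim hsC by auto
    have "closed (h ` cball 0 1)" using conth compact_cball compact_continuous_image compact_imp_closed by blast
    moreover have "?V \<subseteq> h ` cball 0 1" using hbim ball_subset_cball by blast
    ultimately show "?V \<union> ?C \<subseteq> h ` cball 0 1" using clV closure_minimal by metis
  qed
  have sph: "h ` sphere 0 1 = ?C"
  proof
    show "h ` sphere 0 1 \<subseteq> ?C" using hsC by auto
    show "?C \<subseteq> h ` sphere 0 1"
    proof
      fix x assume x: "x \<in> ?C"
      then obtain z where z: "z \<in> cball 0 1" "x = h z" using im by blast
      have "z \<notin> ball 0 1" using x z(2) hbim VC by blast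
      then show "x \<in> h ` sphere 0 1" using z by auto
    qed
  qed
  obtain h' where hom: "homeomorphism (cball 0 1) (?V \<union> ?C) h h'"
    using homeomorphism_compact[OF compact_cball conth im inj] by blast
  show ?thesis by (rule that[OF hom sph hbim]) (simp add: hb f0)
qed

section \<open>Branched covers of the sphere\<close>

abbreviation openS2 :: "(real^3) set \<Rightarrow> bool" where "openS2 A \<equiv> openin (top_of_set S2) A"

section \<open>The local model of a branched cover\<close>

lemma card_roots_unit_ball:
  assumes "k \<ge> 1" "w \<noteq> 0" "cmod w < r ^ k" "0 < r"
  shows "card {z. cmod z < r \<and> z ^ k = w} = k"
proof -
  have "cmod z < r" if "z ^ k = w" for z
  proof -
    have "cmod z ^ k < r ^ k" using that assms(3) by (auto simp: norm_power)
    then show ?thesis using assms(4) by (simp add: power_less_imp_less_base less_imp_le)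
  qed
  then have "{z. cmod z < r \<and> z ^ k = w} = {z. z ^ k = w}" by auto
  then show ?thesis using card_nth_roots[of w k] assms by simp
qed

text \<open>What is left of the map \<open>z ^ k\<close> once the charts are forgotten: open image,
  \<open>k\<close> preimages of every value but the central one, local injectivity off the centre.
  The clause about another value keeps the count from being void.\<close>

definition model_nbhd :: "(real^3 \<Rightarrow> real^3) \<Rightarrow> nat \<Rightarrow> real^3 \<Rightarrow> (real^3) set \<Rightarrow> bool" where
  "model_nbhd f k x U \<longleftrightarrow> openS2 U \<and> x \<in> U \<and> openS2 (f ` U) \<and> (\<exists>y\<in>f ` U. y \<noteq> f x) \<and>
     (\<forall>y\<in>f ` U. y \<noteq> f x \<longrightarrow> card {u\<in>U. f u = y} = k) \<and> {u\<in>U. f u = f x} = {x} \<and>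
     (\<forall>u\<in>U. u \<noteq> x \<longrightarrow> (\<exists>W. openS2 W \<and> u \<in> W \<and> inj_on f W))"

text \<open>The chart is cut down to a round disk of radius \<open>r\<close>. In the charts its
  image is the round disk of radius \<open>r ^ k\<close>, and all \<open>k\<close> roots of a value
  in the latter lie in the former.\<close>

lemma has_local_degree_model_nbhd:
  assumes deg: "has_local_degree f x k" and B: "openS2 B" "x \<in> B"
  obtains U where "model_nbhd f k x U" "U \<subseteq> B"
proof -
  from deg obtain U0 V \<phi> \<psi> where k: "k \<ge> 1" and U0: "oriented_disk_chart U0 \<phi>" and V: "oriented_disk_chart V \<psi>"
    and x: "x \<in> U0" "\<phi> x = 0" "f x \<in> V" "\<psi> (f x) = 0" and fU: "f ` U0 \<subseteq> V" "\<And>u. u \<in> U0 \<Longrightarrow> \<psi> (f u) = \<phi> u ^ k"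
    unfolding has_local_degree_def by blast
  obtain \<phi>' where \<phi>: "homeomorphism U0 (ball 0 1) \<phi> \<phi>'" and opU0: "openS2 U0"
    using U0 unfolding oriented_disk_chart_def by blast
  obtain \<psi>' where \<psi>: "homeomorphism V (ball 0 1) \<psi> \<psi>'" and opV: "openS2 V"
    using V unfolding oriented_disk_chart_def by blast
  have \<phi>1: "\<And>u. u \<in> U0 \<Longrightarrow> \<phi>' (\<phi> u) = u" "\<And>z. z \<in> ball 0 1 \<Longrightarrow> \<phi> (\<phi>' z) = z" "\<phi> ` U0 = ball 0 1" "\<phi>' ` ball 0 1 = U0"
     "continuous_on U0 \<phi>" "continuous_on (ball 0 1) \<phi>'"
    using \<phi> unfolding homeomorphism_def by auto
  have \<psi>1: "\<And>u. u \<in> V \<Longrightarrow> \<psi>' (\<psi> u) = u" "\<psi> ` V = ball 0 1" "continuous_on V \<psi>"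
    using \<psi> unfolding homeomorphism_def by auto
  have "\<phi>' 0 = x" using \<phi>1(1)[OF x(1)] x(2) by simp
  have "openin (top_of_set (ball 0 1)) (ball 0 1 \<inter> \<phi>' -` (U0 \<inter> B))"
  proof (rule continuous_openin_preimage[OF \<phi>1(6)])
    show "\<phi>' \<in> ball 0 1 \<rightarrow> U0" using \<phi>1(4) by blast
    obtain T where "open T" "B = S2 \<inter> T" using openin_open[THEN iffD1, OF B(1)] by blast
    moreover have "U0 \<subseteq> S2" using opU0 openin_imp_subset by blast
    ultimately have "open T \<and> U0 \<inter> B = U0 \<inter> T" by blast
    then show "openin (top_of_set U0) (U0 \<inter> B)" using openin_open by blast
  qed
  then have "open (ball 0 1 \<inter> \<phi>' -` (U0 \<inter> B))" using openin_open_trans open_ball by blast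
  moreover have "0 \<in> ball 0 1 \<inter> \<phi>' -` (U0 \<inter> B)" using \<open>\<phi>' 0 = x\<close> x B by simp
  ultimately obtain r where r: "r > 0" "ball 0 r \<subseteq> ball 0 1 \<inter> \<phi>' -` (U0 \<inter> B)" using openE by blast
  define U where "U = {u \<in> U0. cmod (\<phi> u) < r}"
  have r1: "r \<le> 1"
  proof (rule ccontr)
    assume "\<not> r \<le> 1"
    then have "(1::complex) \<in> ball 0 r" by simp
    then have "(1::complex) \<in> ball 0 1" using r(2) by blast
    then show False by simp
  qed
  have UU0: "U \<subseteq> U0" by (auto simp: U_def)
  have UB: "U \<subseteq> B"
  proof
    fix u assume "u \<in> U"
    then have "\<phi> u \<in> ball 0 r" "u \<in> U0" by (auto simp: U_def)
    then show "u \<in> B" using r(2) \<phi>1(1) by fastforce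
  qed
  have pre: "openS2 {u \<in> U0. \<phi> u \<in> T}" if "open T" for T
  proof -
    have "openin (top_of_set U0) (U0 \<inter> \<phi> -` T)" using continuous_openin_preimage_gen[OF \<phi>1(5) that] .
    moreover have "U0 \<inter> \<phi> -` T = {u \<in> U0. \<phi> u \<in> T}" by auto
    ultimately show ?thesis using openin_trans opU0 by metis
  qed
  have opU: "openS2 U" using pre[of "ball 0 r"] by (simp add: U_def)
  have xU: "x \<in> U" using x r by (simp add: U_def)
  have fUim: "f ` U = {v \<in> V. cmod (\<psi> v) < r ^ k}"
  proof (intro equalityI subsetI)
    fix v assume "v \<in> f ` U"
    then obtain u where u: "u \<in> U0" "cmod (\<phi> u) < r" "v = f u" by (auto simp: U_def)
    then show "v \<in> {v \<in> V. cmod (\<psi> v) < r ^ k}"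
      using fU k by (auto simp: norm_power intro!: power_strict_mono)
  next
    fix v assume v: "v \<in> {v \<in> V. cmod (\<psi> v) < r ^ k}"
    obtain z where z: "cmod z < r" "z ^ k = \<psi> v"
    proof (cases "\<psi> v = 0")
      case True then show ?thesis using that[of 0] r k by simp
    next
      case False
      have "card {z. cmod z < r \<and> z ^ k = \<psi> v} = k" by (rule card_roots_unit_ball) (use False v k r in auto)
      then have "{z. cmod z < r \<and> z ^ k = \<psi> v} \<noteq> {}" using k by force
      then show ?thesis using that by blast
    qed
    have zb: "z \<in> ball 0 1" using z(1) r1 by simp
    have "\<phi>' z \<in> U0" using zb \<phi>1(4) by blast
    moreover have "\<phi> (\<phi>' z) = z" using zb \<phi>1(2) by simp
    ultimately have "\<phi>' z \<in> U" "\<psi> (f (\<phi>' z)) = \<psi> v" using z fU(2) by (auto simp: U_def)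
    then have "f (\<phi>' z) = v" using \<psi>1(1) fU(1) v \<open>\<phi>' z \<in> U0\<close> by (metis (no_types, lifting) image_subset_iff mem_Collect_eq)
    then show "v \<in> f ` U" using \<open>\<phi>' z \<in> U\<close> by blast
  qed
  have opfU: "openS2 (f ` U)"
  proof -
    have "openin (top_of_set V) (V \<inter> \<psi> -` ball 0 (r^k))" using continuous_openin_preimage_gen[OF \<psi>1(3) open_ball] .
    moreover have "V \<inter> \<psi> -` ball 0 (r^k) = f ` U" unfolding fUim by auto
    ultimately show ?thesis using openin_trans opV by metis
  qed
  have eqf: "f u = f v \<longleftrightarrow> \<phi> u ^ k = \<phi> v ^ k" if "u \<in> U0" "v \<in> U0" for u v
    using that fU \<psi>1(1) by (metis image_subset_iff)
  have fibx: "{u\<in>U. f u = f x} = {x}"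
  proof -
    have "u = x" if "u \<in> U" "f u = f x" for u
    proof -
      have "u \<in> U0" using that UU0 by blast
      then have "\<phi> u ^ k = \<phi> x ^ k" using that eqf[of u x] x(1) by blast
      then have "\<phi> u ^ k = 0" using x(2) k by (simp add: power_0_left)
      then have "\<phi> u = \<phi> x" using x by simp
      then show ?thesis using that UU0 x(1) \<phi>1(1) by (metis subsetD)
    qed
    then show ?thesis using xU by auto
  qed
  have card: "card {u\<in>U. f u = y} = k" if y: "y \<in> f ` U" "y \<noteq> f x" for y
  proof -
    have yV: "y \<in> V" "cmod (\<psi> y) < r ^ k" using y fUim by auto
    have y0: "\<psi> y \<noteq> 0" using y(2) yV x(3,4) \<psi>1(1) by metis
    have "bij_betw \<phi> {u\<in>U. f u = y} {z. cmod z < r \<and> z ^ k = \<psi> y}"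
    proof (rule bij_betw_byWitness[of _ \<phi>'])
      show "\<forall>a\<in>{u \<in> U. f u = y}. \<phi>' (\<phi> a) = a" using \<phi>1(1) UU0 by blast
      show "\<forall>a'\<in>{z. cmod z < r \<and> z ^ k = \<psi> y}. \<phi> (\<phi>' a') = a'" using \<phi>1(2) r1 by auto
      show "\<phi> ` {u \<in> U. f u = y} \<subseteq> {z. cmod z < r \<and> z ^ k = \<psi> y}" using fU(2) by (auto simp: U_def)
      show "\<phi>' ` {z. cmod z < r \<and> z ^ k = \<psi> y} \<subseteq> {u \<in> U. f u = y}"
      proof (rule image_subsetI)
        fix z assume z: "z \<in> {z. cmod z < r \<and> z ^ k = \<psi> y}"
        then have zb: "z \<in> ball 0 1" using r1 by simp
        have u0: "\<phi>' z \<in> U0" "\<phi> (\<phi>' z) = z" using zb \<phi>1(2,4) by auto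
        then have "\<psi> (f (\<phi>' z)) = \<psi> y" using fU(2) z by auto
        then have "f (\<phi>' z) = y" using \<psi>1(1) fU(1) u0 yV(1) by (metis image_subset_iff)
        then show "\<phi>' z \<in> {u \<in> U. f u = y}" using u0 z by (auto simp: U_def)
      qed
    qed
    then have "card {u\<in>U. f u = y} = card {z. cmod z < r \<and> z ^ k = \<psi> y}" by (rule bij_betw_same_card)
    then show ?thesis using card_roots_unit_ball[OF k y0 yV(2) r(1)] by simp
  qed
  have other: "\<exists>y\<in>f ` U. y \<noteq> f x"
  proof -
    have zb: "complex_of_real (r/2) \<in> ball 0 1" using r r1 by simp
    define u where "u = \<phi>' (complex_of_real (r/2))"
    have u: "u \<in> U0" "\<phi> u = complex_of_real (r/2)" unfolding u_def using zb \<phi>1(2,4) by auto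
    have "cmod (\<phi> u) = r/2" unfolding u(2) using r by (simp only: norm_of_real)
    then have "u \<in> U" using r u(1) by (simp add: U_def)
    moreover have "f u \<noteq> f x"
    proof
      assume "f u = f x"
      then have "\<phi> u ^ k = 0" using eqf[OF u(1) x(1)] x(2) k by (simp add: power_0_left)
      then have "\<phi> u = 0" by simp
      then show False using \<open>cmod (\<phi> u) = r/2\<close> r by simp
    qed
    ultimately show ?thesis by blast
  qed
  have locinj: "\<exists>W. openS2 W \<and> u \<in> W \<and> inj_on f W" if u: "u \<in> U" "u \<noteq> x" for u
  proof -
    have uU0: "u \<in> U0" using u UU0 by blast
    have "\<phi> u \<noteq> 0" using u(2) uU0 x(1,2) \<phi>1(1) by metis
    moreover have "deriv (\<lambda>z. z ^ k) (\<phi> u) = of_nat k * \<phi> u ^ (k - 1)"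
      by (rule DERIV_imp_deriv) (auto intro!: derivative_eq_intros)
    ultimately have "deriv (\<lambda>z. z ^ k) (\<phi> u) \<noteq> 0" using k by simp
    moreover have "(\<lambda>z. z ^ k) holomorphic_on (UNIV :: complex set)" by (intro holomorphic_intros)
    ultimately obtain \<rho> where \<rho>: "\<rho> > 0" "inj_on (\<lambda>z. z ^ k) (ball (\<phi> u) \<rho>)"
      using has_complex_derivative_locally_injective[of "\<lambda>z. z ^ k" UNIV "\<phi> u"] by blast
    define W where "W = {w \<in> U0. \<phi> w \<in> ball (\<phi> u) \<rho>}"
    have "openS2 W" unfolding W_def by (rule pre) simp
    moreover have "u \<in> W" using \<rho> uU0 by (simp add: W_def)
    moreover have "inj_on f W"
    proof (rule inj_onI)
      fix a b assume ab: "a \<in> W" "b \<in> W" "f a = f b"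
      then have U0ab: "a \<in> U0" "b \<in> U0" by (auto simp: W_def)
      then have "\<phi> a ^ k = \<phi> b ^ k" using eqf ab(3) by blast
      then have "\<phi> a = \<phi> b" using inj_onD[OF \<rho>(2)] ab by (auto simp: W_def)
      then show "a = b" using \<phi>1(1) U0ab by metis
    qed
    ultimately show ?thesis by blast
  qed
  have "model_nbhd f k x U"
    unfolding model_nbhd_def using opU xU opfU other card fibx locinj by blast
  then show ?thesis using UB that by blast
qed

text \<open>For nested model neighbourhoods the fibre of the inner one lies in that of the outer
  one, so neither degree exceeds the other. This makes \<open>local_degree\<close> well
  defined.\<close>

lemma has_local_degree_unique:
  assumes "has_local_degree f x k" "has_local_degree f x l"
  shows "k = l"
proof -
  have "a \<le> b" if a: "has_local_degree f x a" and b: "has_local_degree f x b" for a b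
  proof -
    have x: "x \<in> S2" using a unfolding has_local_degree_def oriented_disk_chart_def by (meson openin_imp_subset subsetD)
    then obtain U where U: "model_nbhd f b x U" using has_local_degree_model_nbhd[OF b openin_topspace] by auto
    then obtain W where W: "model_nbhd f a x W" "W \<subseteq> U"
      using has_local_degree_model_nbhd[OF a, of U] unfolding model_nbhd_def by blast
    obtain y where y: "y \<in> f ` W" "y \<noteq> f x" using W(1) unfolding model_nbhd_def by blast
    have "card {u\<in>W. f u = y} = a" using W(1) y unfolding model_nbhd_def by blast
    moreover have "card {u\<in>U. f u = y} = b" using U W(2) y unfolding model_nbhd_def by blast
    moreover have "b \<ge> 1" using b unfolding has_local_degree_def by blast
    ultimately show ?thesis
      using card_mono[of "{u\<in>U. f u = y}" "{u\<in>W. f u = y}"] W(2) card.infinite by force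
  qed
  then show ?thesis using assms by (meson le_antisym)
qed

lemma local_degree_eqI: "has_local_degree f x k \<Longrightarrow> local_degree f x = k"
  unfolding local_degree_def using has_local_degree_unique by blast

section \<open>Fibres and evenly covered neighbourhoods\<close>

locale branched_cover =
  fixes f :: "real^3 \<Rightarrow> real^3" and N :: nat
  assumes obc: "oriented_branched_cover f N"
begin

abbreviation m where "m \<equiv> local_degree f"

lemma contf: "continuous_on S2 f" and fS2: "x \<in> S2 \<Longrightarrow> f x \<in> S2"
  and fin_fibre: "y \<in> S2 \<Longrightarrow> finite {x\<in>S2. f x = y}"
  and sum_fibre: "y \<in> S2 \<Longrightarrow> (\<Sum>x | x \<in> S2 \<and> f x = y. m x) = N"
  using obc unfolding oriented_branched_cover_def by (blast, blast, blast, blast)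

lemma has_m: "x \<in> S2 \<Longrightarrow> has_local_degree f x (m x)"
  using obc local_degree_eqI unfolding oriented_branched_cover_def by metis

lemma m_pos: "x \<in> S2 \<Longrightarrow> m x \<ge> 1"
  using has_m unfolding has_local_degree_def by blast

lemma loc_inj_m1:
  assumes "openS2 W" "x \<in> W" "inj_on f W"
  shows "m x = 1"
proof -
  have x: "x \<in> S2" using assms openin_imp_subset by blast
  obtain U where U: "model_nbhd f (m x) x U" "U \<subseteq> W" using has_local_degree_model_nbhd[OF has_m[OF x] assms(1,2)] .
  then obtain y where y: "y \<in> f ` U" "y \<noteq> f x" unfolding model_nbhd_def by blast
  then obtain u where "u \<in> U" "y = f u" by blast
  then have "{v\<in>U. f v = y} = {u}" using inj_onD[OF assms(3)] U(2) by blast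
  moreover have "card {v\<in>U. f v = y} = m x" using U y unfolding model_nbhd_def by blast
  ultimately show ?thesis by simp
qed

definition nbhd :: "real^3 \<Rightarrow> (real^3) set \<Rightarrow> bool" where
  "nbhd x U \<longleftrightarrow> openS2 U \<and> x \<in> U \<and> openS2 (f ` U) \<and>
     (\<forall>y\<in>f ` U. y \<noteq> f x \<longrightarrow> card {u\<in>U. f u = y} = m x) \<and> {u\<in>U. f u = f x} = {x} \<and>
     (\<forall>u\<in>U. u \<noteq> x \<longrightarrow> m u = 1)"

lemma exists_nbhd:
  assumes "openS2 B" "x \<in> B"
  obtains U where "nbhd x U" "U \<subseteq> B"
proof -
  have x: "x \<in> S2" using assms openin_imp_subset by blast
  obtain U where U: "model_nbhd f (m x) x U" "U \<subseteq> B" using has_local_degree_model_nbhd[OF has_m[OF x] assms] .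
  then have "nbhd x U" unfolding nbhd_def model_nbhd_def using loc_inj_m1 by (metis (no_types, lifting))
  then show ?thesis using U that by blast
qed

lemma nbhd_inj:
  assumes "nbhd x U" "m x = 1"
  shows "inj_on f U"
proof (rule inj_onI)
  fix a b assume ab: "a \<in> U" "b \<in> U" "f a = f b"
  show "a = b"
  proof (cases "f a = f x")
    case True
    then have "a \<in> {u\<in>U. f u = f x}" "b \<in> {u\<in>U. f u = f x}" using ab by auto
    then show ?thesis using assms(1) unfolding nbhd_def by auto
  next
    case False
    then have "card {u\<in>U. f u = f a} = 1" using assms ab(1) unfolding nbhd_def by auto
    then obtain c where "{u\<in>U. f u = f a} = {c}" using card_1_singletonE by blast
    then show ?thesis using ab by (metis (mono_tags, lifting) mem_Collect_eq singletonD)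
  qed
qed

lemma nbhd_sum:
  assumes "nbhd x U" "y \<in> f ` U"
  shows "(\<Sum>u | u \<in> U \<and> f u = y. m u) = m x"
proof (cases "y = f x")
  case True
  have "{u. u \<in> U \<and> f u = y} = {x}" using assms True unfolding nbhd_def by auto
  then show ?thesis by simp
next
  case False
  have "(\<Sum>u | u \<in> U \<and> f u = y. m u) = (\<Sum>u | u \<in> U \<and> f u = y. 1)"
    using assms False unfolding nbhd_def by (intro sum.cong) auto
  also have "\<dots> = card {u\<in>U. f u = y}" by simp
  also have "\<dots> = m x" using assms False unfolding nbhd_def by blast
  finally show ?thesis .
qed

lemma open_map:
  assumes "openS2 A"
  shows "openS2 (f ` A)"
proof (subst openin_subopen, intro ballI)
  fix y assume "y \<in> f ` A"
  then obtain x where x: "x \<in> A" "y = f x" by blast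
  obtain U where U: "nbhd x U" "U \<subseteq> A" using exists_nbhd[OF assms x(1)] .
  then show "\<exists>T. openS2 T \<and> y \<in> T \<and> T \<subseteq> f ` A"
    unfolding nbhd_def using x by (intro exI[of _ "f ` U"]) auto
qed

lemma N_pos: "N \<ge> 1"
proof -
  obtain x :: "real^3" where x: "x \<in> S2" using sphere_eq_empty[of 0 1] by (metis ex_in_conv not_one_less_zero)
  have "m x \<le> (\<Sum>z | z \<in> S2 \<and> f z = f x. m z)"
    using fin_fibre[OF fS2[OF x]] x by (intro member_le_sum) auto
  then show ?thesis using m_pos[OF x] sum_fibre[OF fS2[OF x]] by simp
qed

lemma surj: "y \<in> S2 \<Longrightarrow> \<exists>x\<in>S2. f x = y"
  using sum_fibre[of y] N_pos by (metis (mono_tags, lifting) empty_Collect_eq not_one_le_zero sum.empty)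

lemma closed_map:
  assumes "closed A" "A \<subseteq> S2"
  shows "closed (f ` A)"
proof -
  have "compact A" using assms compact_eq_bounded_closed bounded_subset bounded_sphere by blast
  then show ?thesis using compact_continuous_image contf continuous_on_subset assms(2) compact_imp_closed by metis
qed

text \<open>The branched version of an evenly covered neighbourhood. The images of the sets
  \<open>U x\<close> may be larger than \<open>W\<close>, but the preimage of \<open>W\<close> lies
  in their disjoint union.\<close>

definition stack_nbhd :: "real^3 \<Rightarrow> (real^3) set \<Rightarrow> (real^3 \<Rightarrow> (real^3) set) \<Rightarrow> bool" where
  "stack_nbhd y W U \<longleftrightarrow> openS2 W \<and> y \<in> W \<and> (\<forall>x\<in>S2. f x = y \<longrightarrow> nbhd x (U x) \<and> W \<subseteq> f ` U x) \<and>
     (\<forall>x\<in>S2. \<forall>x'\<in>S2. f x = y \<longrightarrow> f x' = y \<longrightarrow> x \<noteq> x' \<longrightarrow> U x \<inter> U x' = {}) \<and>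
     (\<forall>z\<in>S2. f z \<in> W \<longrightarrow> (\<exists>x\<in>S2. f x = y \<and> z \<in> U x))"

lemma stack_nbhdD:
  assumes "stack_nbhd y W U"
  shows "openS2 W" "y \<in> W" "\<And>x. x \<in> S2 \<Longrightarrow> f x = y \<Longrightarrow> nbhd x (U x)" "\<And>x. x \<in> S2 \<Longrightarrow> f x = y \<Longrightarrow> W \<subseteq> f ` U x"
    "\<And>x x'. x \<in> S2 \<Longrightarrow> f x = y \<Longrightarrow> x' \<in> S2 \<Longrightarrow> f x' = y \<Longrightarrow> x \<noteq> x' \<Longrightarrow> U x \<inter> U x' = {}"
    "\<And>z. z \<in> S2 \<Longrightarrow> f z \<in> W \<Longrightarrow> \<exists>x\<in>S2. f x = y \<and> z \<in> U x"
  using assms unfolding stack_nbhd_def by blast+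

text \<open>The fibre is finite and \<open>f\<close> is a closed map, so the points outside the
  chosen neighbourhoods have a closed image that misses \<open>y\<close> and can be removed. The
  sets \<open>B x\<close> allow the neighbourhoods to be confined, for instance to one side of a
  curve.\<close>

lemma stack:
  assumes y: "y \<in> S2" and B: "\<And>x. x \<in> S2 \<Longrightarrow> f x = y \<Longrightarrow> openS2 (B x) \<and> x \<in> B x"
  obtains W U where "stack_nbhd y W U" "\<And>x. x \<in> S2 \<Longrightarrow> f x = y \<Longrightarrow> U x \<subseteq> B x"
proof -
  let ?F = "{x\<in>S2. f x = y}"
  have fin: "finite ?F" by (rule fin_fibre[OF y])
  have "\<exists>d>0. \<forall>x\<in>?F. \<forall>x'\<in>?F. x \<noteq> x' \<longrightarrow> d \<le> dist x x'"
  proof -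
    define D where "D = {dist x x' | x x'. x \<in> ?F \<and> x' \<in> ?F \<and> x \<noteq> x'}"
    have "D \<subseteq> (\<lambda>(x,x'). dist x x') ` (?F \<times> ?F)" by (auto simp: D_def)
    then have "finite D" using fin finite_subset by blast
    then have "finite (insert 1 D)" by simp
    moreover have "\<forall>t\<in>insert 1 D. 0 < t" by (auto simp: D_def)
    ultimately have "0 < Min (insert 1 D)" by (subst Min_gr_iff) auto
    moreover have "Min (insert 1 D) \<le> dist x x'" if "x \<in> ?F" "x' \<in> ?F" "x \<noteq> x'" for x x'
      using \<open>finite (insert 1 D)\<close> that by (intro Min_le) (auto simp: D_def)
    ultimately show ?thesis by blast
  qed
  then obtain d where d: "d > 0" "\<And>x x'. x \<in> ?F \<Longrightarrow> x' \<in> ?F \<Longrightarrow> x \<noteq> x' \<Longrightarrow> d \<le> dist x x'" by blast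
  have "\<exists>U. nbhd x U \<and> U \<subseteq> B x \<inter> ball x (d/2)" if "x \<in> ?F" for x
  proof -
    have "openS2 (B x \<inter> ball x (d/2))" using B that by (intro openin_Int_open) auto
    moreover have "x \<in> B x \<inter> ball x (d/2)" using B that d by auto
    ultimately show ?thesis using exists_nbhd[of "B x \<inter> ball x (d/2)" x] by blast
  qed
  then have "\<exists>U. \<forall>x\<in>?F. nbhd x (U x) \<and> U x \<subseteq> B x \<inter> ball x (d/2)" by (intro bchoice ballI)
  then obtain U where U: "\<And>x. x \<in> ?F \<Longrightarrow> nbhd x (U x) \<and> U x \<subseteq> B x \<inter> ball x (d/2)" by blast
  define K where "K = S2 - \<Union>(U ` ?F)"
  have "openS2 (U x)" if "x \<in> ?F" for x using U[OF that] unfolding nbhd_def by blast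
  then have "openS2 (\<Union>(U ` ?F))" by (intro openin_Union) blast
  from openin_open[THEN iffD1, OF this] obtain T where T: "open T" "\<Union>(U ` ?F) = S2 \<inter> T" by blast
  have "K = S2 - T" unfolding K_def T(2) by blast
  then have "closed K" using T(1) closed_sphere by (simp add: closed_Diff)
  then have clK: "closed (f ` K)" by (rule closed_map) (auto simp: K_def)
  have xUx: "x \<in> U x" if "x \<in> ?F" for x using U[OF that] unfolding nbhd_def by blast
  have yK: "y \<notin> f ` K"
  proof
    assume "y \<in> f ` K"
    then obtain z where "z \<in> S2" "f z = y" "z \<notin> \<Union>(U ` ?F)" unfolding K_def by blast
    then show False using xUx by blast
  qed
  define W where "W = (\<Inter>x\<in>?F. f ` U x) \<inter> (S2 - f ` K)"
  have ne: "?F \<noteq> {}" using surj[OF y] by blast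
  have "openS2 (f ` U x)" if "x \<in> ?F" for x using U[OF that] unfolding nbhd_def by blast
  then have "openS2 (\<Inter>x\<in>?F. f ` U x)" using fin ne by (intro openin_INT2) blast+
  moreover have "openS2 (S2 - f ` K)" using clK by (metis Diff_eq openin_open_Int open_Compl)
  ultimately have opW: "openS2 W" unfolding W_def by (rule openin_Int)
  have yU: "y \<in> f ` U x" if "x \<in> ?F" for x
  proof -
    have "x \<in> U x" using U[OF that] unfolding nbhd_def by blast
    then show ?thesis using that by blast
  qed
  have yW: "y \<in> W" unfolding W_def using yU yK y by blast
  have nb: "nbhd x (U x) \<and> W \<subseteq> f ` U x" "U x \<subseteq> B x" if "x \<in> S2" "f x = y" for x
    using U[of x] that unfolding W_def by (blast, blast)
  have disj: "U x \<inter> U x' = {}" if "x \<in> S2" "f x = y" "x' \<in> S2" "f x' = y" "x \<noteq> x'" for x x'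
  proof (rule ccontr)
    assume "U x \<inter> U x' \<noteq> {}"
    then obtain z where "z \<in> U x" "z \<in> U x'" by blast
    then have "z \<in> ball x (d/2)" "z \<in> ball x' (d/2)" using U[of x] U[of x'] that by blast+
    then have "dist x x' < d" using dist_triangle2[of x x' z] by (simp add: dist_commute)
    then show False using d(2)[of x x'] that by simp
  qed
  have cov: "\<exists>x\<in>S2. f x = y \<and> z \<in> U x" if "z \<in> S2" "f z \<in> W" for z
  proof (rule ccontr)
    assume "\<not> ?thesis"
    then have "z \<in> K" using that(1) unfolding K_def by blast
    then show False using that(2) unfolding W_def by blast
  qed
  have "stack_nbhd y W U"
    unfolding stack_nbhd_def using opW yW nb(1) disj cov by simp
  then show ?thesis using that nb(2) by blast
qed

text \<open>Where all local degrees are \<open>1\<close> the model neighbourhoods are injective and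
  a stack becomes an even cover. As \<open>W\<close> is arbitrary, this applies to curves and to
  open sets alike.\<close>

lemma covering:
  assumes W: "W \<subseteq> S2" "\<And>x. x \<in> S2 \<Longrightarrow> f x \<in> W \<Longrightarrow> m x = 1"
  shows "covering_space {x\<in>S2. f x \<in> W} f W"
  unfolding covering_space_def
proof (intro conjI ballI)
  let ?C = "{x\<in>S2. f x \<in> W}"
  show "continuous_on ?C f" using contf continuous_on_subset by (metis (no_types, lifting) mem_Collect_eq subsetI)
  show "f ` ?C = W" using surj W(1) by blast
  fix y assume y: "y \<in> W"
  then have yS: "y \<in> S2" using W(1) by blast
  obtain T U where st: "stack_nbhd y T U" and US: "\<And>x. x \<in> S2 \<Longrightarrow> f x = y \<Longrightarrow> U x \<subseteq> S2"
    using stack[OF yS, of "\<lambda>_. S2"] openin_subtopology_self[of S2] by blast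
  note T = stack_nbhdD(1,2)[OF st] and cov = stack_nbhdD(6)[OF st] and disj = stack_nbhdD(5)[OF st]
  have U: "nbhd x (U x) \<and> U x \<subseteq> S2 \<and> T \<subseteq> f ` U x" if "x \<in> S2" "f x = y" for x
    using stack_nbhdD(3,4)[OF st that] US[OF that] by blast
  let ?T = "T \<inter> W"
  let ?P = "\<lambda>x. {z \<in> U x. f z \<in> ?T}"
  let ?v = "?P ` {x\<in>S2. f x = y}"
  show "\<exists>T. y \<in> T \<and> openin (top_of_set W) T \<and>
      (\<exists>v. \<Union>v = ?C \<inter> f -` T \<and> (\<forall>u\<in>v. openin (top_of_set ?C) u) \<and> pairwise disjnt v \<and>
         (\<forall>u\<in>v. \<exists>q. homeomorphism u T f q))"
  proof (intro exI[of _ ?T] exI[of _ ?v] conjI ballI)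
    show "y \<in> ?T" using T y by blast
    show "openin (top_of_set W) ?T"
    proof -
      obtain T0 where T0: "open T0" "T = S2 \<inter> T0" using openin_open[THEN iffD1, OF T(1)] by blast
      have "?T = W \<inter> T0" using T0(2) W(1) by blast
      then show ?thesis using T0(1) openin_open by blast
    qed
    show "\<Union>?v = ?C \<inter> f -` ?T" using cov U by fastforce
    show "pairwise disjnt ?v" using disj unfolding pairwise_def disjnt_def by blast
    fix u assume "u \<in> ?v"
    then obtain x where x: "x \<in> S2" "f x = y" "u = ?P x" by blast
    have nx: "nbhd x (U x)" "U x \<subseteq> S2" "T \<subseteq> f ` U x" using U x by auto
    have inj: "inj_on f (U x)" using nbhd_inj[OF nx(1)] W(2)[OF x(1)] x(2) y by blast
    have opu: "openS2 {z \<in> U x. f z \<in> T}"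
    proof -
      have "openS2 (S2 \<inter> f -` T)" using continuous_openin_preimage[OF contf _ T(1)] fS2 by blast
      then have "openS2 (U x \<inter> (S2 \<inter> f -` T))" using nx(1) unfolding nbhd_def by (meson openin_Int)
      moreover have "U x \<inter> (S2 \<inter> f -` T) = {z \<in> U x. f z \<in> T}" using nx(2) by auto
      ultimately show ?thesis by simp
    qed
    show "openin (top_of_set ?C) u"
    proof -
      obtain O' where O': "open O'" "{z \<in> U x. f z \<in> T} = S2 \<inter> O'" using openin_open[THEN iffD1, OF opu] by blast
      have "u = ?C \<inter> O'" using O'(2) nx(2) unfolding x(3) by blast
      then show ?thesis using O'(1) openin_open by blast
    qed
    have "\<exists>q. homeomorphism u ?T f q"
    proof (rule homeomorphism_injective_open_map)
      show "continuous_on u f" using contf continuous_on_subset nx(2) x(3) by (metis (no_types, lifting) mem_Collect_eq subset_iff)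
      show "f ` u = ?T" using nx(3) unfolding x(3) by blast
      show "inj_on f u" using inj unfolding x(3) by (auto intro: inj_on_subset)
      show "openin (top_of_set ?T) (f ` A)" if opA: "openin (top_of_set u) A" for A
      proof -
        obtain O' where O': "open O'" "A = u \<inter> O'" using openin_open[THEN iffD1, OF opA] by blast
        have "openS2 (U x \<inter> O')" using nx(1) O'(1) unfolding nbhd_def by (metis openin_Int_open)
        then have "openS2 (f ` (U x \<inter> O'))" by (rule open_map)
        from openin_open[THEN iffD1, OF this] obtain O2 where O2: "open O2" "f ` (U x \<inter> O') = S2 \<inter> O2" by blast
        have "f ` A = ?T \<inter> O2"
        proof -
          have "f ` A = ?T \<inter> f ` (U x \<inter> O')" unfolding O'(2) x(3) by blast
          then show ?thesis unfolding O2(2) using W(1) by blast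
        qed
        then show ?thesis using O2(1) openin_open by blast
      qed
    qed blast
    then show "\<exists>q. homeomorphism u ?T f q" .
  qed
qed

end

section \<open>A bound for the degree\<close>

lemma punctured_sphere_chart:
  assumes "(q::real^3) \<in> S2"
  obtains \<sigma> \<sigma>' where "homeomorphism (S2 - {q}) (UNIV :: complex set) \<sigma> \<sigma>'"
proof -
  have "rel_frontier (cball (0::real^3) 1) = S2"
    by (simp add: rel_frontier_nonempty_interior)
  then have "(S2 - {q}) homeomorphic (UNIV :: complex set)"
    using homeomorphic_punctured_sphere_affine_gen[of "cball (0::real^3) 1" q "UNIV :: complex set"] assms
    by (simp add: aff_dim_cball)
  then show ?thesis using that unfolding homeomorphic_def by blast
qed

lemma negligible_line: "negligible {z::complex. Im (z / c) = d}" if "c \<noteq> 0"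
proof -
  have "Im (z / c) = (\<i> / cnj c) \<bullet> z" for z
  proof -
    have "z / c = z * cnj c / of_real ((cmod c)\<^sup>2)"
      by (metis complex_div_cnj of_real_power)
    moreover have "\<i> / cnj c = \<i> * c / of_real ((cmod c)\<^sup>2)"
      by (metis complex_div_cnj complex_cnj_cnj complex_mod_cnj of_real_power)
    ultimately show ?thesis by (simp add: inner_complex_def Im_divide_of_real Re_divide_of_real field_simps)
        (simp add: add_divide_distrib diff_divide_distrib)
  qed
  then show ?thesis using negligible_hyperplane[of "\<i> / cnj c" d] that by simp
qed

text \<open>The finitely many lines through two points of \<open>K\<close> have measure zero. Seen
  from a point off these lines, no two points of \<open>K\<close> are in the same or in opposite
  directions.\<close>

lemma exists_generic_base:
  fixes K :: "complex set"
  assumes "finite K"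
  obtains b where "b \<notin> K" "\<And>c c'. c \<in> K \<Longrightarrow> c' \<in> K \<Longrightarrow> c \<noteq> c' \<Longrightarrow> \<not> (Im ((c' - b) / (c - b)) = 0)"
proof -
  define L where "L = (\<lambda>(c, c'). {z. Im (z / (c' - c)) = Im (c / (c' - c))})"
  define I where "I = {(c, c'). c \<in> K \<and> c' \<in> K \<and> c \<noteq> c'}"
  have "I \<subseteq> K \<times> K" by (auto simp: I_def)
  then have "finite I" using assms finite_subset by blast
  have "negligible (\<Union>(L ` I))"
  proof (rule negligible_Union)
    show "finite (L ` I)" using \<open>finite I\<close> by simp
    show "negligible t" if "t \<in> L ` I" for t
      using that unfolding L_def I_def by (auto intro!: negligible_line)
  qed
  then have "negligible (K \<union> \<Union>(L ` I))"
    using negligible_finite[OF assms] by (simp add: negligible_Un)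
  then have "K \<union> \<Union>(L ` I) \<noteq> UNIV" using non_negligible_UNIV by metis
  then obtain b where b: "b \<notin> K" "\<And>c c'. c \<in> K \<Longrightarrow> c' \<in> K \<Longrightarrow> c \<noteq> c' \<Longrightarrow> Im (b / (c' - c)) \<noteq> Im (c / (c' - c))"
    unfolding L_def I_def by fastforce
  show ?thesis
  proof (rule that[OF b(1)])
    fix c c' assume c: "c \<in> K" "c' \<in> K" "c \<noteq> c'"
    show "\<not> (Im ((c' - b) / (c - b)) = 0)"
    proof
      assume "Im ((c' - b) / (c - b)) = 0"
      then have "(c' - b) / (c - b) \<in> \<real>" by (simp add: complex_is_Real_iff)
      then obtain t where t: "(c' - b) / (c - b) = of_real t" by (auto elim: Reals_cases)
      have cb: "c - b \<noteq> 0" using b(1) c(1) by auto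
      then have "c' - b = of_real t * (c - b)" using t by (simp add: field_simps)
      then have e: "(c' - c) = of_real (t - 1) * (c - b)" by (simp add: algebra_simps)
      then have t1: "t \<noteq> 1" using c(3) by auto
      have "(c - b) / (c' - c) = of_real (1 / (t - 1))" unfolding e using cb t1 by simp
      then have "Im ((c - b) / (c' - c)) = 0" by simp
      then show False using b(2)[OF c] by (simp add: diff_divide_distrib)
    qed
  qed
qed

text \<open>The assumption \<open>conn\<close> says that the hypergraph on \<open>I\<close> with the edges \<open>B x\<close> is connected.\<close>

lemma connected_blocks_card:
  fixes B :: "'b \<Rightarrow> 'a set"
  assumes fin: "finite I" "finite J" and ne: "I \<noteq> {}" and BI: "\<And>x. x \<in> J \<Longrightarrow> B x \<subseteq> I"
    and conn: "\<And>M. M \<subseteq> I \<Longrightarrow> (\<And>x. x \<in> J \<Longrightarrow> B x \<subseteq> M \<or> B x \<inter> M = {}) \<Longrightarrow> M = {} \<or> M = I"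
  shows "card I - 1 \<le> (\<Sum>x\<in>J. card (B x) - 1)"
proof -
  \<comment> \<open>A pair \<open>(M, F)\<close> models a vertex set grown from one vertex by the
    edges in \<open>F\<close>. An edge that meets \<open>M\<close> adds at most
    \<open>card (B x) - 1\<close> new vertices, so the bound survives, and no edge leaves a largest
    such \<open>M\<close>.\<close>
  define ok where "ok = (\<lambda>(M, F). M \<subseteq> I \<and> M \<noteq> {} \<and> F \<subseteq> J \<and> card M - 1 \<le> (\<Sum>x\<in>F. card (B x) - 1) \<and> (\<forall>x\<in>F. B x \<subseteq> M))"
  obtain w0 where "w0 \<in> I" using ne by blast
  then have ok0: "ok ({w0}, {})" by (auto simp: ok_def)
  have "\<exists>P. ok P \<and> (\<forall>Q. ok Q \<longrightarrow> card (fst Q) \<le> card (fst P))"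
  proof (rule ex_has_greatest_nat[of ok "({w0}, {})" "\<lambda>P. card (fst P)" "card I + 1"])
    show "\<forall>y. ok y \<longrightarrow> card (fst y) < card I + 1"
      using fin(1) by (auto simp: ok_def less_Suc_eq_le intro: card_mono)
    show "ok ({w0}, {})" by (rule ok0)
  qed
  then obtain P where P: "ok P" "\<And>Q. ok Q \<Longrightarrow> card (fst Q) \<le> card (fst P)" by blast
  obtain M F where "P = (M, F)" by (cases P)
  then have MF: "ok (M, F)" "\<And>Q. ok Q \<Longrightarrow> card (fst Q) \<le> card M" using P by auto
  have finM: "finite M" using MF(1) fin finite_subset by (auto simp: ok_def)
  have "B x \<subseteq> M \<or> B x \<inter> M = {}" if x: "x \<in> J" for x
  proof (rule ccontr)
    assume no: "\<not> ?thesis"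
    then have xF: "x \<notin> F" using MF(1) by (auto simp: ok_def)
    have finB: "finite (B x)" using BI[OF x] fin finite_subset by blast
    have finF: "finite F" using MF(1) fin finite_subset by (auto simp: ok_def)
    have "card (M \<union> B x) + card (M \<inter> B x) = card M + card (B x)"
      using card_Un_Int[OF finM finB] by simp
    moreover have "card (M \<inter> B x) \<ge> 1" using no finM by (metis Int_commute One_nat_def Suc_leI card_gt_0_iff finite_Int)
    moreover have "card M \<ge> 1" using MF(1) finM by (auto simp: ok_def Suc_leI card_gt_0_iff)
    moreover have "card (B x) \<ge> 1" using no finB by (metis One_nat_def Suc_leI card_gt_0_iff Int_empty_left)
    ultimately have "card (M \<union> B x) - 1 \<le> (card M - 1) + (card (B x) - 1)" by linarith
    then have "ok (M \<union> B x, insert x F)"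
      using MF(1) x BI[OF x] xF finF by (auto simp: ok_def)
    then have "card (M \<union> B x) \<le> card M" using MF(2) by fastforce
    moreover have "M \<subset> M \<union> B x" using no by blast
    ultimately show False using psubset_card_mono[of "M \<union> B x" M] finM finB by auto
  qed
  then have "M = I" using conn[of M] MF(1) by (auto simp: ok_def)
  then have "card I - 1 \<le> (\<Sum>x\<in>F. card (B x) - 1)" using MF(1) by (auto simp: ok_def)
  also have "\<dots> \<le> (\<Sum>x\<in>J. card (B x) - 1)" using MF(1) fin by (intro sum_mono2) (auto simp: ok_def)
  finally show ?thesis .
qed

lemma connected_in_one:
  assumes "connected D" "D \<subseteq> \<Union>(U ` F)" "finite F" "\<And>x. x \<in> F \<Longrightarrow> openin (top_of_set S) (U x)" "D \<subseteq> S"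
    and disj: "\<And>x x'. x \<in> F \<Longrightarrow> x' \<in> F \<Longrightarrow> x \<noteq> x' \<Longrightarrow> U x \<inter> U x' = {}"
    and "x \<in> F" "z \<in> D" "z \<in> U x"
  shows "D \<subseteq> U x"
proof (rule ccontr)
  assume no: "\<not> D \<subseteq> U x"
  have o1: "openin (top_of_set S) (U x)" using assms by blast
  have o2: "openin (top_of_set S) (\<Union>(U ` (F - {x})))" using assms(4) by (intro openin_Union) blast
  obtain A where A: "open A" "U x = S \<inter> A" using o1[unfolded openin_open] by blast
  obtain B where B: "open B" "\<Union>(U ` (F - {x})) = S \<inter> B" using o2[unfolded openin_open] by blast
  have "D \<subseteq> A \<union> B"
  proof
    fix y assume y: "y \<in> D"
    then obtain x' where "x' \<in> F" "y \<in> U x'" using assms(2) by blast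
    then have "y \<in> U x \<or> y \<in> \<Union>(U ` (F - {x}))" by blast
    then show "y \<in> A \<union> B" using A(2) B(2) by blast
  qed
  moreover have "A \<inter> B \<inter> D = {}"
  proof -
    have "U x \<inter> \<Union>(U ` (F - {x})) = {}" using disj assms(7) by blast
    then have "S \<inter> A \<inter> B = {}" using A(2) B(2) by blast
    then show ?thesis using assms(5) by blast
  qed
  moreover have "A \<inter> D \<noteq> {}" using A(2) assms by blast
  moreover have "B \<inter> D \<noteq> {}"
  proof -
    obtain y where "y \<in> D" "y \<notin> U x" using no by blast
    then have "y \<notin> A" using A(2) assms(5) by blast
    then show ?thesis using \<open>D \<subseteq> A \<union> B\<close> \<open>y \<in> D\<close> by blast
  qed
  ultimately show False using connectedD[OF assms(1) A(1) B(1)] by blast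
qed

section \<open>Lifting where there is no ramification\<close>

context branched_cover
begin

lemma lift_exists:
  fixes \<sigma>' :: "'c::euclidean_space \<Rightarrow> real^3"
  assumes "simply_connected U" "open U" "continuous_on U \<sigma>'" "\<And>z. z \<in> U \<Longrightarrow> \<sigma>' z \<in> S2"
    and "\<And>z x. z \<in> U \<Longrightarrow> x \<in> S2 \<Longrightarrow> f x = \<sigma>' z \<Longrightarrow> m x = 1"
    and "z0 \<in> U" "v \<in> S2" "f v = \<sigma>' z0"
  obtains k where "continuous_on U k" "\<And>z. z \<in> U \<Longrightarrow> k z \<in> S2" "k z0 = v" "\<And>z. z \<in> U \<Longrightarrow> f (k z) = \<sigma>' z"
proof -
  have cov: "covering_space {x\<in>S2. f x \<in> \<sigma>' ` U} f (\<sigma>' ` U)" by (rule covering) (use assms in auto)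
  obtain k where "continuous_on U k" "k \<in> U \<rightarrow> {x\<in>S2. f x \<in> \<sigma>' ` U}" "k z0 = v" "\<And>y. y \<in> U \<Longrightarrow> f (k y) = \<sigma>' y"
    by (rule covering_space_lift_strong[OF cov, of v z0 U \<sigma>'])
      (use assms open_imp_locally_path_connected in auto)
  then show ?thesis using that[of k] by blast
qed

lemma lift_unique:
  fixes k1 k2 :: "'c::real_normed_vector \<Rightarrow> real^3"
  assumes "connected T" "continuous_on T k1" "continuous_on T k2" "\<And>z. z \<in> T \<Longrightarrow> k1 z \<in> S2" "\<And>z. z \<in> T \<Longrightarrow> k2 z \<in> S2"
    and "\<And>z. z \<in> T \<Longrightarrow> f (k1 z) = f (k2 z)"
    and "\<And>z x. z \<in> T \<Longrightarrow> x \<in> S2 \<Longrightarrow> f x = f (k1 z) \<Longrightarrow> m x = 1"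
    and "a \<in> T" "k1 a = k2 a" "z \<in> T"
  shows "k1 z = k2 z"
proof -
  let ?W = "(\<lambda>z. f (k1 z)) ` T"
  have cov: "covering_space {x\<in>S2. f x \<in> ?W} f ?W" by (rule covering) (use assms fS2 in auto)
  have "continuous_on T (\<lambda>z. f (k1 z))"
    by (rule continuous_on_compose2[OF contf assms(2)]) (use assms(4) in blast)
  then show ?thesis
    by (intro covering_space_lift_unique[OF cov, of k1 a k2 T "\<lambda>z. f (k1 z)" z])
      (use assms in auto)
qed

end

section \<open>Sheets over the slit plane\<close>

text \<open>The ray from \<open>c\<close> away from \<open>0\<close>, that is, the multiples
  \<open>t * c\<close> with \<open>t \<ge> 1\<close>. For \<open>c = 0\<close> the quotient is
  \<open>0\<close> and the ray is empty.\<close>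

definition on_ray :: "complex \<Rightarrow> complex \<Rightarrow> bool" where
  "on_ray c z \<longleftrightarrow> Im (z / c) = 0 \<and> Re (z / c) \<ge> 1"

lemma on_ray_self: "c \<noteq> 0 \<Longrightarrow> on_ray c c"
  by (simp add: on_ray_def)

lemma closed_on_ray: "closed {z. on_ray c z}"
proof (cases "c = 0")
  case False
  have "{z. on_ray c z} = {z. Im (z / c) = 0} \<inter> {z. 1 \<le> Re (z / c)}" by (auto simp: on_ray_def)
  moreover have "closed {z. Im (z / c) = 0}" "closed {z. 1 \<le> Re (z / c)}"
    using False by (auto intro!: closed_Collect_eq closed_Collect_le continuous_intros)
  ultimately show ?thesis by (simp only: closed_Int)
qed (simp add: on_ray_def)

text \<open>In the chart \<open>q\<close> is the point at infinity and the base point is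
  \<open>0\<close>. By \<open>dir\<close> no two critical values are on a line through
  \<open>0\<close>, so their rays to infinity are disjoint.\<close>

locale slit_cover = branched_cover +
  fixes q :: "real^3" and \<sigma> :: "real^3 \<Rightarrow> complex" and \<sigma>' :: "complex \<Rightarrow> real^3" and K :: "complex set"
  assumes q: "q \<in> S2"
    and hom: "homeomorphism (S2 - {q}) UNIV \<sigma> \<sigma>'"
    and fincrit: "finite {x\<in>S2. m x > 1}"
    and K_def: "K = \<sigma> ` (f ` {x\<in>S2. m x > 1} - {q})"
    and K0: "0 \<notin> K"
    and dir: "\<And>c c'. c \<in> K \<Longrightarrow> c' \<in> K \<Longrightarrow> c \<noteq> c' \<Longrightarrow> Im (c' / c) \<noteq> 0"
begin

lemma \<sigma>\<sigma>': "\<sigma> (\<sigma>' z) = z" and \<sigma>'\<sigma>: "x \<in> S2 \<Longrightarrow> x \<noteq> q \<Longrightarrow> \<sigma>' (\<sigma> x) = x"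
  and \<sigma>'S2: "\<sigma>' z \<in> S2" and \<sigma>'q: "\<sigma>' z \<noteq> q" and cont\<sigma>': "continuous_on A \<sigma>'"
  using hom unfolding homeomorphism_def by (blast, blast, blast, blast, metis continuous_on_subset subset_UNIV)

lemma finK: "finite K"
  unfolding K_def using fincrit by simp

lemma m_off_K: "x \<in> S2 \<Longrightarrow> f x = \<sigma>' z \<Longrightarrow> z \<notin> K \<Longrightarrow> m x = 1"
proof (rule ccontr)
  assume x: "x \<in> S2" "f x = \<sigma>' z" "z \<notin> K" "m x \<noteq> 1"
  then have "m x > 1" using m_pos[OF x(1)] by simp
  then have "x \<in> {x\<in>S2. m x > 1}" using x(1) by blast
  moreover have "f x \<noteq> q" unfolding x(2) by (rule \<sigma>'q)
  ultimately have "f x \<in> f ` {x\<in>S2. m x > 1} - {q}" by blast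
  then have "\<sigma> (f x) \<in> K" unfolding K_def by blast
  then show False using x \<sigma>\<sigma>' by simp
qed

text \<open>The plane without the rays is starlike about \<open>0\<close> and contains no critical
  value, so over it the cover splits into \<open>N\<close> sheets, one through each point of
  \<open>I\<close>.\<close>

definition \<Omega> where "\<Omega> = {z. \<forall>c\<in>K. \<not> on_ray c z}"

lemma open_\<Omega>: "open \<Omega>"
proof -
  have "\<Omega> = - (\<Union>c\<in>K. {z. on_ray c z})" by (auto simp: \<Omega>_def)
  moreover have "closed (\<Union>c\<in>K. {z. on_ray c z})" using finK closed_on_ray by (intro closed_UN) auto
  ultimately show ?thesis by (simp only: open_Compl)
qed

lemma zero_\<Omega>: "0 \<in> \<Omega>" by (simp add: \<Omega>_def on_ray_def)

lemma \<Omega>_notin_K: "z \<in> \<Omega> \<Longrightarrow> z \<notin> K"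
  by (cases "z = 0") (use K0 on_ray_self[of z] in \<open>auto simp: \<Omega>_def\<close>)

lemma simply_connected_\<Omega>: "simply_connected \<Omega>"
proof (rule starlike_imp_simply_connected)
  have "closed_segment 0 z \<subseteq> \<Omega>" if z: "z \<in> \<Omega>" for z
  proof
    fix x assume x: "x \<in> closed_segment 0 z"
    obtain s where s0: "0 \<le> s" "s \<le> 1" "x = (1 - s) *\<^sub>R 0 + s *\<^sub>R z"
      using x[unfolded closed_segment_def] by blast
    have s: "0 \<le> s" "s \<le> 1" "x = of_real s * z" using s0 by (simp_all add: scaleR_conv_of_real)
    have False if c: "c \<in> K" "on_ray c x" for c
    proof -
      have e: "x / c = of_real s * (z / c)" using s by simp
      have sm: "Im (of_real s * u) = s * Im u" "Re (of_real s * u) = s * Re u" for u by simp_all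
      have r: "s * Im (z / c) = 0" "s * Re (z / c) \<ge> 1"
        using c(2) unfolding on_ray_def e sm by blast+
      then have s0: "s > 0" using s by (cases "s = 0") auto
      then have "Re (z / c) > 0" using r(2) by (metis less_le_trans not_less zero_less_mult_pos zero_less_one)
      then have "s * Re (z / c) \<le> 1 * Re (z / c)" using s by (intro mult_right_mono) auto
      then have "on_ray c z" using r s0 unfolding on_ray_def by auto
      then show False using z c(1) unfolding \<Omega>_def by blast
    qed
    then show "x \<in> \<Omega>" unfolding \<Omega>_def by blast
  qed
  then show "starlike \<Omega>" unfolding starlike_def using zero_\<Omega> by blast
qed

definition I where "I = {w\<in>S2. f w = \<sigma>' 0}"

lemma finI: "finite I" unfolding I_def by (rule fin_fibre[OF \<sigma>'S2])

lemma cardI: "card I = N"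
proof -
  have "N = (\<Sum>x\<in>I. m x)" using sum_fibre[OF \<sigma>'S2, of 0] unfolding I_def by simp
  also have "\<dots> = (\<Sum>x\<in>I. 1)" by (rule sum.cong) (use m_off_K K0 in \<open>auto simp: I_def\<close>)
  finally show ?thesis by simp
qed

text \<open>The inverse branch of \<open>f\<close> over \<Omega> that starts at \<open>w\<close>;
  its image is the sheet of \<open>w\<close>.\<close>

definition g where "g = (\<lambda>w. SOME k. continuous_on \<Omega> k \<and> (\<forall>z\<in>\<Omega>. k z \<in> S2) \<and> k 0 = w \<and> (\<forall>z\<in>\<Omega>. f (k z) = \<sigma>' z))"

lemma lift_at:
  assumes "simply_connected U" "open U" "U \<inter> K = {}" "z0 \<in> U" "v \<in> S2" "f v = \<sigma>' z0"
  obtains k where "continuous_on U k" "\<And>z. z \<in> U \<Longrightarrow> k z \<in> S2" "k z0 = v" "\<And>z. z \<in> U \<Longrightarrow> f (k z) = \<sigma>' z"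
proof -
  show ?thesis
  proof (rule lift_exists[of U \<sigma>' z0 v])
    fix z x assume "z \<in> U" "x \<in> S2" "f x = \<sigma>' z"
    then show "m x = 1" using m_off_K[of x z] assms(3) by blast
  next
    fix k assume "continuous_on U k" "\<And>z. z \<in> U \<Longrightarrow> k z \<in> S2" "k z0 = v" "\<And>z. z \<in> U \<Longrightarrow> f (k z) = \<sigma>' z"
    then show thesis by (rule that)
  qed (use assms cont\<sigma>' \<sigma>'S2 in auto)
qed

lemma g: assumes "w \<in> I"
  shows "continuous_on \<Omega> (g w)" "\<And>z. z \<in> \<Omega> \<Longrightarrow> g w z \<in> S2" "g w 0 = w" "\<And>z. z \<in> \<Omega> \<Longrightarrow> f (g w z) = \<sigma>' z"
proof -
  have "w \<in> S2" "f w = \<sigma>' 0" using assms by (auto simp: I_def)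
  moreover have "\<Omega> \<inter> K = {}" using \<Omega>_notin_K by blast
  ultimately obtain k where "continuous_on \<Omega> k" "\<And>z. z \<in> \<Omega> \<Longrightarrow> k z \<in> S2" "k 0 = w" "\<And>z. z \<in> \<Omega> \<Longrightarrow> f (k z) = \<sigma>' z"
    using lift_at[OF simply_connected_\<Omega> open_\<Omega> _ zero_\<Omega>] by metis
  then have "\<exists>k. continuous_on \<Omega> k \<and> (\<forall>z\<in>\<Omega>. k z \<in> S2) \<and> k 0 = w \<and> (\<forall>z\<in>\<Omega>. f (k z) = \<sigma>' z)" by blast
  then have "continuous_on \<Omega> (g w) \<and> (\<forall>z\<in>\<Omega>. g w z \<in> S2) \<and> g w 0 = w \<and> (\<forall>z\<in>\<Omega>. f (g w z) = \<sigma>' z)"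
    unfolding g_def by (rule someI_ex)
  then show "continuous_on \<Omega> (g w)" "\<And>z. z \<in> \<Omega> \<Longrightarrow> g w z \<in> S2" "g w 0 = w" "\<And>z. z \<in> \<Omega> \<Longrightarrow> f (g w z) = \<sigma>' z"
    by blast+
qed

lemma unique_lift:
  assumes "connected T" "T \<inter> K = {}" "continuous_on T k1" "continuous_on T k2"
    "\<And>z. z \<in> T \<Longrightarrow> k1 z \<in> S2 \<and> k2 z \<in> S2 \<and> f (k1 z) = \<sigma>' z \<and> f (k2 z) = \<sigma>' z"
    "a \<in> T" "k1 a = k2 a" "z \<in> T"
  shows "k1 z = k2 z"
proof (rule lift_unique[OF assms(1,3,4) _ _ _ _ assms(6,7,8)])
  show "m x = 1" if "z \<in> T" "x \<in> S2" "f x = f (k1 z)" for z x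
    using m_off_K[of x z] that assms(2,5) by force
qed (use assms(5) in auto)

lemma connected_\<Omega>: "connected \<Omega>"
  using simply_connected_\<Omega> simply_connected_imp_connected by blast

lemma g_inj: "w \<in> I \<Longrightarrow> w' \<in> I \<Longrightarrow> z \<in> \<Omega> \<Longrightarrow> g w z = g w' z \<Longrightarrow> w = w'"
  using unique_lift[OF connected_\<Omega> _ g(1) g(1), of w w' z 0] g \<Omega>_notin_K zero_\<Omega> by (metis disjoint_iff)

lemma g_surj:
  assumes "z \<in> \<Omega>" "v \<in> S2" "f v = \<sigma>' z"
  obtains w where "w \<in> I" "g w z = v"
proof -
  have d: "\<Omega> \<inter> K = {}" using \<Omega>_notin_K by blast
  obtain k where k: "continuous_on \<Omega> k" "\<And>z. z \<in> \<Omega> \<Longrightarrow> k z \<in> S2" "k z = v" "\<And>z. z \<in> \<Omega> \<Longrightarrow> f (k z) = \<sigma>' z"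
    by (rule lift_at[OF simply_connected_\<Omega> open_\<Omega> d assms]) blast
  have w: "k 0 \<in> I" using k(2,4)[OF zero_\<Omega>] by (simp add: I_def)
  have "g (k 0) z = k z"
  proof (rule unique_lift[OF connected_\<Omega> d g(1)[OF w] k(1) _ zero_\<Omega> _ assms(1)])
    show "g (k 0) z \<in> S2 \<and> k z \<in> S2 \<and> f (g (k 0) z) = \<sigma>' z \<and> f (k z) = \<sigma>' z" if "z \<in> \<Omega>" for z
      using g(2,4)[OF w that] k(2,4)[OF that] by simp
    show "g (k 0) 0 = k 0" by (rule g(3)[OF w])
  qed
  then have "g (k 0) z = v" unfolding k(3) .
  then show ?thesis by (rule that[OF w])
qed

lemma stack_at:
  assumes "z \<in> A" "open A"
  shows "\<exists>W U r. stack_nbhd (\<sigma>' z) W U \<and> r > 0 \<and> ball z r \<subseteq> A \<and> \<sigma>' ` ball z r \<subseteq> W"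
proof -
  obtain W U where st: "stack_nbhd (\<sigma>' z) W U"
    by (rule stack[OF \<sigma>'S2, of z "\<lambda>_. S2"]) (simp_all only: openin_subtopology_self)
  obtain T where T: "open T" "W = S2 \<inter> T" using stack_nbhdD(1)[OF st, unfolded openin_open] by blast
  have "open (\<sigma>' -` T)" using open_vimage[OF T(1) cont\<sigma>'] .
  moreover have "z \<in> \<sigma>' -` T" using stack_nbhdD(2)[OF st] T(2) by blast
  ultimately have "open (A \<inter> \<sigma>' -` T)" "z \<in> A \<inter> \<sigma>' -` T" using assms by auto
  then obtain r where r: "r > 0" "ball z r \<subseteq> A \<inter> \<sigma>' -` T" using openE by blast
  then have "\<sigma>' ` ball z r \<subseteq> W" using T(2) \<sigma>'S2 by blast
  then show ?thesis using st r by blast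
qed

text \<open>A connected set over \<open>W\<close> cannot pass from one of the disjoint open sets
  \<open>U x\<close> to another.\<close>

lemma lift_in_one:
  assumes st: "stack_nbhd (\<sigma>' c) W U" and D: "connected D" "\<sigma>' ` D \<subseteq> W"
    and k: "continuous_on D k" "\<And>z. z \<in> D \<Longrightarrow> k z \<in> S2 \<and> f (k z) = \<sigma>' z" and "z0 \<in> D"
  shows "\<exists>x\<in>S2. f x = \<sigma>' c \<and> (\<forall>z\<in>D. k z \<in> U x)"
proof -
  let ?F = "{x\<in>S2. f x = \<sigma>' c}"
  have sub: "k ` D \<subseteq> \<Union>(U ` ?F)" using stack_nbhdD(6)[OF st] k(2) D(2) by fastforce
  then obtain x where x: "x \<in> ?F" "k z0 \<in> U x" using assms(6) by blast
  have "k ` D \<subseteq> U x"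
  proof (rule connected_in_one[where F = ?F and S = S2 and z = "k z0", OF _ sub fin_fibre[OF \<sigma>'S2] _ _ _ x(1) _ x(2)])
    show "connected (k ` D)" using connected_continuous_image k(1) D(1) by blast
    show "openS2 (U x)" if "x \<in> ?F" for x using stack_nbhdD(3)[OF st, of x] that unfolding nbhd_def by blast
    show "k ` D \<subseteq> S2" using k(2) by blast
    show "U x \<inter> U x' = {}" if "x \<in> ?F" "x' \<in> ?F" "x \<noteq> x'" for x x'
      using stack_nbhdD(5)[OF st, of x x'] that by blast
    show "k z0 \<in> k ` D" using assms(6) by blast
  qed
  then show ?thesis using x by blast
qed

text \<open>Near \<open>c\<close> only the ray of \<open>c\<close> itself is removed.\<close>

definition around :: "complex \<Rightarrow> complex set" where
  "around c = {z. \<forall>c'\<in>K - {c}. \<not> on_ray c' z}"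

lemma open_around: "open (around c)" and in_around: "c \<in> K \<Longrightarrow> c \<in> around c"
proof -
  have "around c = - (\<Union>c\<in>K-{c}. {z. on_ray c z})" by (auto simp: around_def)
  moreover have "closed (\<Union>c\<in>K-{c}. {z. on_ray c z})" using finK closed_on_ray by (intro closed_UN) auto
  ultimately show "open (around c)" by (simp only: open_Compl)
  show "c \<in> around c" if "c \<in> K" using dir[of _ c] that unfolding around_def on_ray_def by blast
qed

definition SU where
  "SU c = (SOME (A, B, e). stack_nbhd (\<sigma>' c) A B \<and> e > 0 \<and> ball c e \<subseteq> around c \<and> \<sigma>' ` ball c e \<subseteq> A)"

definition W where "W c = fst (SU c)"
definition U where "U c = fst (snd (SU c))"
definition r where "r c = snd (snd (SU c))"

lemma WUr: assumes "c \<in> K"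
  shows "stack_nbhd (\<sigma>' c) (W c) (U c)" "r c > 0" "ball c (r c) \<subseteq> around c" "\<sigma>' ` ball c (r c) \<subseteq> W c"
proof -
  have "\<exists>P. case P of (A, B, e) \<Rightarrow> stack_nbhd (\<sigma>' c) A B \<and> e > 0 \<and> ball c e \<subseteq> around c \<and> \<sigma>' ` ball c e \<subseteq> A"
    using stack_at[OF in_around[OF assms] open_around] by auto
  from someI_ex[OF this]
  have "case SU c of (A, B, e) \<Rightarrow> stack_nbhd (\<sigma>' c) A B \<and> e > 0 \<and> ball c e \<subseteq> around c \<and> \<sigma>' ` ball c e \<subseteq> A"
    unfolding SU_def .
  then show "stack_nbhd (\<sigma>' c) (W c) (U c)" "r c > 0" "ball c (r c) \<subseteq> around c" "\<sigma>' ` ball c (r c) \<subseteq> W c"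
    unfolding W_def U_def r_def case_prod_beta by blast+
qed

definition D where "D c = ball c (r c) \<inter> \<Omega>"

lemma D_eq: "c \<in> K \<Longrightarrow> D c = {z \<in> ball c (r c). \<not> on_ray c z}"
  using WUr(3)[of c] unfolding D_def \<Omega>_def around_def by blast

text \<open>The slit disk is starlike about a point \<open>a\<close> on the line of the slit,
  slightly beyond its tip \<open>c\<close> on the side of \<open>0\<close>.\<close>

lemma connected_D: assumes c: "c \<in> K" shows "connected (D c)" "D c \<noteq> {}"
proof -
  have c0: "c \<noteq> 0" using c K0 by auto
  define \<delta> where "\<delta> = min (1/2) (r c / (2 * cmod c))"
  have \<delta>: "0 < \<delta>" "\<delta> < 1" "\<delta> * cmod c < r c"
  proof -
    show "0 < \<delta>" using WUr(2)[OF c] c0 by (simp add: \<delta>_def)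
    show "\<delta> < 1" by (simp add: \<delta>_def)
    have "\<delta> * cmod c \<le> r c / (2 * cmod c) * cmod c" by (intro mult_right_mono) (auto simp: \<delta>_def)
    also have "\<dots> = r c / 2" using c0 by simp
    also have "\<dots> < r c" using WUr(2)[OF c] by simp
    finally show "\<delta> * cmod c < r c" .
  qed
  define a where "a = of_real (1 - \<delta>) * c"
  have ac: "a / c = of_real (1 - \<delta>)" using c0 by (simp add: a_def)
  have "c - a = of_real \<delta> * c" by (simp add: a_def algebra_simps)
  then have aball: "a \<in> ball c (r c)" using \<delta> by (simp add: dist_norm norm_mult)
  have "\<not> on_ray c a" unfolding on_ray_def ac using \<delta> by simp
  then have aD: "a \<in> D c" unfolding D_eq[OF c] using aball by blast
  have "closed_segment a z \<subseteq> D c" if z: "z \<in> D c" for z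
  proof
    fix x assume x: "x \<in> closed_segment a z"
    have zb: "z \<in> ball c (r c)" "\<not> on_ray c z" using z unfolding D_eq[OF c] by auto
    have xb: "x \<in> ball c (r c)" using closed_segment_subset[OF aball zb(1) convex_ball] x by blast
    obtain s where s: "0 \<le> s" "s \<le> 1" "x = (1 - s) *\<^sub>R a + s *\<^sub>R z" using x by (auto simp: in_segment)
    have "\<not> on_ray c x"
    proof
      assume ray: "on_ray c x"
      have e: "x / c = of_real ((1 - s) * (1 - \<delta>)) + of_real s * (z / c)"
      proof -
        have "x / c = of_real (1 - s) * (a / c) + of_real s * (z / c)"
          unfolding s(3) add_divide_distrib by (simp add: scaleR_conv_of_real)
        then show ?thesis unfolding ac by simp
      qed
      have sm: "Im (of_real r + of_real s * u) = s * Im u" "Re (of_real r + of_real s * u) = r + s * Re u" for r u by simp_all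
      have r: "s * Im (z / c) = 0" "1 \<le> (1 - s) * (1 - \<delta>) + s * Re (z / c)"
        using ray unfolding on_ray_def e sm by blast+
      have "(1 - s) * (1 - \<delta>) \<le> (1 - s) * 1" using s \<delta> by (intro mult_left_mono) auto
      then have le: "s * 1 \<le> s * Re (z / c)" using r(2) by simp
      have "s \<noteq> 0" using r(2) \<delta> by auto
      then have "Im (z / c) = 0" "1 \<le> Re (z / c)" using r(1) le s(1) by (auto simp: mult_le_cancel_left)
      then show False using zb(2) unfolding on_ray_def by blast
    qed
    then show "x \<in> D c" using xb unfolding D_eq[OF c] by blast
  qed
  then have "starlike (D c)" unfolding starlike_def using aD by blast
  then show "connected (D c)" by (rule starlike_imp_connected)
  show "D c \<noteq> {}" using aD by blast
qed

text \<open>The sheets that come together at \<open>x\<close>: over the slit disk around the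
  critical value \<open>\<sigma> (f x)\<close> they stay near \<open>x\<close>.\<close>

definition block where "block x = {w\<in>I. \<forall>z\<in>D (\<sigma> (f x)). g w z \<in> U (\<sigma> (f x)) x}"

text \<open>All points over the critical values in the chart. A noncritical one has a block with a
  single sheet and contributes \<open>0\<close> to the sum.\<close>

definition J where "J = {x\<in>S2. f x \<in> \<sigma>' ` K}"

lemma in_block:
  assumes c: "c \<in> K" and w: "w \<in> I" and x: "x \<in> S2" "f x = \<sigma>' c" and z: "z \<in> D c" "g w z \<in> U c x"
  shows "w \<in> block x"
proof -
  have D: "D c \<subseteq> \<Omega>" "\<sigma>' ` D c \<subseteq> W c" using WUr(4)[OF c] by (auto simp: D_def)
  obtain x' where x': "x' \<in> S2" "f x' = \<sigma>' c" "\<And>z. z \<in> D c \<Longrightarrow> g w z \<in> U c x'"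
    using lift_in_one[OF WUr(1)[OF c] connected_D(1)[OF c] D(2) continuous_on_subset[OF g(1)[OF w] D(1)] _ z(1)]
      g(2,4)[OF w] D(1) by blast
  have "x' = x" using stack_nbhdD(5)[OF WUr(1)[OF c] x'(1,2) x] x'(3)[OF z(1)] z(2) by blast
  then show ?thesis using x' w x \<sigma>\<sigma>' unfolding block_def by auto
qed

text \<open>Evaluation at one point of the slit disk matches the sheets of the block with the points
  of that fibre near \<open>x\<close>; by the local model there are \<open>m x\<close> of
  them.\<close>

lemma card_block: assumes x: "x \<in> J" shows "card (block x) = m x"
proof -
  obtain c where c: "c \<in> K" "f x = \<sigma>' c" "x \<in> S2" using x unfolding J_def by blast
  obtain z where z: "z \<in> D c" using connected_D(2)[OF c(1)] by blast
  have z\<Omega>: "z \<in> \<Omega>" and zb: "z \<in> ball c (r c)" using z by (auto simp: D_def)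
  have "bij_betw (\<lambda>w. g w z) (block x) {u\<in>U c x. f u = \<sigma>' z}"
    unfolding bij_betw_def
  proof
    show "inj_on (\<lambda>w. g w z) (block x)" using g_inj z\<Omega> unfolding block_def inj_on_def by blast
    show "(\<lambda>w. g w z) ` block x = {u\<in>U c x. f u = \<sigma>' z}"
    proof (intro equalityI subsetI)
      fix u assume "u \<in> (\<lambda>w. g w z) ` block x"
      then show "u \<in> {u\<in>U c x. f u = \<sigma>' z}" using g(4) z\<Omega> z c(2) \<sigma>\<sigma>' unfolding block_def by auto
    next
      fix u assume u: "u \<in> {u\<in>U c x. f u = \<sigma>' z}"
      have "openS2 (U c x)" using stack_nbhdD(3)[OF WUr(1)[OF c(1)] c(3,2)] unfolding nbhd_def by blast
      then have "u \<in> S2" using u openin_imp_subset by blast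
      then obtain w where w: "w \<in> I" "g w z = u" using g_surj[OF z\<Omega>] u by blast
      then have "w \<in> block x" using in_block[OF c(1) w(1) c(3,2) z] u by blast
      then show "u \<in> (\<lambda>w. g w z) ` block x" using w(2) by blast
    qed
  qed
  then have "card (block x) = card {u\<in>U c x. f u = \<sigma>' z}" by (rule bij_betw_same_card)
  moreover have "\<sigma>' z \<noteq> f x"
  proof
    assume "\<sigma>' z = f x"
    then have "z = c" using c(2) \<sigma>\<sigma>' by metis
    then show False using z\<Omega> \<Omega>_notin_K c(1) by blast
  qed
  moreover have "\<sigma>' z \<in> f ` U c x" using stack_nbhdD(4)[OF WUr(1)[OF c(1)] c(3,2)] WUr(4)[OF c(1)] zb by blast
  moreover have "nbhd x (U c x)" by (rule stack_nbhdD(3)[OF WUr(1)[OF c(1)] c(3,2)])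
  ultimately show ?thesis unfolding nbhd_def by simp
qed

definition sheets where "sheets M = (\<Union>w\<in>M. g w ` \<Omega>)"

text \<open>The neighbourhood of \<open>v\<close> and the preimage of the ball around
  \<open>z\<close> are both open, so a point of a sheet can be found in both. In the gluing argument
  this replaces closures of unions by single sheets.\<close>

lemma adherent_sheet:
  assumes v: "v \<in> S2" "f v = \<sigma>' z" and st: "stack_nbhd (\<sigma>' z) W' U'" and e: "e > 0" and M: "M \<subseteq> I"
    and cl: "v \<in> closure (sheets M)"
  obtains w z1 where "w \<in> M" "z1 \<in> \<Omega>" "z1 \<in> ball z e" "g w z1 \<in> U' v"
proof -
  have n: "nbhd v (U' v)" by (rule stack_nbhdD(3)[OF st v])
  obtain T where T: "open T" "U' v = S2 \<inter> T" using n[unfolded nbhd_def openin_open] by blast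
  have "v \<in> U' v" using n unfolding nbhd_def by blast
  have "continuous_on (S2 - {q}) \<sigma>" using hom unfolding homeomorphism_def by blast
  then have "openin (top_of_set (S2 - {q})) ((S2 - {q}) \<inter> \<sigma> -` ball z e)" by (rule continuous_openin_preimage_gen) simp
  then have "openS2 ((S2 - {q}) \<inter> \<sigma> -` ball z e)"
    by (rule openin_trans) (simp add: openin_diff Diff_eq openin_open_Int open_Compl)
  then have "openS2 (S2 \<inter> f -` ((S2 - {q}) \<inter> \<sigma> -` ball z e))"
    using continuous_openin_preimage[OF contf] fS2 by blast
  then obtain T2 where T2: "open T2" "S2 \<inter> f -` ((S2 - {q}) \<inter> \<sigma> -` ball z e) = S2 \<inter> T2"
    unfolding openin_open by blast
  have "v \<in> S2 \<inter> f -` ((S2 - {q}) \<inter> \<sigma> -` ball z e)" using v e \<sigma>'S2 \<sigma>'q \<sigma>\<sigma>' by simp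
  then have "v \<in> T \<inter> T2" using T2 T \<open>v \<in> U' v\<close> by blast
  moreover have "open (T \<inter> T2)" using T T2 by blast
  ultimately obtain y where y: "y \<in> sheets M" "y \<in> T \<inter> T2" using cl closure_iff_nhds_not_empty by blast
  then obtain w z1 where w: "w \<in> M" "z1 \<in> \<Omega>" "y = g w z1" unfolding sheets_def by blast
  have wI: "w \<in> I" using w(1) M by blast
  have yS: "y \<in> S2" "f y = \<sigma>' z1" using g(2,4)[OF wI w(2)] w(3) by auto
  then have "y \<in> S2 \<inter> f -` ((S2 - {q}) \<inter> \<sigma> -` ball z e)" using y(2) T2(2) by blast
  then have "z1 \<in> ball z e" using yS(2) \<sigma>\<sigma>' by simp
  moreover have "g w z1 \<in> U' v" using y(2) T(2) yS(1) w(3) by blast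
  ultimately show ?thesis using that w by blast
qed

text \<open>The inequalities describe an open cone with apex \<open>c\<close> around the ray of \<open>c\<close>.\<close>

lemma exists_cone:
  assumes c: "c \<in> K"
  obtains \<eta> where "\<eta> > 0" "\<And>z c'. Re (z / c - 1) > 0 \<Longrightarrow> \<bar>Im (z / c - 1)\<bar> < \<eta> * Re (z / c - 1) \<Longrightarrow> c' \<in> K - {c} \<Longrightarrow> \<not> on_ray c' z"
proof -
  \<comment> \<open>The slopes of the other critical values relative to the ray of \<open>c\<close>,
    taken in the half plane that the cone can reach; they are positive by
    \<open>dir\<close>.\<close>
  define E where "E = (\<lambda>c'. \<bar>Im (c' / c)\<bar> / Re (c' / c)) ` {c'\<in>K - {c}. Re (c' / c) > 0}"
  have "finite (insert 1 E)" using finK by (simp add: E_def)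
  define \<eta> where "\<eta> = Min (insert 1 E)"
  have pos: "\<eta> > 0"
    unfolding \<eta>_def using \<open>finite (insert 1 E)\<close> dir[OF c]
    by (subst Min_gr_iff) (auto simp: E_def)
  show ?thesis
  proof (rule that[OF pos])
    fix z c' assume z: "Re (z / c - 1) > 0" "\<bar>Im (z / c - 1)\<bar> < \<eta> * Re (z / c - 1)" and c': "c' \<in> K - {c}"
    show "\<not> on_ray c' z"
    proof
      assume ray: "on_ray c' z"
      have c'0: "c' \<noteq> 0" using c' K0 by auto
      define t where "t = Re (z / c')"
      have t: "t \<ge> 1" "z / c' = of_real t" using ray unfolding on_ray_def t_def by (auto simp: complex_eq_iff)
      then have "z = of_real t * c'" using c'0 by (simp add: field_simps)
      then have e: "z / c = of_real t * (c' / c)" by simp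
      have sm: "Im (of_real r * u - 1) = r * Im u" "Re (of_real r * u - 1) = r * Re u - 1" for r and u :: complex by simp_all
      have Re: "t * Re (c' / c) > 1" and Im: "\<bar>t * Im (c' / c)\<bar> < \<eta> * (t * Re (c' / c) - 1)"
        using z unfolding e sm by simp_all
      have Rpos: "Re (c' / c) > 0" using Re t(1) by (smt (verit) mult_nonneg_nonpos)
      have "\<bar>Im (c' / c)\<bar> / Re (c' / c) \<in> insert 1 E" using c' Rpos unfolding E_def by blast
      then have "\<eta> \<le> \<bar>Im (c' / c)\<bar> / Re (c' / c)" unfolding \<eta>_def using \<open>finite (insert 1 E)\<close> by (rule Min_le[rotated])
      then have "\<eta> * Re (c' / c) \<le> \<bar>Im (c' / c)\<bar>" using Rpos by (simp add: field_simps)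
      then have "t * (\<eta> * Re (c' / c)) \<le> t * \<bar>Im (c' / c)\<bar>" using t(1) by (intro mult_left_mono) auto
      also have "\<dots> = \<bar>t * Im (c' / c)\<bar>" using t(1) by (simp add: abs_mult)
      also note Im
      also have "\<eta> * (t * Re (c' / c) - 1) < \<eta> * (t * Re (c' / c))" using pos by (intro mult_strict_left_mono) auto
      finally show False by (simp add: algebra_simps)
    qed
  qed
qed

end

section \<open>Gluing the sheets along the slits\<close>

lemma convex_affine_vimage:
  fixes c :: complex
  assumes "convex S"
  shows "convex {z. z / c - 1 \<in> S}"
proof (rule convexI)
  fix x y and u v :: real
  assume h: "x \<in> {z. z / c - 1 \<in> S}" "y \<in> {z. z / c - 1 \<in> S}" "0 \<le> u" "0 \<le> v" "u + v = 1"
  have uv: "(of_real u + of_real v :: complex) = 1" using h(5) by (metis of_real_1 of_real_add)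
  have "(u *\<^sub>R x + v *\<^sub>R y) / c - 1 = of_real u * (x / c) + of_real v * (y / c) - (of_real u + of_real v)"
    unfolding uv by (simp add: add_divide_distrib scaleR_conv_of_real)
  also have "\<dots> = u *\<^sub>R (x / c - 1) + v *\<^sub>R (y / c - 1)"
    by (simp add: scaleR_conv_of_real algebra_simps)
  finally show "u *\<^sub>R x + v *\<^sub>R y \<in> {z. z / c - 1 \<in> S}"
    using convexD[OF assms, of "x / c - 1" "y / c - 1" u v] h by simp
qed

lemma convex_open_cone:
  fixes \<eta> s :: real
  shows "convex {z. Re z > 0 \<and> \<bar>Im z\<bar> < \<eta> * Re z}" "open {z. Re z > 0 \<and> \<bar>Im z\<bar> < \<eta> * Re z}"
    "convex {z. s * Im z > 0}"
proof -
  have e: "{z. Re z > 0 \<and> \<bar>Im z\<bar> < \<eta> * Re z} = {z. Re z > 0} \<inter> {z. Complex (-\<eta>) 1 \<bullet> z < 0} \<inter> {z. Complex (-\<eta>) (-1) \<bullet> z < 0}"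
    by (auto simp: inner_complex_def abs_less_iff)
  show "convex {z. Re z > 0 \<and> \<bar>Im z\<bar> < \<eta> * Re z}"
    unfolding e by (intro convex_Int convex_halfspace_lt convex_halfspace_Re_gt)
  show "open {z. Re z > 0 \<and> \<bar>Im z\<bar> < \<eta> * Re z}"
    unfolding e by (intro open_Int open_halfspace_lt open_halfspace_Re_gt)
  have e2: "{z. s * Im z > 0} = {z. Complex 0 s \<bullet> z > 0}" by (auto simp: inner_complex_def)
  show "convex {z. s * Im z > 0}" unfolding e2 by (rule convex_halfspace_gt)
qed

context slit_cover
begin

lemma dense_\<Omega>: assumes A: "open A" "A \<noteq> {}" shows "A \<inter> \<Omega> \<noteq> {}"
proof
  assume "A \<inter> \<Omega> = {}"
  then have "A \<subseteq> (\<Union>c\<in>K. {z. Im (z / c) = 0})" unfolding \<Omega>_def on_ray_def by blast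
  moreover have "negligible (\<Union>c\<in>K. {z. Im (z / c) = 0})"
  proof (rule negligible_Union)
    show "finite ((\<lambda>c. {z. Im (z / c) = 0}) ` K)" using finK by simp
    show "negligible t" if tK: "t \<in> (\<lambda>c. {z. Im (z / c) = 0}) ` K" for t
    proof -
      obtain c where "c \<in> K" "t = {z. Im (z / c) = 0}" using tK by blast
      then show ?thesis using negligible_line[of c 0] K0 by metis
    qed
  qed
  ultimately have "negligible A" using negligible_subset by blast
  then show False using open_not_negligible A by blast
qed

definition Y where "Y = {x\<in>S2. f x \<noteq> q}"

text \<open>Puncturing the sphere at one point of the fibre of \<open>q\<close> gives a plane, where
  the complement of the finitely many others is connected.\<close>

lemma connected_Y: "connected Y"
proof -
  let ?F = "{x\<in>S2. f x = q}"
  have fin: "finite ?F" by (rule fin_fibre[OF q])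
  obtain p where p: "p \<in> S2" "f p = q" using surj[OF q] by blast
  obtain \<tau> \<tau>' where t: "homeomorphism (S2 - {p}) (UNIV :: complex set) \<tau> \<tau>'" using punctured_sphere_chart[OF p(1)] .
  have t1: "\<tau>' (\<tau> x) = x" if "x \<in> S2 - {p}" for x using t that unfolding homeomorphism_def by blast
  have t2: "\<tau> (\<tau>' z) = z" "\<tau>' z \<in> S2 - {p}" for z using t unfolding homeomorphism_def by blast+
  let ?T = "- (\<tau> ` (?F - {p})) :: complex set"
  have "connected ?T"
    using fin by (intro path_connected_imp_connected path_connected_complement_countable) (auto intro: countable_finite)
  moreover have "continuous_on UNIV \<tau>'" using t unfolding homeomorphism_def by blast
  then have "continuous_on ?T \<tau>'" by (rule continuous_on_subset) simp
  ultimately have "connected (\<tau>' ` ?T)" using connected_continuous_image by blast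
  moreover have "\<tau>' ` ?T = Y"
  proof (intro equalityI subsetI)
    fix x assume "x \<in> \<tau>' ` ?T"
    then obtain z where z: "x = \<tau>' z" "z \<notin> \<tau> ` (?F - {p})" by blast
    have x: "x \<in> S2 - {p}" "\<tau> x = z" using t2 z(1) by auto
    then have "x \<notin> ?F" using z(2) by blast
    then show "x \<in> Y" using x unfolding Y_def by blast
  next
    fix x assume x: "x \<in> Y"
    then have xp: "x \<in> S2 - {p}" using p by (auto simp: Y_def)
    have "\<tau> x \<notin> \<tau> ` (?F - {p})"
    proof
      assume "\<tau> x \<in> \<tau> ` (?F - {p})"
      then obtain y where y: "y \<in> ?F - {p}" "\<tau> x = \<tau> y" by blast
      then have yS: "y \<in> S2 - {p}" by blast
      have "x = y" using arg_cong[OF y(2), of \<tau>'] unfolding t1[OF xp] t1[OF yS] .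
      moreover have "f x \<noteq> q" "f y = q" using x y(1) unfolding Y_def by blast+
      ultimately show False by blast
    qed
    then have "\<tau> x \<in> ?T" by simp
    then have "\<tau>' (\<tau> x) \<in> \<tau>' ` ?T" by (rule imageI)
    then show "x \<in> \<tau>' ` ?T" unfolding t1[OF xp] .
  qed
  ultimately show ?thesis by simp
qed

lemma \<sigma>_f: "v \<in> Y \<Longrightarrow> f v = \<sigma>' (\<sigma> (f v))"
  using \<sigma>'\<sigma>[of "f v"] fS2[of v] unfolding Y_def by auto

lemma sheets_dense: "Y \<subseteq> closure (sheets I)"
proof
  fix v assume v: "v \<in> Y"
  have "sheets I \<inter> T \<noteq> {}" if T: "open T" "v \<in> T" for T
  proof -
    have vS: "v \<in> S2" using v by (simp add: Y_def)
    have "openS2 (S2 \<inter> T)" using T(1) by (rule openin_open_Int)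
    from open_map[OF this] obtain A where A: "open A" "f ` (S2 \<inter> T) = S2 \<inter> A" unfolding openin_open by blast
    have "open (\<sigma>' -` A)" using open_vimage[OF A(1) cont\<sigma>'] .
    moreover have "\<sigma> (f v) \<in> \<sigma>' -` A" using \<sigma>_f[OF v] A(2) T(2) vS by auto
    ultimately obtain z where z: "z \<in> \<Omega>" "\<sigma>' z \<in> A" using dense_\<Omega>[of "\<sigma>' -` A"] by blast
    then have "\<sigma>' z \<in> f ` (S2 \<inter> T)" using A(2) \<sigma>'S2 by blast
    then obtain u where u: "u \<in> S2" "u \<in> T" "f u = \<sigma>' z" by force
    obtain w where w: "w \<in> I" "g w z = u" using g_surj[OF z(1) u(1,3)] .
    then have "u \<in> sheets I" using z(1) unfolding sheets_def by blast
    then show ?thesis using u(2) by blast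
  qed
  then show "v \<in> closure (sheets I)" unfolding closure_iff_nhds_not_empty by blast
qed

lemma fibre_in_stack:
  assumes st: "stack_nbhd (\<sigma>' z) W' U'" and v: "v \<in> S2" "f v = \<sigma>' z"
    and B: "connected B" "\<sigma>' ` B \<subseteq> W'" "continuous_on B k" "\<And>z. z \<in> B \<Longrightarrow> k z \<in> S2 \<and> f (k z) = \<sigma>' z"
    and z1: "z1 \<in> B" "k z1 \<in> U' v" and z2: "z2 \<in> B"
  shows "k z2 \<in> U' v"
proof -
  obtain x where x: "x \<in> S2" "f x = \<sigma>' z" "\<And>z. z \<in> B \<Longrightarrow> k z \<in> U' x"
    using lift_in_one[OF st B z1(1)] by blast
  have "x = v" using stack_nbhdD(5)[OF st x(1,2) v] x(3)[OF z1(1)] z1(2) by blast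
  then show ?thesis using x(3)[OF z2] by simp
qed

text \<open>A local inverse \<open>k\<close> through \<open>v\<close> extends over an open cone
  around the ray; near the tip \<open>c\<close> it enters the neighbourhood of some \<open>x\<close>
  over \<open>c\<close>. A sheet adherent to \<open>v\<close> agrees with \<open>k\<close> on one of
  the two half cones, so the sheets on both sides of the slit belong to the block of the same
  \<open>x\<close>.\<close>

lemma ray_crossing:
  assumes c: "c \<in> K" and z: "on_ray c z" "z \<noteq> c" and v: "v \<in> S2" "f v = \<sigma>' z"
  obtains x where "x \<in> J" "\<And>M. M \<subseteq> I \<Longrightarrow> v \<in> closure (sheets M) \<Longrightarrow> \<exists>w\<in>M. w \<in> block x"
proof -
  have c0: "c \<noteq> 0" using c K0 by auto
  obtain \<eta> where \<eta>: "\<eta> > 0" "\<And>z c'. Re (z / c - 1) > 0 \<Longrightarrow> \<bar>Im (z / c - 1)\<bar> < \<eta> * Re (z / c - 1) \<Longrightarrow> c' \<in> K - {c} \<Longrightarrow> \<not> on_ray c' z"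
    using exists_cone[OF c] by blast
  let ?S = "{z. Re z > 0 \<and> \<bar>Im z\<bar> < \<eta> * Re z}"
  define Q where "Q = {z. z / c - 1 \<in> ?S}"
  have cvQ: "convex Q" unfolding Q_def by (rule convex_affine_vimage[OF convex_open_cone(1)])
  have opQ: "open Q"
  proof -
    have "open ((\<lambda>z. z / c - 1) -` ?S)"
      by (rule open_vimage[OF convex_open_cone(2)]) (use c0 in \<open>auto intro!: continuous_intros\<close>)
    then show ?thesis unfolding Q_def vimage_def .
  qed
  have noray: "\<not> on_ray c' x" if "x \<in> Q" "c' \<in> K - {c}" for x c' using \<eta>(2)[of x c'] that unfolding Q_def by blast
  have QK: "Q \<inter> K = {}"
  proof -
    have "c' \<notin> Q" if c': "c' \<in> K" for c'
    proof (cases "c' = c")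
      case True then show ?thesis using c0 by (simp add: Q_def)
    next
      case False
      then show ?thesis using noray[of c' c'] c' on_ray_self[of c'] K0 by auto
    qed
    then show ?thesis by blast
  qed
  have Q\<Omega>: "x \<in> \<Omega>" if "x \<in> Q" "Im (x / c) \<noteq> 0" for x
    using noray[OF that(1)] that(2) unfolding \<Omega>_def on_ray_def by blast
  have zQ: "z \<in> Q"
  proof -
    have "Im (z / c) = 0" "Re (z / c) \<ge> 1" using z(1) unfolding on_ray_def by auto
    moreover have "Re (z / c) \<noteq> 1"
    proof
      assume "Re (z / c) = 1"
      then have "z / c = 1" using calculation by (simp add: complex_eq_iff)
      then show False using z(2) c0 by simp
    qed
    ultimately show ?thesis using \<eta>(1) unfolding Q_def by simp
  qed
  obtain k where k: "continuous_on Q k" "\<And>z. z \<in> Q \<Longrightarrow> k z \<in> S2" "k z = v" "\<And>z. z \<in> Q \<Longrightarrow> f (k z) = \<sigma>' z"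
    by (rule lift_at[OF convex_imp_simply_connected[OF cvQ] opQ QK zQ v]) blast
  obtain W' U' e where st: "stack_nbhd (\<sigma>' z) W' U'" "e > 0" "ball z e \<subseteq> Q" "\<sigma>' ` ball z e \<subseteq> W'"
    using stack_at[OF zQ opQ] by blast
  have zK: "z \<notin> K" using zQ QK by blast
  have mv: "m v = 1" by (rule m_off_K[OF v zK])
  have nv: "nbhd v (U' v)" by (rule stack_nbhdD(3)[OF st(1) v])
  have injU: "inj_on f (U' v)" by (rule nbhd_inj[OF nv mv])
  have vU: "v \<in> U' v" using nv unfolding nbhd_def by blast
  have kU: "k y \<in> U' v" if "y \<in> ball z e" for y
  proof (rule fibre_in_stack[OF st(1) v _ st(4) _ _ _ _ that])
    show "connected (ball z e)" by (rule connected_ball)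
    show "continuous_on (ball z e) k" by (rule continuous_on_subset[OF k(1) st(3)])
    show "k y \<in> S2 \<and> f (k y) = \<sigma>' y" if "y \<in> ball z e" for y using k(2,4) st(3) that by blast
    show "z \<in> ball z e" using st(2) by simp
    show "k z \<in> U' v" using k(3) vU by simp
  qed
  define t where "t = min 1 (r c / (2 * cmod c * (1 + \<eta>)))"
  have rc: "r c > 0" by (rule WUr(2)[OF c])
  have t: "t > 0" using rc c0 \<eta>(1) by (simp add: t_def)
  \<comment> \<open>For \<open>s = 1\<close> and \<open>s = -1\<close> these are points of the two
    half cones, so close to the tip that they lie in the disk of radius \<open>r c\<close>.\<close>
  define p where "p = (\<lambda>s. c * (1 + of_real t * Complex 1 (s * \<eta> / 2)))"
  have pc: "p s / c - 1 = of_real t * Complex 1 (s * \<eta> / 2)" for s using c0 by (simp add: p_def)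
  have pQ: "p s \<in> Q" if "\<bar>s\<bar> = 1" for s
  proof -
    have "\<bar>s * \<eta> / 2\<bar> < \<eta>" using that \<eta>(1) by (simp add: abs_mult)
    then have "t * \<bar>s * \<eta> / 2\<bar> < t * \<eta>" using t by (intro mult_strict_left_mono) auto
    then have "of_real t * Complex 1 (s * \<eta> / 2) \<in> ?S" using t by (simp add: abs_mult mult.commute)
    then show ?thesis unfolding Q_def pc[symmetric] by blast
  qed
  have pball: "p s \<in> ball c (r c)" if "\<bar>s\<bar> = 1" for s
  proof -
    have "cmod (Complex 1 (s * \<eta> / 2)) \<le> \<bar>1\<bar> + \<bar>s * \<eta> / 2\<bar>" using cmod_le[of "Complex 1 (s * \<eta> / 2)"] by simp
    also have "\<dots> \<le> 1 + \<eta>" using that \<eta>(1) by (simp add: abs_mult)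
    finally have "cmod c * (t * cmod (Complex 1 (s * \<eta> / 2))) \<le> cmod c * (r c / (2 * cmod c * (1 + \<eta>)) * (1 + \<eta>))"
      using rc c0 \<eta>(1) by (intro mult_left_mono mult_mono) (auto simp: t_def)
    also have "\<dots> = r c / 2"
    proof -
      have "a * (b / (2 * a * X) * X) = b / 2" if "a \<noteq> 0" "X \<noteq> 0" for a b X :: real
        using that by (simp add: field_simps)
      from this[of "cmod c" "1 + \<eta>" "r c"] show ?thesis using c0 \<eta>(1) by simp
    qed
    also have "\<dots> < r c" using rc by simp
    finally have "cmod (c * (of_real t * Complex 1 (s * \<eta> / 2))) < r c" using t by (simp add: norm_mult)
    moreover have "c - p s = - (c * (of_real t * Complex 1 (s * \<eta> / 2)))" by (simp add: p_def algebra_simps)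
    ultimately show ?thesis by (simp add: dist_norm)
  qed
  let ?QB = "Q \<inter> ball c (r c)"
  have cQB: "connected ?QB" using cvQ by (intro convex_connected convex_Int convex_ball)
  have WQB: "\<sigma>' ` ?QB \<subseteq> W c" using WUr(4)[OF c] by blast
  have kQB: "continuous_on ?QB k" using k(1) continuous_on_subset by blast
  have kk: "k y \<in> S2 \<and> f (k y) = \<sigma>' y" if "y \<in> ?QB" for y using k(2,4) that by blast
  have p1: "p 1 \<in> ?QB" using pQ[of 1] pball[of 1] by simp
  obtain x where x: "x \<in> S2" "f x = \<sigma>' c" "\<And>y. y \<in> ?QB \<Longrightarrow> k y \<in> U c x"
    using lift_in_one[OF WUr(1)[OF c] cQB WQB kQB kk p1] by blast
  show ?thesis
  proof (rule that[of x])
    show "x \<in> J" using x c unfolding J_def by blast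
    fix M assume M: "M \<subseteq> I" "v \<in> closure (sheets M)"
    obtain w z1 where w: "w \<in> M" "z1 \<in> \<Omega>" "z1 \<in> ball z e" "g w z1 \<in> U' v"
      using adherent_sheet[OF v st(1,2) M] by blast
    have wI: "w \<in> I" using w(1) M(1) by blast
    have z1Q: "z1 \<in> Q" using w(3) st(3) by blast
    have gk: "g w z1 = k z1"
      using inj_onD[OF injU _ w(4) kU[OF w(3)]] g(4)[OF wI w(2)] k(4)[OF z1Q] by simp
    have im0: "Im (z1 / c - 1) \<noteq> 0"
    proof
      assume "Im (z1 / c - 1) = 0"
      moreover have "Re (z1 / c - 1) > 0" using z1Q unfolding Q_def by blast
      ultimately have "on_ray c z1" unfolding on_ray_def by simp
      then show False using w(2) c unfolding \<Omega>_def by blast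
    qed
    \<comment> \<open>The side of the slit from which the sheet approaches \<open>v\<close>.\<close>
    define s where "s = sgn (Im (z1 / c - 1))"
    have s: "\<bar>s\<bar> = 1" "s * Im (z1 / c - 1) > 0" using im0 by (auto simp: s_def sgn_real_def)
    define Qs where "Qs = Q \<inter> {y. y / c - 1 \<in> {y. s * Im y > 0}}"
    have cQs: "connected Qs" unfolding Qs_def
      by (intro convex_connected convex_Int cvQ convex_affine_vimage convex_open_cone(3))
    have Qs: "Qs \<subseteq> Q" "Qs \<subseteq> \<Omega>"
    proof -
      show "Qs \<subseteq> Q" by (simp add: Qs_def)
      show "Qs \<subseteq> \<Omega>"
      proof
        fix y assume y: "y \<in> Qs"
        then have "Im (y / c) \<noteq> 0" unfolding Qs_def by auto
        then show "y \<in> \<Omega>" using Q\<Omega>[of y] y unfolding Qs_def by blast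
      qed
    qed
    have z1s: "z1 \<in> Qs" using z1Q s(2) unfolding Qs_def by blast
    have pQs: "p s \<in> Qs"
    proof -
      have "s * s = 1" using im0 by (auto simp: s_def sgn_real_def)
      then have "s * (t * (s * \<eta> / 2)) = t * \<eta> / 2" by (simp add: algebra_simps)
      moreover have "Im (p s / c - 1) = t * (s * \<eta> / 2)" unfolding pc by simp
      ultimately have e: "s * Im (p s / c - 1) = t * \<eta> / 2" by metis
      have "s * Im (p s / c - 1) > 0" unfolding e using t \<eta>(1) by simp
      then show ?thesis using pQ[OF s(1)] unfolding Qs_def by blast
    qed
    have "g w (p s) = k (p s)"
    proof (rule unique_lift[of Qs "g w" k z1 "p s", OF cQs _ _ _ _ z1s gk pQs])
      show "Qs \<inter> K = {}" using Qs(1) QK by blast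
      show "continuous_on Qs (g w)" by (rule continuous_on_subset[OF g(1)[OF wI] Qs(2)])
      show "continuous_on Qs k" by (rule continuous_on_subset[OF k(1) Qs(1)])
      show "g w y \<in> S2 \<and> k y \<in> S2 \<and> f (g w y) = \<sigma>' y \<and> f (k y) = \<sigma>' y" if "y \<in> Qs" for y
        using g(2,4)[OF wI, of y] k(2,4)[of y] Qs that by blast
    qed
    moreover have "k (p s) \<in> U c x" using x(3) pQ[OF s(1)] pball[OF s(1)] by blast
    moreover have "p s \<in> D c" using pball[OF s(1)] pQs Qs(2) unfolding D_def by blast
    ultimately have "w \<in> block x" using in_block[OF c wI x(1,2)] by simp
    then show "\<exists>w\<in>M. w \<in> block x" using w(1) by blast
  qed
qed

text \<open>The point \<open>v\<close> lies over a critical value, over \<Omega> or over a slit.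
  Over \<Omega> it is adherent to its own sheet only; otherwise a single block contains all sheets
  adherent to it.\<close>

lemma shared_point:
  assumes v: "v \<in> Y" and M: "M \<subseteq> I" "v \<in> closure (sheets M)" and M': "M' \<subseteq> I" "v \<in> closure (sheets M')"
  shows "M \<inter> M' \<noteq> {} \<or> (\<exists>x\<in>J. block x \<inter> M \<noteq> {} \<and> block x \<inter> M' \<noteq> {})"
proof -
  define z where "z = \<sigma> (f v)"
  have vz: "v \<in> S2" "f v = \<sigma>' z" using v \<sigma>_f[OF v] by (auto simp: Y_def z_def)
  consider "z \<in> K" | "z \<in> \<Omega>" | c where "c \<in> K" "on_ray c z" "z \<noteq> c"
  proof (cases "z \<in> \<Omega>")
    case False
    then obtain c where "c \<in> K" "on_ray c z" unfolding \<Omega>_def by blast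
    then show ?thesis using that by blast
  qed (rule that)
  then show ?thesis
  proof cases
    case 1
    have "block v \<inter> L \<noteq> {}" if L: "L \<subseteq> I" "v \<in> closure (sheets L)" for L
    proof -
      obtain w z1 where w: "w \<in> L" "z1 \<in> \<Omega>" "z1 \<in> ball z (r z)" "g w z1 \<in> U z v"
        using adherent_sheet[OF vz WUr(1,2)[OF 1] L] by blast
      then have "z1 \<in> D z" unfolding D_def by blast
      then have "w \<in> block v" using in_block[OF 1 _ vz] w(1,4) L(1) by blast
      then show ?thesis using w(1) by blast
    qed
    from this[OF M] this[OF M'] have "block v \<inter> M \<noteq> {} \<and> block v \<inter> M' \<noteq> {}" ..
    moreover have "v \<in> J" using vz 1 unfolding J_def by blast
    ultimately show ?thesis by blast
  next
    case 2
    obtain W' U' e where st: "stack_nbhd (\<sigma>' z) W' U'" "e > 0" "ball z e \<subseteq> \<Omega>" "\<sigma>' ` ball z e \<subseteq> W'"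
      using stack_at[OF 2 open_\<Omega>] by blast
    have gz: "\<exists>w\<in>L. g w z = v" if L: "L \<subseteq> I" "v \<in> closure (sheets L)" for L
    proof -
      obtain w z1 where w: "w \<in> L" "z1 \<in> \<Omega>" "z1 \<in> ball z e" "g w z1 \<in> U' v"
        using adherent_sheet[OF vz st(1,2) L] by blast
      have wI: "w \<in> I" using w(1) L(1) by blast
      have "g w z \<in> U' v"
      proof (rule fibre_in_stack[OF st(1) vz connected_ball[of z e] st(4), where k = "g w", OF _ _ w(3,4)])
        show "continuous_on (ball z e) (g w)" by (rule continuous_on_subset[OF g(1)[OF wI] st(3)])
        show "g w y \<in> S2 \<and> f (g w y) = \<sigma>' y" if "y \<in> ball z e" for y using g(2,4)[OF wI] st(3) that by blast
        show "z \<in> ball z e" using st(2) by simp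
      qed
      moreover have "f (g w z) = f v" using g(4)[OF wI 2] vz(2) by simp
      moreover have "{u\<in>U' v. f u = f v} = {v}" using stack_nbhdD(3)[OF st(1) vz] unfolding nbhd_def by blast
      ultimately show ?thesis using w(1) by blast
    qed
    obtain w w' where w: "w \<in> M" "g w z = v" "w' \<in> M'" "g w' z = v" using gz[OF M] gz[OF M'] by blast
    then have "w = w'" using g_inj[of w w' z] 2 M(1) M'(1) by auto
    then show ?thesis using w by blast
  next
    case 3
    obtain x where x: "x \<in> J" "\<And>M. M \<subseteq> I \<Longrightarrow> v \<in> closure (sheets M) \<Longrightarrow> \<exists>w\<in>M. w \<in> block x"
      by (rule ray_crossing[OF 3 vz]) blast
    from x(2)[OF M] x(2)[OF M'] have "block x \<inter> M \<noteq> {} \<and> block x \<inter> M' \<noteq> {}" by blast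
    then show ?thesis using x(1) by blast
  qed
qed

lemma finJ: "finite J"
proof -
  have "J = (\<Union>y\<in>\<sigma>' ` K. {x\<in>S2. f x = y})" by (auto simp: J_def)
  moreover have "finite \<dots>" using finK fin_fibre[OF \<sigma>'S2] by auto
  ultimately show ?thesis by simp
qed

text \<open>If no block joined \<open>M\<close> to the remaining sheets, the closures of the two
  unions of sheets would be disjoint in the connected set \<open>Y\<close> and cover it. So the
  blocks form a connected hypergraph on the sheets.\<close>

theorem degree_bound_J: "N - 1 \<le> (\<Sum>x\<in>J. m x - 1)"
proof -
  have "card I - 1 \<le> (\<Sum>x\<in>J. card (block x) - 1)"
  proof (rule connected_blocks_card[OF finI finJ])
    show "I \<noteq> {}" using surj[OF \<sigma>'S2, of 0] unfolding I_def by blast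
    show "block x \<subseteq> I" for x unfolding block_def by blast
    fix M assume M: "M \<subseteq> I" "\<And>x. x \<in> J \<Longrightarrow> block x \<subseteq> M \<or> block x \<inter> M = {}"
    have sp: "sheets L \<noteq> {}" "sheets L \<subseteq> Y" if "L \<subseteq> I" "L \<noteq> {}" for L
      using that zero_\<Omega> g(2,4) \<sigma>'q unfolding sheets_def Y_def by (blast, fastforce)
    show "M = {} \<or> M = I"
    proof (rule ccontr)
      assume no: "\<not> (M = {} \<or> M = I)"
      have L: "M \<subseteq> I" "I - M \<subseteq> I" "M \<noteq> {}" "I - M \<noteq> {}" using no M(1) by auto
      have "sheets I = sheets M \<union> sheets (I - M)" using M(1) unfolding sheets_def by blast
      then have "Y \<subseteq> closure (sheets M) \<union> closure (sheets (I - M))" using sheets_dense by (metis closure_Un)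
      moreover have "closure (sheets M) \<inter> closure (sheets (I - M)) \<inter> Y = {}"
        using shared_point[OF _ L(1) _ L(2)] M(2) by blast
      moreover have "closure (sheets M) \<inter> Y \<noteq> {}" using sp[OF L(1,3)] closure_subset by blast
      moreover have "closure (sheets (I - M)) \<inter> Y \<noteq> {}" using sp[OF L(2,4)] closure_subset by blast
      ultimately show False using connected_Y unfolding connected_closed by (metis closed_closure)
    qed
  qed
  also have "(\<Sum>x\<in>J. card (block x) - 1) = (\<Sum>x\<in>J. m x - 1)" using card_block by (intro sum.cong) auto
  finally show ?thesis unfolding cardI .
qed

end

text \<open>By the Riemann-Hurwitz formula the sum equals \<open>N - 2\<close> plus the number of
  preimages of \<open>q\<close>; this is the resulting lower bound.\<close>

theorem (in branched_cover) degree_bound: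
  assumes q: "q \<in> S2" and fin: "finite {x\<in>S2. m x > 1}"
  shows "N - 1 \<le> (\<Sum>x | x \<in> S2 \<and> m x > 1 \<and> f x \<noteq> q. m x - 1)"
proof -
  obtain \<tau> \<tau>' where t: "homeomorphism (S2 - {q}) (UNIV :: complex set) \<tau> \<tau>'" using punctured_sphere_chart[OF q] .
  define CV where "CV = f ` {x\<in>S2. m x > 1} - {q}"
  have "finite (\<tau> ` CV)" using fin by (simp add: CV_def)
  then obtain b where b: "b \<notin> \<tau> ` CV"
    "\<And>c c'. c \<in> \<tau> ` CV \<Longrightarrow> c' \<in> \<tau> ` CV \<Longrightarrow> c \<noteq> c' \<Longrightarrow> \<not> (Im ((c' - b) / (c - b)) = 0)"
    using exists_generic_base by blast
  define \<sigma> where "\<sigma> = (\<lambda>x. \<tau> x - b)"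
  define \<sigma>' where "\<sigma>' = (\<lambda>z. \<tau>' (z + b))"
  have hom: "homeomorphism (S2 - {q}) UNIV \<sigma> \<sigma>'"
  proof -
    have "homeomorphism UNIV (UNIV::complex set) (\<lambda>z. z - b) (\<lambda>z. z + b)"
      by (auto simp: homeomorphism_def intro!: continuous_intros)
    from homeomorphism_compose[OF t this] show ?thesis by (simp add: comp_def \<sigma>_def \<sigma>'_def)
  qed
  interpret slit_cover f N q \<sigma> \<sigma>' "\<sigma> ` CV"
  proof
    show "\<sigma> ` CV = \<sigma> ` (f ` {x\<in>S2. m x > 1} - {q})" by (simp add: CV_def)
    show "0 \<notin> \<sigma> ` CV" using b(1) by (auto simp: \<sigma>_def)
    show "Im (c' / c) \<noteq> 0" if cc: "c \<in> \<sigma> ` CV" "c' \<in> \<sigma> ` CV" "c \<noteq> c'" for c c'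
    proof -
      obtain x x' where "x \<in> CV" "c = \<tau> x - b" "x' \<in> CV" "c' = \<tau> x' - b" using cc(1,2) unfolding \<sigma>_def by blast
      then show ?thesis using b(2)[of "\<tau> x" "\<tau> x'"] cc(3) by auto
    qed
  qed (fact q hom fin)+
  have im: "\<sigma>' ` \<sigma> ` CV = CV"
  proof -
    have "\<sigma>' (\<sigma> y) = y" if "y \<in> CV" for y
    proof -
      have "y \<in> S2" "y \<noteq> q" using that fS2 unfolding CV_def by auto
      then show ?thesis by (rule \<sigma>'\<sigma>)
    qed
    then show ?thesis by (force simp: image_image)
  qed
  have sub: "{x. x \<in> S2 \<and> m x > 1 \<and> f x \<noteq> q} \<subseteq> J" unfolding J_def im by (auto simp: CV_def)
  have "N - 1 \<le> (\<Sum>x\<in>J. m x - 1)" by (rule degree_bound_J)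
  also have "\<dots> = (\<Sum>x | x \<in> S2 \<and> m x > 1 \<and> f x \<noteq> q. m x - 1)"
  proof (rule sum.mono_neutral_right[OF finJ sub], intro ballI)
    fix x assume "x \<in> J - {x. x \<in> S2 \<and> m x > 1 \<and> f x \<noteq> q}"
    then have x: "x \<in> S2" "f x \<in> CV" "\<not> (m x > 1 \<and> f x \<noteq> q)" unfolding J_def im by auto
    then have "\<not> m x > 1" unfolding CV_def by blast
    then show "m x - 1 = 0" by simp
  qed
  finally show ?thesis .
qed

section \<open>Jordan curves in the punctured sphere\<close>

lemma loop_free_compose:
  assumes "simple_path g" "continuous_on (path_image g) h" "inj_on h (path_image g)"
  shows "simple_path (h \<circ> g)"
proof -
  have "loop_free (h \<circ> g)"
    unfolding loop_free_def comp_def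
  proof (intro ballI impI)
    fix x y :: real assume xy: "x \<in> {0..1}" "y \<in> {0..1}" "h (g x) = h (g y)"
    then have "g x = g y" using inj_onD[OF assms(3) xy(3)] by (auto simp: path_image_def)
    then show "x = y \<or> x = 0 \<and> y = 1 \<or> x = 1 \<and> y = 0"
      using loop_freeD[of g x y] assms(1) xy by (auto simp: simple_path_def)
  qed
  then show ?thesis using assms path_continuous_image by (auto simp: simple_path_def)
qed

lemma homotopic_loops_reversepath:
  assumes "homotopic_loops S p q"
  shows "homotopic_loops S (reversepath p) (reversepath q)"
proof -
  obtain h where h: "continuous_on ({0..1::real} \<times> {0..1::real}) h" "h \<in> ({0..1} \<times> {0..1}) \<rightarrow> S"
    "\<forall>x\<in>{0..1}. h (0, x) = p x" "\<forall>x\<in>{0..1}. h (1, x) = q x"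
    "\<forall>t\<in>{0..1}. pathfinish (h \<circ> Pair t) = pathstart (h \<circ> Pair t)"
    using assms unfolding homotopic_loops by blast
  show ?thesis unfolding homotopic_loops
  proof (intro exI[of _ "\<lambda>(t, x). h (t, 1 - x)"] conjI)
    show "continuous_on ({0..1} \<times> {0..1}) (\<lambda>(t, x). h (t, 1 - x))"
      unfolding case_prod_beta
      by (rule continuous_on_compose2[OF h(1)]) (auto intro!: continuous_intros)
  qed (use h in \<open>auto simp: reversepath_def pathstart_def pathfinish_def\<close>)
qed

text \<open>Two parametrizations of a simple closed curve become loops of winding number \<open>1\<close> or \<open>-1\<close> in a circle.\<close>

lemma closed_curve_params_homotopic:
  fixes p q :: "real \<Rightarrow> real^3"
  assumes p: "simple_path p" "pathfinish p = pathstart p" "path_image p = C"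
    and q: "simple_path q" "pathfinish q = pathstart q" "path_image q = C"
  shows "homotopic_loops C p q \<or> homotopic_loops C p (reversepath q)"
proof -
  have "C homeomorphic sphere (0::complex) 1"
    using homeomorphic_simple_path_image_circle[OF p(1,2), of 1 0] p(3) by simp
  then obtain \<psi> \<psi>' where \<psi>: "homeomorphism C (sphere (0::complex) 1) \<psi> \<psi>'" unfolding homeomorphic_def by blast
  have \<psi>1: "\<psi>' (\<psi> x) = x" if "x \<in> C" for x using \<psi> that unfolding homeomorphism_def by blast
  have \<psi>2: "\<psi> ` C = sphere 0 1" "continuous_on C \<psi>" "continuous_on (sphere 0 1) \<psi>'" "\<psi>' ` sphere 0 1 = C"
    using \<psi> unfolding homeomorphism_def by blast+
  have inj: "inj_on \<psi> C" using \<psi>1 by (metis inj_onI)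
  have sp: "simple_path (\<psi> \<circ> r)" "pathfinish (\<psi> \<circ> r) = pathstart (\<psi> \<circ> r)" "path_image (\<psi> \<circ> r) = sphere 0 1"
    if "simple_path r" "pathfinish r = pathstart r" "path_image r = C" for r
    using loop_free_compose[OF that(1), of \<psi>] that \<psi>2 inj
    by (auto simp: path_image_compose pathstart_compose pathfinish_compose)
  have "inside (frontier (cball (0::complex) 1)) = interior (cball 0 1)"
    by (rule inside_frontier_eq_interior) auto
  then have in0: "(0::complex) \<in> inside (sphere 0 1)" by simp
  have wn: "winding_number (\<psi> \<circ> r) 0 = 1 \<or> winding_number (\<psi> \<circ> r) 0 = -1"
    if "simple_path r" "pathfinish r = pathstart r" "path_image r = C" for r
    using simple_closed_path_winding_number_inside[OF sp(1)[OF that]] in0 unfolding sp(3)[OF that] by metis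
  have rq: "simple_path (reversepath q)" "pathfinish (reversepath q) = pathstart (reversepath q)" "path_image (reversepath q) = C"
    using q by (auto simp: simple_path_reversepath)
  have rev: "\<psi> \<circ> reversepath q = reversepath (\<psi> \<circ> q)" by (auto simp: reversepath_def)
  have "winding_number (\<psi> \<circ> reversepath q) 0 = - winding_number (\<psi> \<circ> q) 0"
    unfolding rev by (rule winding_number_reversepath) (use sp[OF q] simple_path_imp_path in auto)
  then have cases: "winding_number (\<psi> \<circ> p) 0 = winding_number (\<psi> \<circ> q) 0 \<or> winding_number (\<psi> \<circ> p) 0 = winding_number (\<psi> \<circ> reversepath q) 0"
    using wn[OF p] wn[OF q] by auto
  have hom: "homotopic_loops C p r"
    if r: "simple_path r" "pathfinish r = pathstart r" "path_image r = C"
      and eq: "winding_number (\<psi> \<circ> p) 0 = winding_number (\<psi> \<circ> r) 0" for r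
  proof -
    have h1: "homotopic_loops (-{0}) (\<psi> \<circ> p) (\<psi> \<circ> r)"
      using winding_number_homotopic_loops_eq[of "\<psi> \<circ> p" 0 "\<psi> \<circ> r"] sp[OF p] sp[OF r] eq simple_path_imp_path by auto
    \<comment> \<open>Radial projection to the circle followed by \<open>\<psi>'\<close>: it carries
      homotopies in the punctured plane to homotopies in \<open>C\<close> and undoes \<psi> on
      \<open>C\<close>.\<close>
    define k where "k = (\<lambda>z::complex. \<psi>' (z / of_real (cmod z)))"
    have "homotopic_loops C (k \<circ> (\<psi> \<circ> p)) (k \<circ> (\<psi> \<circ> r))"
    proof (rule homotopic_loops_continuous_image[OF h1])
      have sp: "z / of_real (cmod z) \<in> sphere 0 1" if "z \<in> -{0}" for z :: complex
        using that by (simp add: norm_divide)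
      show "continuous_on (-{0}) k" unfolding k_def
      proof (rule continuous_on_compose2[OF \<psi>2(3)])
        show "continuous_on (-{0}) (\<lambda>z::complex. z / of_real (cmod z))" by (intro continuous_intros) auto
      qed (use sp in blast)
      show "k \<in> -{0} \<rightarrow> C" unfolding k_def using sp \<psi>2(4) by blast
    qed
    moreover have kk: "k (\<psi> x) = x" if "x \<in> C" for x
    proof -
      have "cmod (\<psi> x) = 1" using that \<psi>2(1) by auto
      then show ?thesis using \<psi>1[OF that] by (simp add: k_def)
    qed
    moreover have "homotopic_loops C p (k \<circ> (\<psi> \<circ> p))"
      by (rule homotopic_loops_eq) (use p kk simple_path_imp_path in \<open>auto simp: path_image_def\<close>)
    moreover have "homotopic_loops C r (k \<circ> (\<psi> \<circ> r))"
      by (rule homotopic_loops_eq) (use r kk simple_path_imp_path in \<open>auto simp: path_image_def\<close>)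
    ultimately show ?thesis by (meson homotopic_loops_trans homotopic_loops_sym)
  qed
  show ?thesis using cases hom[OF q] hom[OF rq] by blast
qed

text \<open>The two homotopies may use different parametrizations of \<alpha>. These agree up to
  homotopy and direction, and a homotopy can be reversed as a whole.\<close>

lemma homotopic_curves_sym_trans:
  assumes ab: "homotopic_curves X \<alpha> \<beta>" and ac: "homotopic_curves X \<alpha> \<gamma>"
  shows "homotopic_curves X \<beta> \<gamma>"
proof -
  obtain g h where gh: "closed_curve_param g \<alpha>" "closed_curve_param h \<beta>" "homotopic_loops X g h"
    using ab unfolding homotopic_curves_def by blast
  obtain g' k where gk: "closed_curve_param g' \<alpha>" "closed_curve_param k \<gamma>" "homotopic_loops X g' k"
    using ac unfolding homotopic_curves_def by blast
  have \<alpha>X: "\<alpha> \<subseteq> X" using homotopic_loops_imp_subset[OF gh(3)] gh(1) by (auto simp: closed_curve_param_def)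
  have "homotopic_loops \<alpha> g g' \<or> homotopic_loops \<alpha> g (reversepath g')"
    using gh(1) gk(1) unfolding closed_curve_param_def by (intro closed_curve_params_homotopic) auto
  then show ?thesis
  proof
    assume "homotopic_loops \<alpha> g g'"
    then have "homotopic_loops X g g'" using \<alpha>X homotopic_loops_subset by blast
    then have "homotopic_loops X h k" using gh(3) gk(3) by (meson homotopic_loops_trans homotopic_loops_sym)
    then show ?thesis using gh(2) gk(2) unfolding homotopic_curves_def by blast
  next
    assume "homotopic_loops \<alpha> g (reversepath g')"
    then have "homotopic_loops X g (reversepath g')" using \<alpha>X homotopic_loops_subset by blast
    then have "homotopic_loops X h (reversepath k)"
      using gh(3) homotopic_loops_reversepath[OF gk(3)] by (meson homotopic_loops_trans homotopic_loops_sym)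
    moreover have "closed_curve_param (reversepath k) \<gamma>"
      using gk(2) unfolding closed_curve_param_def by (auto simp: simple_path_reversepath)
    ultimately show ?thesis using gh(2) unfolding homotopic_curves_def by blast
  qed
qed

lemma no_isolated_S2: "openS2 A \<Longrightarrow> A \<noteq> {p}"
proof
  assume A: "openS2 A" "A = {p}"
  have "{p} \<subseteq> S2" using A openin_imp_subset by blast
  then have "closedin (top_of_set S2) {p}" by (rule closed_subset) simp
  moreover have "connected S2" by (rule connected_sphere) simp
  ultimately have "{p} = {} \<or> {p} = S2" using A unfolding connected_clopen by blast
  then have "S2 = {p}" by simp
  moreover have "axis 1 1 \<in> S2" "- axis 1 1 \<in> S2" by (auto simp: norm_axis_1)
  ultimately have "axis 1 1 = (- axis 1 1 :: real^3)" by (metis singletonD)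
  from arg_cong[OF this, of "\<lambda>v::real^3. v $ 1"] show False by (simp add: axis_def)
qed

section \<open>The two sides of a Jordan curve\<close>

locale punctured =
  fixes q :: "real^3" and \<sigma> :: "real^3 \<Rightarrow> complex" and \<sigma>' :: "complex \<Rightarrow> real^3"
  assumes q: "q \<in> S2" and hom: "homeomorphism (S2 - {q}) UNIV \<sigma> \<sigma>'"
begin

lemma \<sigma>\<sigma>': "\<sigma> (\<sigma>' z) = z" and \<sigma>'\<sigma>: "x \<in> S2 - {q} \<Longrightarrow> \<sigma>' (\<sigma> x) = x"
  and \<sigma>'im: "\<sigma>' z \<in> S2 - {q}" and cont\<sigma>: "continuous_on (S2 - {q}) \<sigma>" and cont\<sigma>': "continuous_on A \<sigma>'"
  using hom unfolding homeomorphism_def by (blast, blast, blast, blast, blast intro: continuous_on_subset)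

lemma inj\<sigma>: "inj_on \<sigma> (S2 - {q})"
  using \<sigma>'\<sigma> by (rule inj_on_inverseI)

lemma inj\<sigma>': "inj_on \<sigma>' A"
  using \<sigma>\<sigma>' by (rule inj_on_inverseI)

lemma open_punctured: "openS2 (S2 - {q})"
  by (simp add: Diff_eq openin_open_Int open_Compl)

lemma open_image: assumes "open A" shows "openS2 (\<sigma>' ` A)"
proof -
  have "openin (top_of_set (S2 - {q})) ((S2 - {q}) \<inter> \<sigma> -` A)" by (rule continuous_openin_preimage_gen[OF cont\<sigma> assms])
  moreover have "(S2 - {q}) \<inter> \<sigma> -` A = \<sigma>' ` A"
  proof (intro equalityI subsetI)
    fix x assume "x \<in> (S2 - {q}) \<inter> \<sigma> -` A"
    then show "x \<in> \<sigma>' ` A" using \<sigma>'\<sigma>[of x] by (metis IntD1 IntD2 image_eqI vimageE)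
  qed (use \<sigma>'im \<sigma>\<sigma>' in auto)
  ultimately show ?thesis using openin_trans[OF _ open_punctured] by metis
qed

definition jc :: "(real^3) set \<Rightarrow> bool" where
  "jc \<gamma> \<longleftrightarrow> (\<exists>g. closed_curve_param g \<gamma>) \<and> \<gamma> \<subseteq> S2 - {q}"

text \<open>The open side of \<gamma> that misses \<open>q\<close>, bounded in the chart; the closed
  disk is \<open>Dd \<gamma> \<union> \<gamma>\<close>. The other side \<open>Ed \<gamma>\<close>
  contains \<open>q\<close>.\<close>

definition Dd :: "(real^3) set \<Rightarrow> (real^3) set" where "Dd \<gamma> = \<sigma>' ` inside (\<sigma> ` \<gamma>)"

definition Ed :: "(real^3) set \<Rightarrow> (real^3) set" where "Ed \<gamma> = S2 - \<gamma> - Dd \<gamma>"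

lemma param_plane:
  assumes "closed_curve_param g \<gamma>" "\<gamma> \<subseteq> S2 - {q}"
  shows "simple_path (\<sigma> \<circ> g)" "pathfinish (\<sigma> \<circ> g) = pathstart (\<sigma> \<circ> g)" "path_image (\<sigma> \<circ> g) = \<sigma> ` \<gamma>"
proof -
  have g: "simple_path g" "pathfinish g = pathstart g" "path_image g = \<gamma>" using assms(1) unfolding closed_curve_param_def by auto
  show "simple_path (\<sigma> \<circ> g)"
    by (rule loop_free_compose[OF g(1)])
      (unfold g(3), rule continuous_on_subset[OF cont\<sigma> assms(2)], rule inj_on_subset[OF inj\<sigma> assms(2)])
  show "pathfinish (\<sigma> \<circ> g) = pathstart (\<sigma> \<circ> g)" "path_image (\<sigma> \<circ> g) = \<sigma> ` \<gamma>"
    using g by (auto simp: path_image_compose pathstart_compose pathfinish_compose)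
qed

context
  fixes \<gamma> assumes jc: "jc \<gamma>"
begin

lemma jc_sub: "\<gamma> \<subseteq> S2 - {q}" and jc_img: "\<sigma>' ` \<sigma> ` \<gamma> = \<gamma>"
proof -
  show s: "\<gamma> \<subseteq> S2 - {q}" using jc unfolding jc_def by blast
  have "\<sigma>' (\<sigma> x) = x" if "x \<in> \<gamma>" for x using \<sigma>'\<sigma> s that by blast
  then show "\<sigma>' ` \<sigma> ` \<gamma> = \<gamma>" by (force simp: image_image)
qed

lemma jc_plane:
  obtains c where "simple_path c" "pathfinish c = pathstart c" "path_image c = \<sigma> ` \<gamma>"
  using jc param_plane unfolding jc_def by metis

lemma jc_ne: "\<gamma> \<noteq> {}"
  using jc unfolding jc_def closed_curve_param_def by (metis path_image_nonempty)

lemma plane_facts: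
  "inside (\<sigma> ` \<gamma>) \<noteq> {}" "open (inside (\<sigma> ` \<gamma>))" "connected (inside (\<sigma> ` \<gamma>))" "bounded (inside (\<sigma> ` \<gamma>))"
  "outside (\<sigma> ` \<gamma>) \<noteq> {}" "open (outside (\<sigma> ` \<gamma>))" "connected (outside (\<sigma> ` \<gamma>))"
  "frontier (inside (\<sigma> ` \<gamma>)) = \<sigma> ` \<gamma>" "frontier (outside (\<sigma> ` \<gamma>)) = \<sigma> ` \<gamma>" "compact (\<sigma> ` \<gamma>)"
proof -
  obtain c where c: "simple_path c" "pathfinish c = pathstart c" "path_image c = \<sigma> ` \<gamma>" by (rule jc_plane)
  from Jordan_inside_outside[OF c(1,2)] compact_simple_path_image[OF c(1)] show
  "inside (\<sigma> ` \<gamma>) \<noteq> {}" "open (inside (\<sigma> ` \<gamma>))" "connected (inside (\<sigma> ` \<gamma>))" "bounded (inside (\<sigma> ` \<gamma>))"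
  "outside (\<sigma> ` \<gamma>) \<noteq> {}" "open (outside (\<sigma> ` \<gamma>))" "connected (outside (\<sigma> ` \<gamma>))"
  "frontier (inside (\<sigma> ` \<gamma>)) = \<sigma> ` \<gamma>" "frontier (outside (\<sigma> ` \<gamma>)) = \<sigma> ` \<gamma>" "compact (\<sigma> ` \<gamma>)"
    unfolding c(3) by simp_all
qed

lemma Dd_sub: "Dd \<gamma> \<subseteq> S2 - {q}" unfolding Dd_def using \<sigma>'im by blast

lemma Dd_disj: "Dd \<gamma> \<inter> \<gamma> = {}"
proof -
  have "\<sigma>' ` inside (\<sigma> ` \<gamma>) \<inter> \<sigma>' ` \<sigma> ` \<gamma> = \<sigma>' ` (inside (\<sigma> ` \<gamma>) \<inter> \<sigma> ` \<gamma>)"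
    by (rule inj_on_image_Int[OF inj\<sigma>'[of UNIV] subset_UNIV subset_UNIV, symmetric])
  then show ?thesis unfolding Dd_def jc_img inside_no_overlap by simp
qed

lemma q_Ed: "q \<in> Ed \<gamma>" unfolding Ed_def using q Dd_sub jc_sub by blast

lemma Dd_open: "openS2 (Dd \<gamma>)" unfolding Dd_def by (rule open_image[OF plane_facts(2)])

lemma Dd_connected: "connected (Dd \<gamma>)" unfolding Dd_def by (rule connected_continuous_image[OF cont\<sigma>' plane_facts(3)])

lemma Dd_ne: "Dd \<gamma> \<noteq> {}" unfolding Dd_def using plane_facts(1) by blast

lemma compact_Dd: "compact (Dd \<gamma> \<union> \<gamma>)"
proof -
  have "closure (inside (\<sigma> ` \<gamma>)) = inside (\<sigma> ` \<gamma>) \<union> \<sigma> ` \<gamma>" using plane_facts(8) closure_Un_frontier by metis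
  then have "compact (inside (\<sigma> ` \<gamma>) \<union> \<sigma> ` \<gamma>)" using plane_facts(4) compact_closure by metis
  then have "compact (\<sigma>' ` (inside (\<sigma> ` \<gamma>) \<union> \<sigma> ` \<gamma>))" by (rule compact_continuous_image[OF cont\<sigma>'])
  then show ?thesis unfolding Dd_def image_Un jc_img .
qed

lemma Ed_open: "openS2 (Ed \<gamma>)"
proof -
  have "Ed \<gamma> = S2 \<inter> - (Dd \<gamma> \<union> \<gamma>)" unfolding Ed_def by blast
  then show ?thesis using compact_Dd compact_imp_closed by (metis openin_open_Int open_Compl)
qed

lemma Ed_eq: "Ed \<gamma> = insert q (\<sigma>' ` outside (\<sigma> ` \<gamma>))"
proof (intro equalityI subsetI)
  fix x assume x: "x \<in> Ed \<gamma>"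
  show "x \<in> insert q (\<sigma>' ` outside (\<sigma> ` \<gamma>))"
  proof (cases "x = q")
    case False
    then have xs: "\<sigma>' (\<sigma> x) = x" using x \<sigma>'\<sigma> unfolding Ed_def by blast
    have "\<sigma> x \<notin> \<sigma> ` \<gamma>" "\<sigma> x \<notin> inside (\<sigma> ` \<gamma>)"
      using x xs jc_img unfolding Ed_def Dd_def by (metis DiffD1 DiffD2 imageI)+
    then have "\<sigma> x \<in> outside (\<sigma> ` \<gamma>)" using inside_Un_outside[of "\<sigma> ` \<gamma>"] by blast
    then show ?thesis using xs by (metis imageI insertI2)
  qed simp
next
  fix x assume "x \<in> insert q (\<sigma>' ` outside (\<sigma> ` \<gamma>))"
  then consider "x = q" | z where "z \<in> outside (\<sigma> ` \<gamma>)" "x = \<sigma>' z" by blast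
  then show "x \<in> Ed \<gamma>"
  proof cases
    case 2
    have "z \<notin> \<sigma> ` \<gamma>" "z \<notin> inside (\<sigma> ` \<gamma>)" using 2(1) outside_no_overlap inside_Int_outside by blast+
    then have "\<sigma>' z \<notin> \<sigma>' ` \<sigma> ` \<gamma>" "\<sigma>' z \<notin> \<sigma>' ` inside (\<sigma> ` \<gamma>)" using \<sigma>\<sigma>' by (metis imageE)+
    then show ?thesis unfolding 2(2) Ed_def Dd_def jc_img using \<sigma>'im[of z] by blast
  qed (use q_Ed in simp)
qed

lemma q_closure: "q \<in> closure (\<sigma>' ` outside (\<sigma> ` \<gamma>))"
proof (rule ccontr)
  assume "q \<notin> closure (\<sigma>' ` outside (\<sigma> ` \<gamma>))"
  then obtain T where T: "open T" "q \<in> T" "T \<inter> \<sigma>' ` outside (\<sigma> ` \<gamma>) = {}" unfolding closure_iff_nhds_not_empty by blast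
  have "openS2 (Ed \<gamma> \<inter> T)" using Ed_open T(1) by (rule openin_Int_open)
  moreover have "Ed \<gamma> \<inter> T = {q}" using T(2,3) unfolding Ed_eq by blast
  ultimately show False using no_isolated_S2 by metis
qed

text \<open>Adding \<open>q\<close>, the point at infinity, keeps the outside connected, because
  \<open>q\<close> is a limit of it: the sphere has no isolated points.\<close>

lemma Ed_connected: "connected (Ed \<gamma>)"
proof (rule connected_intermediate_closure)
  show "connected (\<sigma>' ` outside (\<sigma> ` \<gamma>))" by (rule connected_continuous_image[OF cont\<sigma>' plane_facts(7)])
  show "\<sigma>' ` outside (\<sigma> ` \<gamma>) \<subseteq> Ed \<gamma>" "Ed \<gamma> \<subseteq> closure (\<sigma>' ` outside (\<sigma> ` \<gamma>))"
    unfolding Ed_eq using q_closure closure_subset[of "\<sigma>' ` outside (\<sigma> ` \<gamma>)"] by blast+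
qed

lemma curve_sub_closure: "\<gamma> \<subseteq> closure (Dd \<gamma>)" "\<gamma> \<subseteq> closure (Ed \<gamma>)"
proof -
  have cl: "\<gamma> \<subseteq> closure (\<sigma>' ` A)" if "\<sigma> ` \<gamma> \<subseteq> closure A" for A
  proof -
    have "\<sigma>' ` closure A \<subseteq> closure (\<sigma>' ` A)"
      by (rule image_closure_subset[OF cont\<sigma>' closed_closure closure_subset])
    then have "\<sigma>' ` \<sigma> ` \<gamma> \<subseteq> closure (\<sigma>' ` A)" using that by blast
    then show ?thesis unfolding jc_img .
  qed
  show "\<gamma> \<subseteq> closure (Dd \<gamma>)" unfolding Dd_def by (rule cl) (metis plane_facts(8) closure_Un_frontier Un_upper2)
  have "\<gamma> \<subseteq> closure (\<sigma>' ` outside (\<sigma> ` \<gamma>))" by (rule cl) (metis plane_facts(9) closure_Un_frontier Un_upper2)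
  moreover have "closure (\<sigma>' ` outside (\<sigma> ` \<gamma>)) \<subseteq> closure (Ed \<gamma>)" unfolding Ed_eq by (rule closure_mono) blast
  ultimately show "\<gamma> \<subseteq> closure (Ed \<gamma>)" by blast
qed

lemma connected_in_side:
  assumes A: "connected A" "A \<subseteq> S2" "A \<inter> \<gamma> = {}"
  shows "A \<subseteq> Dd \<gamma> \<or> A \<subseteq> Ed \<gamma>"
proof -
  obtain T where T: "open T" "Dd \<gamma> = S2 \<inter> T" using Dd_open[unfolded openin_open] by blast
  obtain T' where T': "open T'" "Ed \<gamma> = S2 \<inter> T'" using Ed_open[unfolded openin_open] by blast
  have "A \<subseteq> Dd \<gamma> \<union> Ed \<gamma>" using A unfolding Ed_def by blast
  then have "A \<subseteq> T \<union> T'" using T T' by blast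
  moreover have "T \<inter> T' \<inter> A = {}"
  proof -
    have "S2 \<inter> T \<inter> (S2 \<inter> T') = {}" unfolding T(2)[symmetric] T'(2)[symmetric] Ed_def by blast
    then show ?thesis using A(2) by blast
  qed
  ultimately have "T \<inter> A = {} \<or> T' \<inter> A = {}" using connectedD[OF A(1) T(1) T'(1)] by blast
  then show ?thesis using T(2) T'(2) A(2) \<open>A \<subseteq> T \<union> T'\<close> by blast
qed

end

lemma Dd_eq_imp_eq:
  assumes "jc \<alpha>" "jc \<beta>" "Dd \<alpha> = Dd \<beta>"
  shows "\<alpha> = \<beta>"
proof -
  have "\<gamma> = closure (Dd \<gamma>) - Dd \<gamma>" if "jc \<gamma>" for \<gamma>
  proof -
    have "closure (Dd \<gamma>) \<subseteq> Dd \<gamma> \<union> \<gamma>" using compact_Dd[OF that] compact_imp_closed by (intro closure_minimal) auto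
    then show ?thesis using curve_sub_closure(1)[OF that] Dd_disj[OF that] by blast
  qed
  then show ?thesis using assms by metis
qed

text \<open>The case to exclude is that each curve lies in the disk of the other. Both exteriors
  contain \<open>q\<close>, so the exterior of \<alpha> would then lie in that of \<beta>, and
  \<alpha>, which consists of limits of its exterior, could not meet
  \<open>Dd \<beta>\<close>.\<close>

lemma Dd_nested_or_disjoint:
  assumes jc: "jc \<alpha>" "jc \<beta>" and "\<alpha> \<inter> \<beta> = {}"
  shows "Dd \<alpha> \<inter> Dd \<beta> = {} \<or> Dd \<alpha> \<subseteq> Dd \<beta> \<or> Dd \<beta> \<subseteq> Dd \<alpha>"
proof -
  have con: "connected \<gamma>" "\<gamma> \<subseteq> S2" if "jc \<gamma>" for \<gamma>
    using that unfolding jc_def closed_curve_param_def by (metis connected_simple_path_image, blast)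
  have a: "\<alpha> \<subseteq> Dd \<beta> \<or> \<alpha> \<subseteq> Ed \<beta>" by (rule connected_in_side[OF jc(2) con[OF jc(1)] assms(3)])
  have b: "\<beta> \<subseteq> Dd \<alpha> \<or> \<beta> \<subseteq> Ed \<alpha>" by (rule connected_in_side[OF jc(1) con[OF jc(2)]]) (use assms(3) in blast)
  have S: "Dd \<alpha> \<subseteq> S2" "Dd \<beta> \<subseteq> S2" using Dd_sub jc by blast+
  show ?thesis
  proof (cases "\<beta> \<inter> Dd \<alpha> = {}")
    case True
    then have "Dd \<alpha> \<subseteq> Dd \<beta> \<or> Dd \<alpha> \<subseteq> Ed \<beta>" using connected_in_side[OF jc(2) Dd_connected[OF jc(1)] S(1)] by blast
    then show ?thesis unfolding Ed_def by blast
  next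
    case False
    then have bD: "\<beta> \<subseteq> Dd \<alpha>" using b unfolding Ed_def by blast
    show ?thesis
    proof (cases "\<alpha> \<inter> Dd \<beta> = {}")
      case True
      then have "Dd \<beta> \<subseteq> Dd \<alpha> \<or> Dd \<beta> \<subseteq> Ed \<alpha>" using connected_in_side[OF jc(1) Dd_connected[OF jc(2)] S(2)] by blast
      then show ?thesis unfolding Ed_def by blast
    next
      case F: False
      then have aD: "\<alpha> \<subseteq> Dd \<beta>" using a unfolding Ed_def by blast
      have "Ed \<alpha> \<inter> \<beta> = {}" using bD unfolding Ed_def by blast
      then have "Ed \<alpha> \<subseteq> Dd \<beta> \<or> Ed \<alpha> \<subseteq> Ed \<beta>"
        using connected_in_side[OF jc(2) Ed_connected[OF jc(1)]] unfolding Ed_def[of \<alpha>] by blast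
      moreover have "q \<in> Ed \<alpha>" "q \<in> Ed \<beta>" using q_Ed jc by blast+
      ultimately have "Ed \<alpha> \<subseteq> Ed \<beta>" unfolding Ed_def[of \<beta>] by blast
      then have "closure (Ed \<alpha>) \<inter> Dd \<beta> = {}"
      proof -
        obtain T where T: "open T" "Dd \<beta> = S2 \<inter> T" using Dd_open[OF jc(2), unfolded openin_open] by blast
        have ES: "Ed \<alpha> \<subseteq> S2" unfolding Ed_def by blast
        have "T \<inter> Ed \<alpha> = {}" using \<open>Ed \<alpha> \<subseteq> Ed \<beta>\<close> T(2) ES unfolding Ed_def[of \<beta>] by blast
        then have "T \<inter> closure (Ed \<alpha>) = {}" using T(1) by (simp add: open_Int_closure_eq_empty)
        then show ?thesis using T(2) by blast
      qed
      then show ?thesis using F curve_sub_closure(2)[OF jc(1)] by blast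
    qed
  qed
qed

text \<open>The winding number around \<open>x\<close> is invariant under homotopies that avoid
  \<open>x\<close>, and it is nonzero exactly when \<open>x\<close> is inside.\<close>

lemma homotopic_same_side:
  assumes h: "homotopic_curves (S2 - P) \<alpha> \<beta>" and qP: "q \<in> P" and x: "x \<in> P" "x \<in> S2 - {q}"
  shows "x \<in> Dd \<alpha> \<longleftrightarrow> x \<in> Dd \<beta>"
proof -
  obtain g k where gk: "closed_curve_param g \<alpha>" "closed_curve_param k \<beta>" "homotopic_loops (S2 - P) g k"
    using h unfolding homotopic_curves_def by blast
  have sub: "\<alpha> \<subseteq> S2 - P" "\<beta> \<subseteq> S2 - P"
    using homotopic_loops_imp_subset[OF gk(3)] gk(1,2) unfolding closed_curve_param_def by auto
  have aq: "\<alpha> \<subseteq> S2 - {q}" "\<beta> \<subseteq> S2 - {q}" using sub qP by blast+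
  have "homotopic_loops (-{\<sigma> x}) (\<sigma> \<circ> g) (\<sigma> \<circ> k)"
  proof (rule homotopic_loops_continuous_image[OF gk(3)])
    show "continuous_on (S2 - P) \<sigma>" using cont\<sigma> by (rule continuous_on_subset) (use qP in blast)
    show "\<sigma> \<in> S2 - P \<rightarrow> - {\<sigma> x}"
    proof
      fix y assume y: "y \<in> S2 - P"
      then have "y \<in> S2 - {q}" "y \<noteq> x" using qP x by blast+
      then show "\<sigma> y \<in> - {\<sigma> x}" using inj_onD[OF inj\<sigma>, of y x] x(2) by blast
    qed
  qed
  then have wn: "winding_number (\<sigma> \<circ> g) (\<sigma> x) = winding_number (\<sigma> \<circ> k) (\<sigma> x)" by (rule winding_number_homotopic_loops)
  have iff: "x \<in> Dd \<gamma> \<longleftrightarrow> winding_number (\<sigma> \<circ> r) (\<sigma> x) \<noteq> 0"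
    if r: "closed_curve_param r \<gamma>" "\<gamma> \<subseteq> S2 - {q}" "x \<notin> \<gamma>" for r \<gamma>
  proof -
    note c = param_plane[OF r(1,2)]
    have xD: "x \<in> Dd \<gamma> \<longleftrightarrow> \<sigma> x \<in> inside (\<sigma> ` \<gamma>)"
      unfolding Dd_def using \<sigma>'\<sigma>[OF x(2)] \<sigma>\<sigma>' by (metis imageE imageI)
    have "\<sigma> x \<notin> \<sigma> ` \<gamma>" using inj_onD[OF inj\<sigma>, of x] x(2) r(2,3) by blast
    then have cs: "\<sigma> x \<in> inside (\<sigma> ` \<gamma>) \<or> \<sigma> x \<in> outside (\<sigma> ` \<gamma>)" using inside_Un_outside[of "\<sigma> ` \<gamma>"] by blast
    have i: "winding_number (\<sigma> \<circ> r) (\<sigma> x) \<noteq> 0" if "\<sigma> x \<in> inside (\<sigma> ` \<gamma>)"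
      using simple_closed_path_winding_number_inside[OF c(1)] that unfolding c(3)
      by (metis neg_equal_0_iff_equal one_neq_zero)
    have o: "winding_number (\<sigma> \<circ> r) (\<sigma> x) = 0" if "\<sigma> x \<in> outside (\<sigma> ` \<gamma>)"
      using winding_number_zero_in_outside[OF simple_path_imp_path[OF c(1)] c(2)] that unfolding c(3) by blast
    show ?thesis unfolding xD using cs i o by blast
  qed
  have "x \<notin> \<alpha>" "x \<notin> \<beta>" using sub x(1) by blast+
  then show ?thesis using iff[OF gk(1) aq(1)] iff[OF gk(2) aq(2)] wn by simp
qed

end

section \<open>Preimages of Jordan curves\<close>

locale polynomial_cover = branched_cover + punctured +
  assumes fq: "\<And>x. x \<in> S2 \<Longrightarrow> f x = q \<Longrightarrow> x = q" and N2: "N \<ge> 2"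
begin

definition pre :: "(real^3) set \<Rightarrow> (real^3) set" where "pre A = {x\<in>S2. f x \<in> A}"

lemma pre_open: assumes "openS2 A" shows "openS2 (pre A)"
proof -
  have "openS2 (S2 \<inter> f -` A)" using continuous_openin_preimage[OF contf _ assms] fS2 by blast
  moreover have "S2 \<inter> f -` A = pre A" unfolding pre_def by blast
  ultimately show ?thesis by simp
qed

lemma openS2_meets_closure:
  assumes "openS2 A" "y \<in> A" "y \<in> closure B" "B \<subseteq> S2"
  shows "A \<inter> B \<noteq> {}"
proof -
  obtain T where T: "open T" "A = S2 \<inter> T" using assms(1)[unfolded openin_open] by blast
  then have "T \<inter> B \<noteq> {}" using assms(2,3) closure_iff_nhds_not_empty[of y B] by blast
  then show ?thesis using T(2) assms(4) by blast
qed

text \<open>A maximum principle: within the connected exterior of \<delta> the image of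
  \<open>Dd \<alpha>\<close> is open and closed and misses \<open>q\<close>, so it is empty there.
  Being open, the image then cannot touch \<delta> either.\<close>

lemma image_Dd_subset:
  assumes jc: "jc \<alpha>" "jc \<delta>" and im: "f ` \<alpha> \<subseteq> \<delta>"
  shows "f ` Dd \<alpha> \<subseteq> Dd \<delta>"
proof -
  have DS: "Dd \<alpha> \<subseteq> S2" using Dd_sub[OF jc(1)] by blast
  have op: "openS2 (f ` Dd \<alpha>)" by (rule open_map[OF Dd_open[OF jc(1)]])
  then obtain T where T: "open T" "f ` Dd \<alpha> = S2 \<inter> T" unfolding openin_open by blast
  have "continuous_on (Dd \<alpha> \<union> \<alpha>) f" using contf by (rule continuous_on_subset) (use DS jc_sub[OF jc(1)] in blast)
  then have cl: "closed (f ` (Dd \<alpha> \<union> \<alpha>))" using compact_Dd[OF jc(1)] compact_continuous_image compact_imp_closed by blast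
  have ES: "Ed \<delta> \<subseteq> S2" "Ed \<delta> \<inter> \<delta> = {}" unfolding Ed_def by blast+
  have e1: "f ` Dd \<alpha> \<inter> Ed \<delta> = Ed \<delta> \<inter> T" using T(2) ES(1) by blast
  have e2: "f ` Dd \<alpha> \<inter> Ed \<delta> = Ed \<delta> \<inter> f ` (Dd \<alpha> \<union> \<alpha>)" using im ES(2) by blast
  have "openin (top_of_set (Ed \<delta>)) (f ` Dd \<alpha> \<inter> Ed \<delta>)" unfolding e1 using T(1) by (rule openin_open_Int)
  moreover have "closedin (top_of_set (Ed \<delta>)) (f ` Dd \<alpha> \<inter> Ed \<delta>)" unfolding e2 using cl by (rule closedin_closed_Int)
  ultimately have "f ` Dd \<alpha> \<inter> Ed \<delta> = {} \<or> f ` Dd \<alpha> \<inter> Ed \<delta> = Ed \<delta>"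
    using Ed_connected[OF jc(2)] unfolding connected_clopen by blast
  moreover have "q \<notin> f ` Dd \<alpha>" using fq Dd_sub[OF jc(1)] by blast
  ultimately have disj: "f ` Dd \<alpha> \<inter> Ed \<delta> = {}" using q_Ed[OF jc(2)] by blast
  show ?thesis
  proof
    fix y assume y: "y \<in> f ` Dd \<alpha>"
    have "y \<notin> \<delta>"
    proof
      assume "y \<in> \<delta>"
      then have "f ` Dd \<alpha> \<inter> Ed \<delta> \<noteq> {}"
        using openS2_meets_closure[OF op y _ ES(1)] curve_sub_closure(2)[OF jc(2)] by blast
      then show False using disj by blast
    qed
    moreover have "y \<in> S2" using y fS2 DS by blast
    ultimately show "y \<in> Dd \<delta>" using y disj unfolding Ed_def by blast
  qed
qed

lemma preimage_component:
  assumes "\<alpha> \<in> preimage_curves f \<delta>"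
  shows "\<alpha> \<subseteq> S2" "f ` \<alpha> \<subseteq> \<delta>" "connected \<alpha>" "\<alpha> \<noteq> {}"
    "\<And>T. connected T \<Longrightarrow> T \<subseteq> pre \<delta> \<Longrightarrow> T \<inter> \<alpha> \<noteq> {} \<Longrightarrow> T \<subseteq> \<alpha>"
proof -
  have a: "\<alpha> \<in> components (pre \<delta>)" using assms unfolding preimage_curves_def pre_def .
  have "\<alpha> \<subseteq> pre \<delta>" using in_components_subset[OF a] .
  then show "\<alpha> \<subseteq> S2" "f ` \<alpha> \<subseteq> \<delta>" unfolding pre_def by blast+
  show "connected \<alpha>" "\<alpha> \<noteq> {}" using in_components_connected[OF a] in_components_nonempty[OF a] by blast+
  show "T \<subseteq> \<alpha>" if "connected T" "T \<subseteq> pre \<delta>" "T \<inter> \<alpha> \<noteq> {}" for T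
    using components_maximal[OF a that(1,2)] that(3) by blast
qed

text \<open>The disk of one component is mapped into \<open>Dd \<delta>\<close>, so it misses the
  other component and lies on one side of it. If the disks meet, each therefore contains the other,
  and equal disks have equal boundary curves.\<close>

lemma preimages_disjoint_Dd:
  assumes jc: "jc \<alpha>" "jc \<beta>" "jc \<delta>" and pre: "\<alpha> \<in> preimage_curves f \<delta>" "\<beta> \<in> preimage_curves f \<delta>" and ne: "\<alpha> \<noteq> \<beta>"
  shows "Dd \<alpha> \<inter> Dd \<beta> = {}"
proof (rule ccontr)
  assume meet: "Dd \<alpha> \<inter> Dd \<beta> \<noteq> {}"
  have sub: "Dd \<gamma> \<subseteq> Dd \<epsilon>"
    if j: "jc \<gamma>" "jc \<epsilon>" "f ` \<gamma> \<subseteq> \<delta>" "f ` \<epsilon> \<subseteq> \<delta>" "Dd \<gamma> \<inter> Dd \<epsilon> \<noteq> {}" for \<gamma> \<epsilon>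
  proof -
    have "f ` Dd \<gamma> \<subseteq> Dd \<delta>" by (rule image_Dd_subset[OF j(1) jc(3) j(3)])
    then have d: "Dd \<gamma> \<inter> \<epsilon> = {}" using j(4) Dd_disj[OF jc(3)] by blast
    have "Dd \<gamma> \<subseteq> S2" using Dd_sub[OF j(1)] by blast
    from connected_in_side[OF j(2) Dd_connected[OF j(1)] this d] show ?thesis
      using j(5) unfolding Ed_def by blast
  qed
  have "Dd \<alpha> \<subseteq> Dd \<beta>" "Dd \<beta> \<subseteq> Dd \<alpha>"
    using sub[OF jc(1,2)] sub[OF jc(2,1)] preimage_component(2)[OF pre(1)] preimage_component(2)[OF pre(2)] meet by blast+
  then have "Dd \<alpha> = Dd \<beta>" by blast
  then show False using Dd_eq_imp_eq[OF jc(1,2)] ne by blast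
qed

text \<open>Path lifting along \<delta> injects every fibre in \<alpha> into every other one, so
  they have equal size and the description in \<open>curve_degree\<close> has a solution.\<close>

lemma curve_degree_spec:
  assumes jc: "jc \<delta>" and m1: "\<And>x. x \<in> S2 \<Longrightarrow> f x \<in> \<delta> \<Longrightarrow> m x = 1" and a: "\<alpha> \<in> preimage_curves f \<delta>"
  shows "\<forall>y\<in>\<delta>. finite {x\<in>\<alpha>. f x = y} \<and> card {x\<in>\<alpha>. f x = y} = curve_degree f \<alpha> \<delta>"
proof -
  note A = preimage_component[OF a]
  have dS: "\<delta> \<subseteq> S2" using jc_sub[OF jc] by blast
  have fin: "finite {x\<in>\<alpha>. f x = y}" if "y \<in> \<delta>" for y
  proof (rule finite_subset)
    show "{x\<in>\<alpha>. f x = y} \<subseteq> {x\<in>S2. f x = y}" using A(1) by blast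
    show "finite {x\<in>S2. f x = y}" by (rule fin_fibre) (use dS that in blast)
  qed
  have cov: "covering_space (pre \<delta>) f \<delta>" unfolding pre_def by (rule covering[OF dS m1])
  have pc: "path_connected \<delta>"
    using jc path_connected_path_image unfolding jc_def closed_curve_param_def by (metis simple_path_imp_path)
  have le: "card {x\<in>\<alpha>. f x = y} \<le> card {x\<in>\<alpha>. f x = y'}" if y: "y \<in> \<delta>" "y' \<in> \<delta>" for y y'
  proof -
    obtain \<beta> where \<beta>: "path \<beta>" "path_image \<beta> \<subseteq> \<delta>" "pathstart \<beta> = y" "pathfinish \<beta> = y'"
      using pc y unfolding path_connected_def by blast
    have "\<exists>h. path h \<and> path_image h \<subseteq> pre \<delta> \<and> pathstart h = x \<and> (\<forall>t\<in>{0..1}. f (h t) = \<beta> t)" if x: "x \<in> {x\<in>\<alpha>. f x = y}" for x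
    proof -
      have xp: "x \<in> pre \<delta>" "pathstart \<beta> = f x" using x A(1) y(1) \<beta>(3) unfolding pre_def by auto
      obtain h where "path h" "path_image h \<subseteq> pre \<delta>" "pathstart h = x" "\<And>t. t \<in> {0..1} \<Longrightarrow> f (h t) = \<beta> t"
        by (rule covering_space_lift_path_strong[OF cov xp(1) \<beta>(1,2) xp(2)]) blast
      then show ?thesis by blast
    qed
    then have "\<exists>h. \<forall>x\<in>{x\<in>\<alpha>. f x = y}. path (h x) \<and> path_image (h x) \<subseteq> pre \<delta> \<and> pathstart (h x) = x \<and> (\<forall>t\<in>{0..1}. f (h x t) = \<beta> t)"
      by (intro bchoice ballI)
    then obtain h where h: "\<And>x. x \<in> {x\<in>\<alpha>. f x = y} \<Longrightarrow> path (h x)" "\<And>x. x \<in> {x\<in>\<alpha>. f x = y} \<Longrightarrow> path_image (h x) \<subseteq> pre \<delta>"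
       "\<And>x. x \<in> {x\<in>\<alpha>. f x = y} \<Longrightarrow> h x 0 = x" "\<And>x t. x \<in> {x\<in>\<alpha>. f x = y} \<Longrightarrow> t \<in> {0..1} \<Longrightarrow> f (h x t) = \<beta> t"
      unfolding pathstart_def by blast
    show ?thesis
    proof (rule card_inj_on_le[OF _ _ fin[OF y(2)]])
      show "inj_on (\<lambda>x. h x 1) {x\<in>\<alpha>. f x = y}"
      proof (rule inj_onI)
        fix x x' assume xx: "x \<in> {x\<in>\<alpha>. f x = y}" "x' \<in> {x\<in>\<alpha>. f x = y}" "h x 1 = h x' 1"
        have hS: "h u t \<in> S2" "f (h u t) \<in> \<delta>" if "u \<in> {x\<in>\<alpha>. f x = y}" "t \<in> {0..1}" for u t
          using h(2)[OF that(1)] that(2) unfolding path_image_def pre_def by blast+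
        have "h x 0 = h x' 0"
        proof (rule lift_unique[of "{0..1}" "h x" "h x'" 1 0])
          show "continuous_on {0..1} (h x)" "continuous_on {0..1} (h x')" using h(1) xx unfolding path_def by blast+
          show "f (h x t) = f (h x' t)" if "t \<in> {0..1}" for t unfolding h(4)[OF xx(1) that] h(4)[OF xx(2) that] ..
          show "h x 1 = h x' 1" by (rule xx(3))
          show "h x t \<in> S2" "h x' t \<in> S2" if "t \<in> {0..1}" for t using hS(1)[OF xx(1) that] hS(1)[OF xx(2) that] .
          show "m u = 1" if "t \<in> {0..1}" "u \<in> S2" "f u = f (h x t)" for t u
            using m1[OF that(2)] hS(2)[OF xx(1) that(1)] that(3) by simp
        qed auto
        then show "x = x'" unfolding h(3)[OF xx(1)] h(3)[OF xx(2)] .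
      qed
      show "(\<lambda>x. h x 1) ` {x\<in>\<alpha>. f x = y} \<subseteq> {x\<in>\<alpha>. f x = y'}"
      proof (rule image_subsetI)
        fix x assume x: "x \<in> {x\<in>\<alpha>. f x = y}"
        have "x \<in> path_image (h x)" "h x 1 \<in> path_image (h x)"
          using h(3)[OF x] by (metis pathstart_def pathstart_in_path_image, metis pathfinish_def pathfinish_in_path_image)
        moreover have "path_image (h x) \<subseteq> \<alpha>"
          by (rule A(5)[OF connected_path_image[OF h(1)[OF x]] h(2)[OF x]]) (use calculation(1) x in blast)
        moreover have "f (h x 1) = y'" using h(4)[OF x, of 1] \<beta>(4) unfolding pathfinish_def by simp
        ultimately show "h x 1 \<in> {x\<in>\<alpha>. f x = y'}" by blast
      qed
    qed
  qed
  obtain y0 where y0: "y0 \<in> \<delta>" using jc_ne[OF jc] by blast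
  have ex: "\<forall>y\<in>\<delta>. finite {x\<in>\<alpha>. f x = y} \<and> card {x\<in>\<alpha>. f x = y} = card {x\<in>\<alpha>. f x = y0}"
    using fin le y0 by (meson le_antisym)
  have "curve_degree f \<alpha> \<delta> = card {x\<in>\<alpha>. f x = y0}"
    unfolding curve_degree_def
  proof (rule the_equality)
    show "\<forall>y\<in>\<delta>. finite {x\<in>\<alpha>. f x = y} \<and> card {x\<in>\<alpha>. f x = y} = card {x\<in>\<alpha>. f x = y0}" by (rule ex)
    show "n = card {x\<in>\<alpha>. f x = y0}" if "\<forall>y\<in>\<delta>. finite {x\<in>\<alpha>. f x = y} \<and> card {x\<in>\<alpha>. f x = y} = n" for n
      using bspec[OF that y0] by simp
  qed
  then show ?thesis using ex by simp
qed

text \<open>The number of preimages in the disk, counted with multiplicity, is locally constant, and it is at most \<open>1\<close> near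
  the boundary curve.\<close>

lemma degree_one_disk:
  assumes jc: "jc \<alpha>" "jc \<delta>" and im: "f ` \<alpha> \<subseteq> \<delta>" and m1: "\<And>x. x \<in> S2 \<Longrightarrow> f x \<in> \<delta> \<Longrightarrow> m x = 1"
    and one: "\<And>y. y \<in> \<delta> \<Longrightarrow> card {x\<in>\<alpha>. f x = y} = 1"
  shows "inj_on f (Dd \<alpha>)" "\<And>x. x \<in> Dd \<alpha> \<Longrightarrow> m x = 1"
proof -
  have DS: "Dd \<alpha> \<subseteq> S2" "Dd \<delta> \<subseteq> S2" and dS: "\<delta> \<subseteq> S2" using Dd_sub jc_sub jc by blast+
  have fD: "f ` Dd \<alpha> \<subseteq> Dd \<delta>" by (rule image_Dd_subset[OF jc im])
  define n where "n = (\<lambda>y. \<Sum>x | x \<in> Dd \<alpha> \<and> f x = y. m x)"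
  have fin: "finite {x. x \<in> Dd \<alpha> \<and> f x = y}" if "y \<in> S2" for y
    using finite_subset[OF _ fin_fibre[OF that], of "{x. x \<in> Dd \<alpha> \<and> f x = y}"] DS(1) by blast
  have loc: "\<exists>T. openin (top_of_set (Dd \<delta>)) T \<and> y \<in> T \<and> (\<forall>y'\<in>T. n y' = n y)" if y: "y \<in> Dd \<delta>" for y
  proof -
    \<comment> \<open>The neighbourhoods are kept on one side of \<alpha>, so that no preimage
      enters or leaves \<open>Dd \<alpha>\<close> when \<open>y\<close> moves a little.\<close>
    define B where "B = (\<lambda>x. if x \<in> Dd \<alpha> then Dd \<alpha> else Ed \<alpha>)"
    have yS: "y \<in> S2" using y DS by blast
    have nf: "x \<notin> \<alpha>" if "f x = y" for x using that im y Dd_disj[OF jc(2)] by blast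
    have "openS2 (B x) \<and> x \<in> B x" if "x \<in> S2" "f x = y" for x
      using that nf[OF that(2)] Dd_open[OF jc(1)] Ed_open[OF jc(1)] unfolding B_def by (auto simp: Ed_def)
    from stack[OF yS this] obtain W U where st: "stack_nbhd y W U" and UB: "\<And>x. x \<in> S2 \<Longrightarrow> f x = y \<Longrightarrow> U x \<subseteq> B x"
      by blast
    let ?F = "{x. x \<in> Dd \<alpha> \<and> f x = y}"
    have n_eq: "n y' = n y" if y': "y' \<in> W \<inter> Dd \<delta>" for y'
    proof -
      have U: "nbhd x (U x)" "U x \<subseteq> Dd \<alpha>" "y' \<in> f ` U x" if "x \<in> ?F" for x
      proof -
        have x: "x \<in> S2" "f x = y" "x \<in> Dd \<alpha>" using that DS by blast+
        show "nbhd x (U x)" by (rule stack_nbhdD(3)[OF st x(1,2)])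
        show "U x \<subseteq> Dd \<alpha>" using UB[OF x(1,2)] x(3) unfolding B_def by simp
        show "y' \<in> f ` U x" using stack_nbhdD(4)[OF st x(1,2)] y' by blast
      qed
      have eq: "{x. x \<in> Dd \<alpha> \<and> f x = y'} = (\<Union>x\<in>?F. {u. u \<in> U x \<and> f u = y'})"
      proof (intro equalityI subsetI)
        fix u assume u: "u \<in> {x. x \<in> Dd \<alpha> \<and> f x = y'}"
        then have "u \<in> S2" "f u \<in> W" using DS y' by blast+
        from stack_nbhdD(6)[OF st this] obtain x where x: "x \<in> S2" "f x = y" "u \<in> U x" by blast
        have "x \<in> Dd \<alpha>"
        proof (rule ccontr)
          assume "x \<notin> Dd \<alpha>"
          then have "u \<in> Ed \<alpha>" using UB[OF x(1,2)] x(3) unfolding B_def by auto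
          then show False using u unfolding Ed_def by blast
        qed
        then show "u \<in> (\<Union>x\<in>?F. {u. u \<in> U x \<and> f u = y'})" using x u by blast
      qed (use U(2) in blast)
      have "n y' = (\<Sum>x\<in>?F. \<Sum>u | u \<in> U x \<and> f u = y'. m u)"
        unfolding n_def eq
      proof (rule sum.UNION_disjoint[OF fin[OF yS]])
        have y'S: "y' \<in> S2" using y' DS by blast
        show "\<forall>x\<in>?F. finite {u. u \<in> U x \<and> f u = y'}"
        proof
          fix x assume "x \<in> ?F"
          then have "{u. u \<in> U x \<and> f u = y'} \<subseteq> {x. x \<in> Dd \<alpha> \<and> f x = y'}" using U(2) by blast
          then show "finite {u. u \<in> U x \<and> f u = y'}" using fin[OF y'S] by (rule finite_subset)
        qed
        show "\<forall>x\<in>?F. \<forall>x'\<in>?F. x \<noteq> x' \<longrightarrow> {u. u \<in> U x \<and> f u = y'} \<inter> {u. u \<in> U x' \<and> f u = y'} = {}"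
        proof (intro ballI impI)
          fix x x' assume x: "x \<in> ?F" "x' \<in> ?F" "x \<noteq> x'"
          then have "U x \<inter> U x' = {}" using stack_nbhdD(5)[OF st, of x x'] DS by blast
          then show "{u. u \<in> U x \<and> f u = y'} \<inter> {u. u \<in> U x' \<and> f u = y'} = {}" by blast
        qed
      qed
      also have "\<dots> = n y" unfolding n_def using nbhd_sum U by (intro sum.cong) blast+
      finally show ?thesis .
    qed
    obtain T where T: "open T" "W = S2 \<inter> T" using stack_nbhdD(1)[OF st, unfolded openin_open] by blast
    have "W \<inter> Dd \<delta> = Dd \<delta> \<inter> T" using T(2) DS by blast
    then have "openin (top_of_set (Dd \<delta>)) (W \<inter> Dd \<delta>)" using T(1) by (metis openin_open_Int)
    then show ?thesis using n_eq y stack_nbhdD(2)[OF st] by (intro exI[of _ "W \<inter> Dd \<delta>"]) blast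
  qed
  then have "n constant_on Dd \<delta>" by (rule locally_constant_imp_constant[OF Dd_connected[OF jc(2)]])
  then obtain k where k: "\<And>y. y \<in> Dd \<delta> \<Longrightarrow> n y = k" unfolding constant_on_def by blast
  have "\<exists>y\<in>Dd \<delta>. n y \<le> 1"
  proof -
    obtain y0 where y0: "y0 \<in> \<delta>" using jc_ne[OF jc(2)] by blast
    have y0S: "y0 \<in> S2" using y0 dS by blast
    obtain x0 where x0: "{x\<in>\<alpha>. f x = y0} = {x0}" using one[OF y0] card_1_singletonE by blast
    \<comment> \<open>Over \<open>y0\<close> only \<open>x0\<close> is on \<alpha>, and the other
      preimages are in the exterior, where their neighbourhoods stay. So a value near
      \<open>y0\<close> is taken in \<open>Dd \<alpha>\<close> only near \<open>x0\<close>, where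
      the multiplicity is \<open>1\<close>.\<close>
    define B where "B = (\<lambda>x. if x = x0 then S2 else Ed \<alpha>)"
    have "openS2 (B x) \<and> x \<in> B x" if x: "x \<in> S2" "f x = y0" for x
    proof -
      have "x \<notin> Dd \<alpha>" using x(2) y0 fD Dd_disj[OF jc(2)] by blast
      moreover have "x \<in> \<alpha> \<Longrightarrow> x = x0" using x0 x by blast
      ultimately show ?thesis using Ed_open[OF jc(1)] x(1) openin_subtopology_self[of S2] unfolding B_def Ed_def by auto
    qed
    from stack[OF y0S this] obtain W U where st: "stack_nbhd y0 W U" and UB: "\<And>x. x \<in> S2 \<Longrightarrow> f x = y0 \<Longrightarrow> U x \<subseteq> B x"
      by blast
    have "y0 \<in> closure (Dd \<delta>)" using curve_sub_closure(1)[OF jc(2)] y0 by blast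
    then have "W \<inter> Dd \<delta> \<noteq> {}" using openS2_meets_closure[OF stack_nbhdD(1,2)[OF st]] DS(2) by blast
    then obtain y where y: "y \<in> W" "y \<in> Dd \<delta>" by blast
    have x0f: "x0 \<in> \<alpha>" "f x0 = y0" using x0 by blast+
    then have x0S: "x0 \<in> S2" using jc_sub[OF jc(1)] by blast
    have mx0: "m x0 = 1" using m1[OF x0S] x0f y0 by simp
    have nb: "nbhd x0 (U x0)" by (rule stack_nbhdD(3)[OF st x0S x0f(2)])
    have sub: "{x. x \<in> Dd \<alpha> \<and> f x = y} \<subseteq> {u. u \<in> U x0 \<and> f u = y}"
    proof
      fix u assume u: "u \<in> {x. x \<in> Dd \<alpha> \<and> f x = y}"
      then have "u \<in> S2" "f u \<in> W" using DS y by blast+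
      from stack_nbhdD(6)[OF st this] obtain x where x: "x \<in> S2" "f x = y0" "u \<in> U x" by blast
      have "x = x0"
      proof (rule ccontr)
        assume "x \<noteq> x0"
        then have "u \<in> Ed \<alpha>" using UB[OF x(1,2)] x(3) unfolding B_def by auto
        then show False using u unfolding Ed_def by blast
      qed
      then show "u \<in> {u. u \<in> U x0 \<and> f u = y}" using x u by blast
    qed
    have yU: "y \<in> f ` U x0" using stack_nbhdD(4)[OF st x0S x0f(2)] y(1) by blast
    have sumU: "(\<Sum>u | u \<in> U x0 \<and> f u = y. m u) = 1" using nbhd_sum[OF nb yU] mx0 by simp
    have "finite {u. u \<in> U x0 \<and> f u = y}"
    proof (rule ccontr)
      assume "infinite {u. u \<in> U x0 \<and> f u = y}"
      from sum.infinite[OF this, of m] show False unfolding sumU by simp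
    qed
    then have "n y \<le> (\<Sum>u | u \<in> U x0 \<and> f u = y. m u)" unfolding n_def using sub by (intro sum_mono2) auto
    then have "n y \<le> 1" unfolding sumU .
    then show ?thesis using y(2) by blast
  qed
  then have k1: "k \<le> 1" using k by auto
  have le: "m x + m x' \<le> 1" if "x \<in> Dd \<alpha>" "x' \<in> Dd \<alpha>" "f x = f x'" "x \<noteq> x'" for x x'
  proof -
    have y: "f x \<in> Dd \<delta>" using that fD by blast
    have "(\<Sum>u\<in>{x, x'}. m u) \<le> n (f x)"
      unfolding n_def using that y DS by (intro sum_mono2 fin) auto
    then show ?thesis using k[OF y] k1 that(4) by simp
  qed
  have le1: "m x \<le> 1" if "x \<in> Dd \<alpha>" for x
  proof -
    have y: "f x \<in> Dd \<delta>" using that fD by blast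
    have "(\<Sum>u\<in>{x}. m u) \<le> n (f x)"
      unfolding n_def using that y DS by (intro sum_mono2 fin) auto
    then show ?thesis using k[OF y] k1 by simp
  qed
  show m1D: "m x = 1" if "x \<in> Dd \<alpha>" for x using le1[OF that] m_pos[of x] DS that by fastforce
  show "inj_on f (Dd \<alpha>)"
  proof (rule inj_onI, rule ccontr)
    fix x x' assume "x \<in> Dd \<alpha>" "x' \<in> Dd \<alpha>" "f x = f x'" "x \<noteq> x'"
    then show False using le[of x x'] m1D[of x] m1D[of x'] by simp
  qed
qed

end

section \<open>Closed disks on either side of a curve\<close>

context punctured
begin

lemma disk_param:
  assumes jc: "jc \<delta>" and p: "p \<in> Dd \<delta>"
  obtains H H' where "homeomorphism (cball (0::complex) 1) (Dd \<delta> \<union> \<delta>) H H'" "H ` sphere 0 1 = \<delta>" "H 0 = p"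
proof -
  obtain c where c: "simple_path c" "pathfinish c = pathstart c" "path_image c = \<sigma> ` \<delta>" by (rule jc_plane[OF jc])
  obtain z where z: "z \<in> inside (path_image c)" "p = \<sigma>' z" using p unfolding Dd_def c(3) by blast
  obtain h h' where h: "homeomorphism (cball (0::complex) 1) (inside (path_image c) \<union> path_image c) h h'"
    "h ` sphere 0 1 = path_image c" "h 0 = z"
    by (rule Schoenflies[OF c(1,2) z(1)]) blast
  have im: "\<sigma>' ` (inside (path_image c) \<union> path_image c) = Dd \<delta> \<union> \<delta>"
    unfolding c(3) image_Un Dd_def jc_img[OF jc] ..
  have "homeomorphism (inside (path_image c) \<union> path_image c) (Dd \<delta> \<union> \<delta>) \<sigma>' \<sigma>"
    by (rule homeomorphism_of_subsets[OF homeomorphism_symD[OF hom] subset_UNIV empty_subsetI im])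
  then have "homeomorphism (cball 0 1) (Dd \<delta> \<union> \<delta>) (\<sigma>' \<circ> h) (h' \<circ> \<sigma>)" by (rule homeomorphism_compose[OF h(1)])
  moreover have "(\<sigma>' \<circ> h) ` sphere 0 1 = \<delta>" unfolding image_comp[symmetric] h(2) c(3) jc_img[OF jc] ..
  moreover have "(\<sigma>' \<circ> h) 0 = p" using h(3) z(2) by simp
  ultimately show ?thesis by (rule that)
qed

text \<open>The Schoenflies theorem makes \<open>Dd \<delta> \<union> \<delta>\<close> a disk in the
  sense of \<open>bounds_disk\<close>. With no point of \<open>P\<close> in it, \<delta> would be
  inessential, with one point peripheral.\<close>

lemma two_points_inside:
  assumes qP: "q \<in> P" and \<delta>: "\<delta> \<subseteq> S2 - P" "\<exists>g. closed_curve_param g \<delta>" and fin: "finite P"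
    and ess: "essential P \<delta>" "\<not> peripheral P \<delta>"
  shows "card (Dd \<delta> \<inter> P) \<ge> 2"
proof -
  have jc: "jc \<delta>" unfolding jc_def using \<delta> qP by blast
  obtain p where "p \<in> Dd \<delta>" using Dd_ne[OF jc] by blast
  then obtain H H' where H: "homeomorphism (cball (0::complex) 1) (Dd \<delta> \<union> \<delta>) H H'" "H ` sphere 0 1 = \<delta>"
    by (rule disk_param[OF jc]) blast
  have DS: "Dd \<delta> \<union> \<delta> \<subseteq> S2" using Dd_sub[OF jc] jc_sub[OF jc] by blast
  have bd: "bounds_disk \<delta> (Dd \<delta> \<union> \<delta>)" unfolding bounds_disk_def using DS H by blast
  have eq: "(Dd \<delta> \<union> \<delta>) \<inter> P = Dd \<delta> \<inter> P" using \<delta>(1) by blast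
  have "\<not> Dd \<delta> \<union> \<delta> \<subseteq> S2 - P" using ess(1) bd unfolding essential_def by blast
  then have ne: "Dd \<delta> \<inter> P \<noteq> {}" using DS eq by blast
  have "card (Dd \<delta> \<inter> P) \<noteq> 1" using ess(2) bd eq unfolding peripheral_def by metis
  moreover have "card (Dd \<delta> \<inter> P) > 0" using ne fin by (simp add: card_gt_0_iff)
  ultimately show ?thesis by linarith
qed

text \<open>Puncturing at a point of the disk in place of \<open>q\<close> exchanges the two sides.
  In this way the exterior, which contains \<open>q\<close>, is parametrized by a disk as
  well.\<close>

lemma other_side:
  assumes jc: "jc \<delta>" and p: "p \<in> Dd \<delta>" and P: "punctured p \<tau> \<tau>'"
  shows "punctured.jc p \<delta>" "punctured.Dd \<tau> \<tau>' \<delta> = Ed \<delta>"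
proof -
  interpret P: punctured p \<tau> \<tau>' by (rule P)
  have "p \<notin> \<delta>" using p Dd_disj[OF jc] by blast
  then show Pjc: "P.jc \<delta>" using jc unfolding P.jc_def jc_def by blast
  have S: "P.Dd \<delta> \<subseteq> S2" "P.Ed \<delta> \<subseteq> S2" using P.Dd_sub[OF Pjc] unfolding P.Ed_def by blast+
  have d: "P.Dd \<delta> \<inter> \<delta> = {}" "P.Ed \<delta> \<inter> \<delta> = {}" using P.Dd_disj[OF Pjc] unfolding P.Ed_def by blast+
  have "P.Ed \<delta> \<subseteq> Dd \<delta> \<or> P.Ed \<delta> \<subseteq> Ed \<delta>" by (rule connected_in_side[OF jc P.Ed_connected[OF Pjc] S(2) d(2)])
  moreover have "p \<in> P.Ed \<delta>" by (rule P.q_Ed[OF Pjc])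
  ultimately have E: "P.Ed \<delta> \<subseteq> Dd \<delta>" using p unfolding Ed_def by blast
  have "P.Dd \<delta> \<subseteq> Dd \<delta> \<or> P.Dd \<delta> \<subseteq> Ed \<delta>" by (rule connected_in_side[OF jc P.Dd_connected[OF Pjc] S(1) d(1)])
  moreover have "\<not> P.Dd \<delta> \<subseteq> Dd \<delta>"
  proof
    assume "P.Dd \<delta> \<subseteq> Dd \<delta>"
    then have "S2 - \<delta> \<subseteq> Dd \<delta>" using E unfolding P.Ed_def by blast
    then show False using q_Ed[OF jc] unfolding Ed_def by blast
  qed
  ultimately have "P.Dd \<delta> \<subseteq> Ed \<delta>" by blast
  moreover have "Ed \<delta> \<subseteq> P.Dd \<delta>" using E unfolding P.Ed_def Ed_def by blast
  ultimately show "P.Dd \<delta> = Ed \<delta>" by blast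
qed

end

lemma exists_punctured: "p \<in> S2 \<Longrightarrow> \<exists>\<tau> \<tau>'. punctured p \<tau> \<tau>'"
  using punctured_sphere_chart[of p] unfolding punctured_def by metis

lemma connected_open_delete_S2:
  assumes "openS2 G" "connected G" "p \<in> S2" "p \<notin> G"
  shows "connected (G - {x})"
proof -
  obtain \<tau> \<tau>' where "punctured p \<tau> \<tau>'" using exists_punctured[OF assms(3)] by blast
  then interpret punctured p \<tau> \<tau>' .
  have GS: "G \<subseteq> S2 - {p}" using assms(1,4) openin_imp_subset by blast
  have im: "\<tau> ` G = \<tau>' -` G"
  proof (intro equalityI subsetI)
    fix z assume "z \<in> \<tau> ` G"
    then obtain y where y: "y \<in> G" "z = \<tau> y" by blast
    then have "\<tau>' z = y" using \<sigma>'\<sigma>[of y] GS by blast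
    then show "z \<in> \<tau>' -` G" using y(1) by simp
  next
    fix z assume "z \<in> \<tau>' -` G"
    then show "z \<in> \<tau> ` G" using \<sigma>\<sigma>'[of z] by (metis imageI vimageE)
  qed
  obtain T where T: "open T" "G = S2 \<inter> T" using assms(1)[unfolded openin_open] by blast
  have "\<tau>' -` G = \<tau>' -` T" using T(2) \<sigma>'im by blast
  then have "open (\<tau> ` G)" unfolding im using open_vimage[OF T(1) cont\<sigma>'] by simp
  moreover have "connected (\<tau> ` G)" by (rule connected_continuous_image[OF continuous_on_subset[OF cont\<sigma> GS] assms(2)])
  ultimately have "connected (\<tau> ` G - {\<tau> x})" by (intro connected_open_delete) auto
  then have c: "connected (\<tau>' ` (\<tau> ` G - {\<tau> x}))" by (rule connected_continuous_image[OF cont\<sigma>'])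
  show ?thesis
  proof (cases "x \<in> G")
    case True
    have "\<tau>' ` (\<tau> ` G - {\<tau> x}) = G - {x}"
    proof (intro equalityI subsetI)
      fix y assume "y \<in> \<tau>' ` (\<tau> ` G - {\<tau> x})"
      then obtain u where u: "u \<in> G" "\<tau> u \<noteq> \<tau> x" "y = \<tau>' (\<tau> u)" by blast
      then have "y = u" using \<sigma>'\<sigma>[of u] GS by blast
      then show "y \<in> G - {x}" using u by blast
    next
      fix y assume y: "y \<in> G - {x}"
      then have "\<tau> y \<noteq> \<tau> x" using inj_onD[OF inj\<sigma>, of y x] GS True by blast
      then have "\<tau> y \<in> \<tau> ` G - {\<tau> x}" using y by blast
      then have "\<tau>' (\<tau> y) \<in> \<tau>' ` (\<tau> ` G - {\<tau> x})" by (rule imageI)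
      moreover have "\<tau>' (\<tau> y) = y" using \<sigma>'\<sigma>[of y] GS y by blast
      ultimately show "y \<in> \<tau>' ` (\<tau> ` G - {\<tau> x})" by simp
    qed
    then show ?thesis using c by simp
  next
    case False
    then show ?thesis using assms(2) by simp
  qed
qed

section \<open>Connectedness of the preimage of a curve\<close>

context polynomial_cover
begin

text \<open>A nonempty part that is both open and closed has an image that is open and closed in the
  connected exterior, hence all of it. So each such part contains a preimage of \<open>q\<close>,
  and the only one is \<open>q\<close>.\<close>

lemma pre_Ed_connected:
  assumes jc: "jc \<delta>"
  shows "connected (pre (Ed \<delta>))"
proof (rule ccontr)
  assume "\<not> connected (pre (Ed \<delta>))"
  then obtain A B where AB: "openin (top_of_set (pre (Ed \<delta>))) A" "openin (top_of_set (pre (Ed \<delta>))) B"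
    "A \<union> B = pre (Ed \<delta>)" "A \<inter> B = {}" "A \<noteq> {}" "B \<noteq> {}"
    unfolding connected_openin_eq by blast
  have full: "q \<in> A" if A: "openin (top_of_set (pre (Ed \<delta>))) A" "openin (top_of_set (pre (Ed \<delta>))) B"
    "A \<union> B = pre (Ed \<delta>)" "A \<inter> B = {}" "A \<noteq> {}" for A B
  proof -
    have S: "pre (Ed \<delta>) \<subseteq> S2" unfolding pre_def by blast
    have oA: "openS2 A" by (rule openin_trans[OF A(1) pre_open[OF Ed_open[OF jc]]])
    have oB: "openS2 B" by (rule openin_trans[OF A(2) pre_open[OF Ed_open[OF jc]]])
    obtain T where T: "open T" "f ` A = S2 \<inter> T" using open_map[OF oA] unfolding openin_open by blast
    obtain T' where T': "open T'" "B = S2 \<inter> T'" using oB unfolding openin_open by blast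
    have ES: "Ed \<delta> \<subseteq> S2" unfolding Ed_def by blast
    let ?K = "S2 - B - pre (Dd \<delta>)"
    obtain T2 where T2: "open T2" "pre (Dd \<delta>) = S2 \<inter> T2" using pre_open[OF Dd_open[OF jc]] unfolding openin_open by blast
    have "?K = S2 - T' - T2" using T' T2 by blast
    then have "closed ?K" using T'(1) T2(1) closed_sphere by (simp add: closed_Diff)
    then have cl: "closed (f ` ?K)" by (rule closed_map) blast
    have "f ` A \<inter> Ed \<delta> = f ` ?K \<inter> Ed \<delta>"
    proof (intro equalityI subsetI)
      fix y assume "y \<in> f ` A \<inter> Ed \<delta>"
      then obtain x where x: "x \<in> A" "y = f x" "y \<in> Ed \<delta>" by blast
      then have "x \<in> S2" "x \<notin> B" using A S by blast+
      moreover have "x \<notin> pre (Dd \<delta>)" using x unfolding pre_def Ed_def by blast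
      ultimately show "y \<in> f ` ?K \<inter> Ed \<delta>" using x by blast
    next
      fix y assume "y \<in> f ` ?K \<inter> Ed \<delta>"
      then obtain x where x: "x \<in> S2" "x \<notin> B" "y = f x" "y \<in> Ed \<delta>" by blast
      then have "x \<in> pre (Ed \<delta>)" unfolding pre_def by blast
      then show "y \<in> f ` A \<inter> Ed \<delta>" using x A(3) by blast
    qed
    then have "closedin (top_of_set (Ed \<delta>)) (f ` A \<inter> Ed \<delta>)" using cl by (metis closedin_closed_Int inf_commute)
    moreover have "f ` A \<inter> Ed \<delta> = Ed \<delta> \<inter> T" using T(2) ES by blast
    then have "openin (top_of_set (Ed \<delta>)) (f ` A \<inter> Ed \<delta>)" using T(1) by (metis openin_open_Int)
    ultimately have "f ` A \<inter> Ed \<delta> = {} \<or> f ` A \<inter> Ed \<delta> = Ed \<delta>"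
      using Ed_connected[OF jc] unfolding connected_clopen by blast
    moreover have "f ` A \<inter> Ed \<delta> \<noteq> {}"
    proof -
      obtain x where "x \<in> A" using A(5) by blast
      then have "f x \<in> f ` A \<inter> Ed \<delta>" using A(3) unfolding pre_def by blast
      then show ?thesis by blast
    qed
    ultimately have "q \<in> f ` A" using q_Ed[OF jc] by blast
    then obtain x where x: "x \<in> A" "f x = q" by blast
    then have "x \<in> S2" using A(3) S by blast
    from fq[OF this x(2)] show "q \<in> A" using x(1) by simp
  qed
  have "q \<in> A" by (rule full[OF AB(1-5)])
  moreover have "q \<in> B" by (rule full[OF AB(2,1)]) (use AB in blast)+
  ultimately show False using AB(4) by blast
qed

text \<open>The exterior of \<open>\<delta>\<close>, punctured at \<open>q\<close>, retracts onto \<open>\<delta>\<close>; the lifted retraction shows that the preimage of \<open>\<delta>\<close>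
  is connected.\<close>

lemma preimage_connected:
  assumes jc: "jc \<delta>" and crit: "\<And>x. x \<in> S2 \<Longrightarrow> m x > 1 \<Longrightarrow> f x = q \<or> f x \<in> Dd \<delta>"
  shows "connected (pre \<delta>)"
proof -
  obtain p where p: "p \<in> Dd \<delta>" using Dd_ne[OF jc] by blast
  then have pS: "p \<in> S2" using Dd_sub[OF jc] by blast
  obtain \<tau> \<tau>' where P: "punctured p \<tau> \<tau>'" using exists_punctured[OF pS] by blast
  have qP: "q \<in> punctured.Dd \<tau> \<tau>' \<delta>" unfolding other_side(2)[OF jc p P] by (rule q_Ed[OF jc])
  obtain H H' where H: "homeomorphism (cball (0::complex) 1) (Ed \<delta> \<union> \<delta>) H H'" "H ` sphere 0 1 = \<delta>" "H 0 = q"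
    using punctured.disk_param[OF P other_side(1)[OF jc p P] qP] unfolding other_side(2)[OF jc p P] by blast
  have H1: "H' (H z) = z" if "z \<in> cball 0 1" for z using H(1) that unfolding homeomorphism_def by blast
  have H2: "H (H' y) = y" "H' y \<in> cball 0 1" if "y \<in> Ed \<delta> \<union> \<delta>" for y using H(1) that unfolding homeomorphism_def by blast+
  have H3: "H ` cball 0 1 = Ed \<delta> \<union> \<delta>" "continuous_on (cball 0 1) H" "continuous_on (Ed \<delta> \<union> \<delta>) H'"
    using H(1) unfolding homeomorphism_def by blast+
  define R where "R = Ed \<delta> \<union> \<delta> - {q}"
  have RS: "R \<subseteq> S2" unfolding R_def Ed_def using jc_sub[OF jc] by blast
  have \<delta>R: "\<delta> \<subseteq> R" unfolding R_def using jc_sub[OF jc] by blast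
  have m1: "m x = 1" if "x \<in> S2" "f x \<in> R" for x
  proof -
    have "\<not> m x > 1" using crit[OF that(1)] that(2) Dd_disj[OF jc] unfolding R_def Ed_def by blast
    then show ?thesis using m_pos[OF that(1)] by simp
  qed
  have nz: "H' y \<noteq> 0" if "y \<in> R" for y
  proof
    assume "H' y = 0"
    then have "y = q" using H2(1)[of y] H(3) that unfolding R_def by auto
    then show False using that unfolding R_def by blast
  qed
  have circ: "cmod (H' y) = 1" if y\<delta>: "y \<in> \<delta>" for y
  proof -
    obtain z where z: "z \<in> sphere 0 1" "y = H z" using y\<delta> H(2) by blast
    then show ?thesis using H1[of z] by auto
  qed
  \<comment> \<open>The radial motion of \<open>z\<close> to the unit circle. At time
    \<open>t\<close> the modulus is \<open>(1 - t) * cmod z + t\<close>, so the centre is never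
    hit.\<close>
  define w where "w = (\<lambda>(t::real) z. of_real ((1 - t) + t / cmod z) * z)"
  have cw: "cmod (w t z) = (1 - t) * cmod z + t" if "t \<in> {0..1}" "z \<noteq> 0" for t z
  proof -
    have "cmod (w t z) = \<bar>(1 - t) + t / cmod z\<bar> * cmod z" unfolding w_def by (simp only: norm_mult norm_of_real case_prod_conv)
    also have "\<bar>(1 - t) + t / cmod z\<bar> = (1 - t) + t / cmod z" using that by (intro abs_of_nonneg) auto
    finally show ?thesis using that(2) by (simp add: algebra_simps)
  qed
  have w_in: "w t z \<in> cball 0 1" "w t z \<noteq> 0" if "t \<in> {0..1}" "z \<noteq> 0" "z \<in> cball 0 1" for t z
  proof -
    have "(1 - t) * cmod z \<le> (1 - t) * 1" using that by (intro mult_left_mono) auto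
    then show "w t z \<in> cball 0 1" using cw[OF that(1,2)] by simp
    have "(1 - t) * cmod z + t > 0"
    proof (cases "t = 0")
      case False then show ?thesis using that by (intro add_nonneg_pos) auto
    qed (use that in simp)
    then have "cmod (w t z) > 0" using cw[OF that(1,2)] by simp
    then show "w t z \<noteq> 0" by auto
  qed
  define X where "X = pre R"
  have XS: "X \<subseteq> S2" and fX: "\<And>v. v \<in> X \<Longrightarrow> f v \<in> R" unfolding X_def pre_def by blast+
  define h where "h = (\<lambda>s. H (w (fst s) (H' (f (snd s)))))"
  have contX: "continuous_on X f" by (rule continuous_on_subset[OF contf XS])
  have H'R: "H' y \<in> cball 0 1" "H' y \<noteq> 0" if "y \<in> R" for y using H2(2)[of y] nz[OF that] that unfolding R_def by blast+
  have conth: "continuous_on ({0..1} \<times> X) h"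
    unfolding h_def
  proof (rule continuous_on_compose2[OF H3(2)])
    have cs: "continuous_on ({0..1::real} \<times> X) (\<lambda>s. f (snd s))"
      by (rule continuous_on_compose2[OF contX]) (auto intro!: continuous_intros)
    have "continuous_on ({0..1::real} \<times> X) (\<lambda>s. H' (f (snd s)))"
    proof (rule continuous_on_compose2[OF H3(3) cs])
      have "R \<subseteq> Ed \<delta> \<union> \<delta>" unfolding R_def by blast
      then show "(\<lambda>s. f (snd s)) ` ({0..1} \<times> X) \<subseteq> Ed \<delta> \<union> \<delta>" using fX by force
    qed
    moreover have "\<forall>s\<in>{0..1::real} \<times> X. cmod (H' (f (snd s))) \<noteq> 0"
    proof
      fix s :: "real \<times> (real^3)" assume "s \<in> {0..1::real} \<times> X"
      then have "H' (f (snd s)) \<noteq> 0" by (intro H'R(2) fX) auto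
      then show "cmod (H' (f (snd s))) \<noteq> 0" by simp
    qed
    ultimately show "continuous_on ({0..1} \<times> X) (\<lambda>s. w (fst s) (H' (f (snd s))))"
      unfolding w_def case_prod_conv by (intro continuous_intros) auto
    show "(\<lambda>s. w (fst s) (H' (f (snd s)))) ` ({0..1} \<times> X) \<subseteq> cball 0 1"
      using w_in(1) H'R fX by fastforce
  qed
  have hR: "h (t, v) \<in> R" if "t \<in> {0..1}" "v \<in> X" for t v
  proof -
    let ?z = "w t (H' (f v))"
    have z: "?z \<in> cball 0 1" "?z \<noteq> 0" using w_in[OF that(1)] H'R[OF fX[OF that(2)]] by blast+
    have "H ?z \<in> Ed \<delta> \<union> \<delta>" using H3(1) z(1) by blast
    moreover have "H ?z \<noteq> q"
    proof
      assume "H ?z = q"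
      then have "H ?z = H 0" using H(3) by simp
      then have "?z = 0" using H1[OF z(1)] H1[of 0] by simp
      then show False using z(2) by blast
    qed
    ultimately show ?thesis unfolding R_def h_def by simp
  qed
  have h0: "h (0, v) = f v" if "v \<in> X" for v
    using H2(1)[of "f v"] fX[OF that] unfolding h_def w_def R_def by simp
  have h1: "h (1, v) \<in> \<delta>" if "v \<in> X" for v
  proof -
    have "cmod (w 1 (H' (f v))) = 1" using cw[of 1 "H' (f v)"] H'R(2)[OF fX[OF that]] by simp
    then have "w 1 (H' (f v)) \<in> sphere 0 1" by simp
    then show ?thesis using H(2) unfolding h_def by auto
  qed
  have hfix: "h (t, v) = f v" if "f v \<in> \<delta>" for t v
    using H2(1)[of "f v"] circ[OF that] that unfolding h_def w_def by simp
  have cov: "covering_space X f R" unfolding X_def pre_def by (rule covering[OF RS m1])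
  obtain k where k: "continuous_on ({0..1} \<times> X) k" "k \<in> ({0..1} \<times> X) \<rightarrow> X"
    "\<And>v. v \<in> X \<Longrightarrow> k (0, v) = v" "\<And>s. s \<in> {0..1} \<times> X \<Longrightarrow> h s = f (k s)"
  proof (rule covering_space_lift_homotopy[OF cov conth, of "\<lambda>v. v"])
    show "h \<in> {0..1} \<times> X \<rightarrow> R" using hR by auto
    show "h (0, v) = f v" if "v \<in> X" for v by (rule h0[OF that])
  qed auto
  have kX: "k (t, v) \<in> X" if "t \<in> {0..1}" "v \<in> X" for t v using k(2) that by blast
  \<comment> \<open>The motion \<open>h\<close> is constant over points of \<delta>, so its lift
    fixes the points above them; hence the final map of the lift sends \<open>X\<close> onto the
    preimage of \<delta>.\<close>
  have im: "(\<lambda>v. k (1, v)) ` X = pre \<delta>"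
  proof (intro equalityI subsetI)
    fix u assume "u \<in> (\<lambda>v. k (1, v)) ` X"
    then obtain v where v: "v \<in> X" "u = k (1, v)" by blast
    have "f u = h (1, v)" using k(4)[of "(1, v)"] v by simp
    then show "u \<in> pre \<delta>" using h1[OF v(1)] kX[of 1 v] v XS unfolding pre_def by auto
  next
    fix v assume v: "v \<in> pre \<delta>"
    then have vX: "v \<in> X" and fv: "f v \<in> \<delta>" using \<delta>R unfolding X_def pre_def by blast+
    have "k (1, v) = v"
    proof (rule lift_unique[of "{0..1::real}" "\<lambda>t. k (t, v)" "\<lambda>_. v" 0 1])
      show "continuous_on {0..1} (\<lambda>t. k (t, v))"
        by (rule continuous_on_compose2[OF k(1)]) (use vX in \<open>auto intro!: continuous_intros\<close>)
      show "k (t, v) \<in> S2" if "t \<in> {0..1}" for t using kX[OF that vX] XS by blast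
      show e: "f (k (t, v)) = f v" if "t \<in> {0..1}" for t using k(4)[of "(t, v)"] hfix[OF fv, of t] that vX by simp
      show "m x = 1" if "t \<in> {0..1}" "x \<in> S2" "f x = f (k (t, v))" for t x
        using m1[OF that(2)] e[OF that(1)] that(3) fv \<delta>R by auto
    qed (use vX XS k(3) in auto)
    then show "v \<in> (\<lambda>v. k (1, v)) ` X" using vX by (metis imageI)
  qed
  \<comment> \<open>\<open>X\<close> lies between the preimage of the exterior without
    \<open>q\<close> and its closure: \<delta> consists of limits of the exterior, and
    \<open>f\<close> is open.\<close>
  have "connected X"
  proof (rule connected_intermediate_closure)
    have "pre (Ed \<delta>) \<noteq> S2"
    proof -
      obtain y where "y \<in> \<delta>" using jc_ne[OF jc] by blast
      moreover obtain x where "x \<in> S2" "f x = y" using surj[of y] calculation jc_sub[OF jc] by blast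
      ultimately show ?thesis unfolding pre_def Ed_def by blast
    qed
    then obtain x where x: "x \<in> S2" "x \<notin> pre (Ed \<delta>)" unfolding pre_def by blast
    show "connected (pre (Ed \<delta>) - {q})"
      by (rule connected_open_delete_S2[OF pre_open[OF Ed_open[OF jc]] pre_Ed_connected[OF jc] x])
    show "pre (Ed \<delta>) - {q} \<subseteq> X" using fq unfolding X_def pre_def R_def by blast
    show "X \<subseteq> closure (pre (Ed \<delta>) - {q})"
    proof
      fix v assume v: "v \<in> X"
      have fv: "f v \<in> R" by (rule fX[OF v])
      have "Ed \<delta> \<union> \<delta> \<subseteq> closure (Ed \<delta>)" using closure_subset[of "Ed \<delta>"] curve_sub_closure(2)[OF jc] by blast
      then have vq: "v \<in> S2" "f v \<in> closure (Ed \<delta>)" "f v \<in> S2" "f v \<noteq> q"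
        using fv v XS RS unfolding R_def by (blast, blast, blast, blast)
      have "T \<inter> (pre (Ed \<delta>) - {q}) \<noteq> {}" if T: "open T" "v \<in> T" for T
      proof -
        have "openS2 (S2 \<inter> T)" using T(1) by (rule openin_open_Int)
        then have o1: "openS2 (f ` (S2 \<inter> T))" by (rule open_map)
        have o2: "openS2 (f ` (S2 \<inter> T) \<inter> (S2 - {f q}))"
          using o1 by (rule openin_Int) (simp add: Diff_eq openin_open_Int open_Compl)
        show ?thesis
        proof (cases "f v = f q")
          case False
          then have "f v \<in> f ` (S2 \<inter> T) \<inter> (S2 - {f q})" using vq T by blast
          then have "f ` (S2 \<inter> T) \<inter> (S2 - {f q}) \<inter> Ed \<delta> \<noteq> {}"
            by (rule openS2_meets_closure[OF o2 _ vq(2)]) (auto simp: Ed_def)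
          then obtain u where "u \<in> S2" "u \<in> T" "f u \<noteq> f q" "f u \<in> Ed \<delta>" by blast
          then show ?thesis unfolding pre_def by blast
        next
          case True
          obtain x where x: "x \<in> S2" "f x = q" using surj[OF q] by blast
          have "f q = q" using fq[OF x] x(2) by simp
          then show ?thesis using True vq(4) by simp
        qed
      qed
      then show "v \<in> closure (pre (Ed \<delta>) - {q})" unfolding closure_iff_nhds_not_empty by blast
    qed
  qed
  moreover have "continuous_on X (\<lambda>v. k (1, v))"
    by (rule continuous_on_compose2[OF k(1)]) (auto intro!: continuous_intros)
  ultimately show ?thesis unfolding im[symmetric] using connected_continuous_image by blast
qed

text \<open>The preimage is connected, so \<alpha> is all of it and contains whole fibres; without
  critical points these have \<open>N \<ge> 2\<close> elements.\<close>

lemma not_degree_one: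
  assumes jc: "jc \<delta>" and crit: "\<And>x. x \<in> S2 \<Longrightarrow> m x > 1 \<Longrightarrow> f x = q \<or> f x \<in> Dd \<delta>"
    and a: "\<alpha> \<in> preimage_curves f \<delta>" and y: "y \<in> \<delta>"
  shows "card {x\<in>\<alpha>. f x = y} \<noteq> 1"
proof -
  note A = preimage_component[OF a]
  have "pre \<delta> \<inter> \<alpha> \<noteq> {}" using A(1,2,4) unfolding pre_def by blast
  then have "pre \<delta> \<subseteq> \<alpha>" using A(5)[OF preimage_connected[OF jc crit]] by blast
  then have eq: "{x\<in>\<alpha>. f x = y} = {x. x \<in> S2 \<and> f x = y}" using A(1) y unfolding pre_def by blast
  have yS: "y \<in> S2" "y \<noteq> q" "y \<notin> Dd \<delta>" using jc_sub[OF jc] Dd_disj[OF jc] y by blast+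
  have "N = (\<Sum>x | x \<in> S2 \<and> f x = y. m x)" using sum_fibre[OF yS(1)] by simp
  also have "\<dots> = (\<Sum>x | x \<in> S2 \<and> f x = y. 1)"
  proof (rule sum.cong[OF refl])
    fix x assume "x \<in> {x. x \<in> S2 \<and> f x = y}"
    then have x: "x \<in> S2" "f x = y" by blast+
    then have "\<not> m x > 1" using crit yS by blast
    then show "m x = 1" using m_pos[OF x(1)] by simp
  qed
  also have "\<dots> = card {x\<in>\<alpha>. f x = y}" unfolding eq by simp
  finally show ?thesis using N2 by simp
qed

end

section \<open>Obstructions\<close>

text \<open>The image of an invariant subset with the fewest elements is again invariant, so it
  cannot be smaller.\<close>

lemma exists_invariant_subset:
  assumes "finite X" "X \<noteq> {}" "f ` X \<subseteq> X"
  obtains Y where "Y \<subseteq> X" "Y \<noteq> {}" "f ` Y = Y"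
proof -
  define P where "P = (\<lambda>Y. Y \<subseteq> X \<and> Y \<noteq> {} \<and> f ` Y \<subseteq> Y)"
  have PX: "P X" using assms by (simp add: P_def)
  obtain Y where Y: "P Y" "\<And>Z. P Z \<Longrightarrow> card Y \<le> card Z"
    using ex_has_least_nat[of P X card] PX by blast
  have finY: "finite Y" using Y(1) assms(1) finite_subset unfolding P_def by blast
  have "P (f ` Y)" using Y(1) unfolding P_def by blast
  then have "card Y \<le> card (f ` Y)" by (rule Y(2))
  moreover have "f ` Y \<subseteq> Y" using Y(1) unfolding P_def by blast
  ultimately have "f ` Y = Y" using finY by (metis card_seteq)
  then show ?thesis using that Y(1) unfolding P_def by blast
qed

text \<open>Choosing for every member a member that maps onto it is an injection of a finite family into itself, hence surjective.\<close>

lemma finite_family_image_closed: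
  assumes fin: "finite \<B>" and pre: "\<And>b. b \<in> \<B> \<Longrightarrow> \<exists>b'\<in>\<B>. f ` b' = b \<and> Q b'"
  shows "\<And>b. b \<in> \<B> \<Longrightarrow> f ` b \<in> \<B> \<and> Q b"
proof -
  have "\<exists>g. \<forall>b\<in>\<B>. g b \<in> \<B> \<and> f ` g b = b \<and> Q (g b)" 
  proof (rule bchoice, rule ballI)
    fix b assume "b \<in> \<B>"
    from pre[OF this] show "\<exists>b'. b' \<in> \<B> \<and> f ` b' = b \<and> Q b'" by blast
  qed
  then obtain g where "\<forall>b\<in>\<B>. g b \<in> \<B> \<and> f ` g b = b \<and> Q (g b)" ..
  then have g: "\<And>b. b \<in> \<B> \<Longrightarrow> g b \<in> \<B>" "\<And>b. b \<in> \<B> \<Longrightarrow> f ` g b = b" "\<And>b. b \<in> \<B> \<Longrightarrow> Q (g b)" by blast+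
  have "inj_on g \<B>"
  proof (rule inj_onI)
    fix a b assume ab: "a \<in> \<B>" "b \<in> \<B>" "g a = g b"
    show "a = b" using arg_cong[OF ab(3), of "image f"] unfolding g(2)[OF ab(1)] g(2)[OF ab(2)] .
  qed
  moreover have "g ` \<B> \<subseteq> \<B>" using g(1) by blast
  ultimately have surj: "g ` \<B> = \<B>" using endo_inj_surj[OF fin] by blast
  show "f ` b \<in> \<B> \<and> Q b" if b: "b \<in> \<B>" for b
  proof -
    obtain a where "a \<in> \<B>" "b = g a" using b surj by blast
    then show ?thesis using g(2,3) by simp
  qed
qed

section \<open>Weights of the curves around a point\<close>

locale obstructed_cover = polynomial_cover +
  fixes P :: "(real^3) set" and \<Delta> :: "(real^3) set set" and u :: "(real^3) set \<Rightarrow> real"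
  assumes P: "P = postcritical_set f" and finP: "finite P" and qP: "q \<in> P"
    and mc: "multicurve P \<Delta>"
    and u0: "\<And>\<delta>. u \<delta> \<ge> 0" and u_pos: "\<exists>\<delta>\<in>\<Delta>. u \<delta> > 0"
    and u_le: "\<And>\<delta>. \<delta> \<in> \<Delta> \<Longrightarrow> u \<delta> \<le> (\<Sum>\<epsilon>\<in>\<Delta>. thurston_matrix f \<delta> \<epsilon> * u \<epsilon>)"
begin

lemma P_sub: "P \<subseteq> S2" and P_inv: "x \<in> P \<Longrightarrow> f x \<in> P" and P_crit: "x \<in> S2 \<Longrightarrow> m x > 1 \<Longrightarrow> f x \<in> P"
proof -
  let ?F = "{X. X \<subseteq> S2 \<and> f ` critical_points f \<subseteq> X \<and> f ` X \<subseteq> X}"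
  have PF: "P = \<Inter>?F" unfolding P postcritical_set_def ..
  have "S2 \<in> ?F" using fS2 unfolding critical_points_def by blast
  then show "P \<subseteq> S2" unfolding PF by blast
  show "f x \<in> P" if "x \<in> P" using that unfolding PF by blast
  show "f x \<in> P" if "x \<in> S2" "m x > 1"
  proof -
    have "f x \<in> f ` critical_points f" using that unfolding critical_points_def by blast
    then show ?thesis unfolding PF by blast
  qed
qed

lemma fin\<Delta>: "finite \<Delta>" using mc unfolding multicurve_def by blast

lemma \<Delta>D: assumes "\<delta> \<in> \<Delta>"
  shows "jc \<delta>" "\<delta> \<subseteq> S2 - P" "card (Dd \<delta> \<inter> P) \<ge> 2"
proof -
  have d: "\<delta> \<subseteq> S2 - P" "\<exists>g. closed_curve_param g \<delta>" "essential P \<delta>" "\<not> peripheral P \<delta>"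
    using mc assms unfolding multicurve_def by blast+
  show "jc \<delta>" using d(1,2) qP unfolding jc_def by blast
  show "\<delta> \<subseteq> S2 - P" by (rule d(1))
  show "card (Dd \<delta> \<inter> P) \<ge> 2" by (rule two_points_inside[OF qP d(1,2) finP d(3,4)])
qed

lemma \<Delta>_distinct: "\<delta> \<in> \<Delta> \<Longrightarrow> \<epsilon> \<in> \<Delta> \<Longrightarrow> \<delta> \<noteq> \<epsilon> \<Longrightarrow> \<delta> \<inter> \<epsilon> = {} \<and> \<not> homotopic_curves (S2 - P) \<delta> \<epsilon>"
  using mc unfolding multicurve_def by blast

lemma m1_on: "\<delta> \<in> \<Delta> \<Longrightarrow> x \<in> S2 \<Longrightarrow> f x \<in> \<delta> \<Longrightarrow> m x = 1"
  using \<Delta>D(2)[of \<delta>] P_crit[of x] m_pos[of x] by fastforce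

lemma homotopic_jc: assumes "homotopic_curves (S2 - P) \<alpha> \<delta>" shows "jc \<alpha>"
proof -
  obtain g h where g: "closed_curve_param g \<alpha>" "homotopic_loops (S2 - P) g h"
    using assms unfolding homotopic_curves_def by blast
  then have "\<alpha> \<subseteq> S2 - P" using homotopic_loops_imp_subset[OF g(2)] unfolding closed_curve_param_def by blast
  then show ?thesis using g(1) qP unfolding jc_def by blast
qed

lemma homotopic_inside: "homotopic_curves (S2 - P) \<alpha> \<delta> \<Longrightarrow> x \<in> P - {q} \<Longrightarrow> x \<in> Dd \<alpha> \<longleftrightarrow> x \<in> Dd \<delta>"
  using homotopic_same_side[OF _ qP, of \<alpha> \<delta> x] P_sub by blast

abbreviation A where "A \<equiv> thurston_matrix f"

definition S where "S \<delta>' \<delta> = {\<alpha>. \<alpha> \<in> preimage_curves f \<delta> \<and> homotopic_curves (S2 - P) \<alpha> \<delta>'}"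

lemma A_eq: "A \<delta>' \<delta> = (\<Sum>\<alpha>\<in>S \<delta>' \<delta>. 1 / real (curve_degree f \<alpha> \<delta>))"
  unfolding thurston_matrix_def S_def P[symmetric] ..

lemma A_nonneg: "A \<delta>' \<delta> \<ge> 0" unfolding A_eq by (intro sum_nonneg) simp

definition around where "around x = {\<delta>\<in>\<Delta>. x \<in> Dd \<delta>}"

text \<open>A partial column sum: the share of \<delta> that the matrix passes on to the curves
  around \<open>x\<close>.\<close>

definition c where "c x \<delta> = (\<Sum>\<delta>'\<in>around x. A \<delta>' \<delta>)"

lemma fin_around: "finite (around x)" unfolding around_def using fin\<Delta> by simp

definition deg1 where "deg1 \<alpha> \<delta> \<longleftrightarrow> \<alpha> \<in> preimage_curves f \<delta> \<and> jc \<alpha> \<and> (\<forall>y\<in>\<delta>. card {x\<in>\<alpha>. f x = y} = 1)"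

text \<open>At most one summand occurs. Two components surrounding \<open>x\<close> would have
  meeting disks, and one component homotopic to two members of the multicurve would make these
  homotopic. The summand is the inverse of a degree, and \<open>f\<close> maps the disk of its
  component, which contains \<open>x\<close>, into \<open>Dd \<delta>\<close>.\<close>

lemma c_cases:
  assumes x: "x \<in> P - {q}" and \<delta>: "\<delta> \<in> \<Delta>"
  shows "c x \<delta> \<le> (if f x \<in> Dd \<delta> then 1 else 0)"
    "c x \<delta> = 1 \<Longrightarrow> \<exists>\<delta>'\<in>around x. A \<delta>' \<delta> = 1 \<and> (\<exists>\<alpha>. deg1 \<alpha> \<delta> \<and> homotopic_curves (S2 - P) \<alpha> \<delta>')"
proof -
  have "c x \<delta> = 0 \<or> (\<exists>\<delta>'\<in>around x. \<exists>\<alpha>\<in>S \<delta>' \<delta>. x \<in> Dd \<alpha> \<and> A \<delta>' \<delta> = 1 / real (curve_degree f \<alpha> \<delta>) \<and> c x \<delta> = A \<delta>' \<delta>)"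
  proof (cases "\<forall>\<delta>'\<in>around x. A \<delta>' \<delta> = 0")
    case True
    then show ?thesis unfolding c_def by simp
  next
    case False
    then obtain \<delta>' where d': "\<delta>' \<in> around x" "A \<delta>' \<delta> \<noteq> 0" by blast
    have "S \<delta>' \<delta> \<noteq> {}" using d'(2) unfolding A_eq by auto
    then obtain \<alpha> where \<alpha>: "\<alpha> \<in> S \<delta>' \<delta>" by blast
    have uniq: "\<beta> = \<alpha> \<and> \<delta>'' = \<delta>'" if b: "\<delta>'' \<in> around x" "\<beta> \<in> S \<delta>'' \<delta>" for \<beta> \<delta>''
    proof -
      have h: "homotopic_curves (S2 - P) \<beta> \<delta>''" "homotopic_curves (S2 - P) \<alpha> \<delta>'"
        "\<beta> \<in> preimage_curves f \<delta>" "\<alpha> \<in> preimage_curves f \<delta>"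
        using b(2) \<alpha> unfolding S_def by blast+
      have xD: "x \<in> Dd \<beta>" "x \<in> Dd \<alpha>"
        using homotopic_inside[OF h(1) x] homotopic_inside[OF h(2) x] b(1) d'(1) unfolding around_def by blast+
      have e: "\<beta> = \<alpha>"
      proof (rule ccontr)
        assume "\<beta> \<noteq> \<alpha>"
        from preimages_disjoint_Dd[OF homotopic_jc[OF h(1)] homotopic_jc[OF h(2)] \<Delta>D(1)[OF \<delta>] h(3,4) this]
        show False using xD by blast
      qed
      have "homotopic_curves (S2 - P) \<delta>'' \<delta>'" using homotopic_curves_sym_trans[of "S2 - P" \<alpha> \<delta>'' \<delta>'] h(1,2) unfolding e by blast
      then have "\<delta>'' = \<delta>'" using \<Delta>_distinct b(1) d'(1) unfolding around_def by blast
      then show ?thesis using e by blast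
    qed
    have "S \<delta>' \<delta> = {\<alpha>}" using uniq[OF d'(1)] \<alpha> by blast
    then have A': "A \<delta>' \<delta> = 1 / real (curve_degree f \<alpha> \<delta>)" unfolding A_eq by simp
    have "A \<delta>'' \<delta> = 0" if "\<delta>'' \<in> around x - {\<delta>'}" for \<delta>''
    proof -
      have "S \<delta>'' \<delta> = {}" using uniq that by blast
      then show ?thesis unfolding A_eq by simp
    qed
    then have "c x \<delta> = A \<delta>' \<delta>" unfolding c_def using fin_around d'(1) by (subst sum.remove[OF fin_around d'(1)]) simp
    moreover have "x \<in> Dd \<alpha>" using homotopic_inside[of \<alpha> \<delta>' x] \<alpha> x d'(1) unfolding S_def around_def by blast
    ultimately show ?thesis using A' d'(1) \<alpha> by blast
  qed
  then consider "c x \<delta> = 0" | \<delta>' \<alpha> where "\<delta>' \<in> around x" "\<alpha> \<in> S \<delta>' \<delta>" "x \<in> Dd \<alpha>"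
    "A \<delta>' \<delta> = 1 / real (curve_degree f \<alpha> \<delta>)" "c x \<delta> = A \<delta>' \<delta>" by blast
  then have "c x \<delta> \<le> (if f x \<in> Dd \<delta> then 1 else 0) \<and>
    (c x \<delta> = 1 \<longrightarrow> (\<exists>\<delta>'\<in>around x. A \<delta>' \<delta> = 1 \<and> (\<exists>\<alpha>. deg1 \<alpha> \<delta> \<and> homotopic_curves (S2 - P) \<alpha> \<delta>')))"
  proof cases
    case (2 \<delta>' \<alpha>)
    have a: "\<alpha> \<in> preimage_curves f \<delta>" "homotopic_curves (S2 - P) \<alpha> \<delta>'" using 2(2) unfolding S_def by blast+
    have ja: "jc \<alpha>" by (rule homotopic_jc[OF a(2)])
    have "f x \<in> Dd \<delta>" using image_Dd_subset[OF ja \<Delta>D(1)[OF \<delta>] preimage_component(2)[OF a(1)]] 2(3) by blast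
    moreover have "c x \<delta> \<le> 1"
    \<comment> \<open>In degree \<open>0\<close> the summand \<open>1 / 0\<close> is
      \<open>0\<close>.\<close>
    proof (cases "curve_degree f \<alpha> \<delta> = 0")
      case False
      then have "1 / real (curve_degree f \<alpha> \<delta>) \<le> 1" by simp
      then show ?thesis using 2(4,5) by simp
    qed (use 2(4,5) in simp)
    moreover have "\<exists>\<delta>'\<in>around x. A \<delta>' \<delta> = 1 \<and> (\<exists>\<alpha>. deg1 \<alpha> \<delta> \<and> homotopic_curves (S2 - P) \<alpha> \<delta>')" if "c x \<delta> = 1"
    proof -
      have cd: "curve_degree f \<alpha> \<delta> = 1" using that 2(4,5) by (cases "curve_degree f \<alpha> \<delta> = 0") auto
      have "\<forall>y\<in>\<delta>. card {x\<in>\<alpha>. f x = y} = 1"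
        using curve_degree_spec[OF \<Delta>D(1)[OF \<delta>] m1_on[OF \<delta>] a(1)] unfolding cd by blast
      then have "deg1 \<alpha> \<delta>" unfolding deg1_def using a(1) ja by blast
      then show ?thesis using 2(1,5) that a(2) by (intro bexI[of _ \<delta>']) auto
    qed
    ultimately show ?thesis by simp
  qed simp
  then show "c x \<delta> \<le> (if f x \<in> Dd \<delta> then 1 else 0)"
    "c x \<delta> = 1 \<Longrightarrow> \<exists>\<delta>'\<in>around x. A \<delta>' \<delta> = 1 \<and> (\<exists>\<alpha>. deg1 \<alpha> \<delta> \<and> homotopic_curves (S2 - P) \<alpha> \<delta>')" by blast+
qed

definition L where "L x = (\<Sum>\<delta>\<in>around x. u \<delta>)"

lemma L_alt: "L y = (\<Sum>\<delta>\<in>\<Delta>. u \<delta> * (if y \<in> Dd \<delta> then 1 else 0))"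
proof -
  have "L y = (\<Sum>\<delta>\<in>\<Delta>. if y \<in> Dd \<delta> then u \<delta> else 0)" unfolding L_def around_def using fin\<Delta> by (rule sum.inter_filter)
  also have "\<dots> = (\<Sum>\<delta>\<in>\<Delta>. u \<delta> * (if y \<in> Dd \<delta> then 1 else 0))" by (rule sum.cong) auto
  finally show ?thesis .
qed

lemma sum_Au: "(\<Sum>\<delta>'\<in>around x. \<Sum>\<delta>\<in>\<Delta>. A \<delta>' \<delta> * u \<delta>) = (\<Sum>\<delta>\<in>\<Delta>. u \<delta> * c x \<delta>)"
proof -
  have "(\<Sum>\<delta>'\<in>around x. \<Sum>\<delta>\<in>\<Delta>. A \<delta>' \<delta> * u \<delta>) = (\<Sum>\<delta>\<in>\<Delta>. \<Sum>\<delta>'\<in>around x. A \<delta>' \<delta> * u \<delta>)" by (rule sum.swap)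
  also have "\<dots> = (\<Sum>\<delta>\<in>\<Delta>. u \<delta> * c x \<delta>)" unfolding c_def by (simp add: sum_distrib_left sum_distrib_right mult.commute)
  finally show ?thesis .
qed

lemma L_le: "L x \<le> (\<Sum>\<delta>\<in>\<Delta>. u \<delta> * c x \<delta>)"
  unfolding sum_Au[symmetric] L_def by (rule sum_mono) (use u_le in \<open>auto simp: around_def\<close>)

lemma c_term_le: "x \<in> P - {q} \<Longrightarrow> \<delta> \<in> \<Delta> \<Longrightarrow> u \<delta> * c x \<delta> \<le> u \<delta> * (if f x \<in> Dd \<delta> then 1 else 0)"
  using c_cases(1) u0 by (intro mult_left_mono) auto

lemma L_mono: "x \<in> P - {q} \<Longrightarrow> L x \<le> L (f x)"
  using L_le[of x] sum_mono[of \<Delta> "\<lambda>\<delta>. u \<delta> * c x \<delta>" "\<lambda>\<delta>. u \<delta> * (if f x \<in> Dd \<delta> then 1 else 0)"] c_term_le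
  unfolding L_alt[of "f x"] by fastforce

lemma sum_mono_eq:
  fixes a b :: "'i \<Rightarrow> real"
  assumes "finite I" "\<And>i. i \<in> I \<Longrightarrow> a i \<le> b i" "sum a I = sum b I" "i \<in> I"
  shows "a i = b i"
proof -
  have "(\<Sum>i\<in>I. b i - a i) = 0" using assms(3) by (simp add: sum_subtractf)
  then have "\<forall>i\<in>I. b i - a i = 0" using sum_nonneg_eq_0_iff[OF assms(1), of "\<lambda>i. b i - a i"] assms(2) by fastforce
  then show ?thesis using assms(4) by simp
qed

text \<open>Both estimates between \<open>L x\<close> and \<open>L (f x)\<close> are equalities,
  hence equalities term by term. The upper one gives \<open>c x \<delta> = 1\<close> and so a
  component of degree one; the lower one expresses \<open>u \<delta>'\<close> through the matrix, so
  \<open>u \<delta>' \<ge> u \<delta> > 0\<close> and the step can be repeated with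
  \<open>\<delta>'\<close>.\<close>

lemma deg1_preimage:
  assumes x: "x \<in> P - {q}" "L (f x) = L x" and \<delta>: "\<delta> \<in> \<Delta>" "u \<delta> > 0" "f x \<in> Dd \<delta>"
  shows "\<exists>\<delta>'\<in>around x. u \<delta>' > 0 \<and> (\<exists>\<alpha>. deg1 \<alpha> \<delta> \<and> homotopic_curves (S2 - P) \<alpha> \<delta>')"
proof -
  have le2: "(\<Sum>\<delta>\<in>\<Delta>. u \<delta> * c x \<delta>) \<le> L (f x)"
    unfolding L_alt[of "f x"] by (rule sum_mono) (rule c_term_le[OF x(1)])
  then have e1: "(\<Sum>\<delta>\<in>\<Delta>. u \<delta> * c x \<delta>) = L (f x)" and e2: "L x = (\<Sum>\<delta>\<in>\<Delta>. u \<delta> * c x \<delta>)" using L_le[of x] x(2) by simp_all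
  have "u \<delta> * c x \<delta> = u \<delta> * (if f x \<in> Dd \<delta> then 1 else 0)"
    by (rule sum_mono_eq[OF fin\<Delta> c_term_le[OF x(1)] e1[unfolded L_alt[of "f x"]] \<delta>(1)])
  then have "c x \<delta> = 1" using \<delta>(2,3) by simp
  from c_cases(2)[OF x(1) \<delta>(1) this] obtain \<delta>' where d': "\<delta>' \<in> around x" "A \<delta>' \<delta> = 1"
    "\<exists>\<alpha>. deg1 \<alpha> \<delta> \<and> homotopic_curves (S2 - P) \<alpha> \<delta>'" by blast
  have "u \<delta>' = (\<Sum>\<epsilon>\<in>\<Delta>. A \<delta>' \<epsilon> * u \<epsilon>)"
    by (rule sum_mono_eq[OF fin_around _ e2[unfolded L_def sum_Au[symmetric]] d'(1)]) (use u_le in \<open>auto simp: around_def\<close>)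
  also have "\<dots> \<ge> A \<delta>' \<delta> * u \<delta>" by (rule member_le_sum[OF \<delta>(1) _ fin\<Delta>]) (simp add: A_nonneg u0)
  finally have "u \<delta>' > 0" using d'(2) \<delta>(2) by simp
  then show ?thesis using d' by blast
qed

definition B where "B \<delta> = Dd \<delta> \<inter> P"

text \<open>Homotopic curves surround the same points of \<open>P - {q}\<close>, so the points in
  question lie in the disk of \<alpha>, where \<open>f\<close> is injective and unramified.\<close>

lemma deg1_B:
  assumes \<delta>: "\<delta> \<in> \<Delta>" and \<alpha>: "deg1 \<alpha> \<delta>" "homotopic_curves (S2 - P) \<alpha> \<delta>'"
  shows "inj_on f (B \<delta>')" "f ` B \<delta>' \<subseteq> B \<delta>" "\<forall>x\<in>B \<delta>'. m x = 1"
proof -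
  have a: "\<alpha> \<in> preimage_curves f \<delta>" "jc \<alpha>" "\<And>y. y \<in> \<delta> \<Longrightarrow> card {x\<in>\<alpha>. f x = y} = 1" using \<alpha>(1) unfolding deg1_def by blast+
  have im: "f ` \<alpha> \<subseteq> \<delta>" by (rule preimage_component(2)[OF a(1)])
  note d1 = degree_one_disk[OF a(2) \<Delta>D(1)[OF \<delta>] im m1_on[OF \<delta>] a(3)]
  have "Dd \<delta>' \<subseteq> S2 - {q}"
  proof -
    have "homotopic_curves (S2 - P) \<delta>' \<alpha>"
      using \<alpha>(2) unfolding homotopic_curves_def using homotopic_loops_sym by blast
    then show ?thesis by (intro Dd_sub homotopic_jc)
  qed
  then have sub: "B \<delta>' \<subseteq> Dd \<alpha>" using homotopic_inside[OF \<alpha>(2)] unfolding B_def by blast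
  show "inj_on f (B \<delta>')" by (rule inj_on_subset[OF d1(1) sub])
  show "\<forall>x\<in>B \<delta>'. m x = 1" using d1(2) sub by blast
  have "f ` Dd \<alpha> \<subseteq> Dd \<delta>" by (rule image_Dd_subset[OF a(2) \<Delta>D(1)[OF \<delta>] im])
  then show "f ` B \<delta>' \<subseteq> B \<delta>" using sub P_inv unfolding B_def by blast
qed

theorem obstruction_blocks:
  obtains \<B> where "\<B> \<noteq> {}"
    "\<And>b. b \<in> \<B> \<Longrightarrow> b \<subseteq> P - {q} \<and> 2 \<le> card b \<and> (\<forall>x\<in>b. m x = 1)"
    "\<And>b. b \<in> \<B> \<Longrightarrow> f ` b \<in> \<B>"
    "\<And>b. b \<in> \<B> \<Longrightarrow> \<exists>b'\<in>\<B>. f ` b' = b"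
    "\<And>b b'. b \<in> \<B> \<Longrightarrow> b' \<in> \<B> \<Longrightarrow> b = b' \<or> b \<inter> b' = {}"
    "\<And>b. b \<in> \<B> \<Longrightarrow> \<not> f ` {x\<in>S2. m x > 1} - {q} \<subseteq> b"
proof -
  have finPq: "finite (P - {q})" using finP by simp
  have Bsub: "B \<delta> \<subseteq> P - {q}" if "\<delta> \<in> \<Delta>" for \<delta> using Dd_sub[OF \<Delta>D(1)[OF that]] unfolding B_def by blast
  have B2: "card (B \<delta>) \<ge> 2" if "\<delta> \<in> \<Delta>" for \<delta> using \<Delta>D(3)[OF that] unfolding B_def .
  have finB: "finite (B \<delta>)" for \<delta> unfolding B_def using finP by simp
  obtain \<delta>0 where \<delta>0: "\<delta>0 \<in> \<Delta>" "u \<delta>0 > 0" using u_pos by blast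
  have "B \<delta>0 \<noteq> {}" using B2[OF \<delta>0(1)] by auto
  then obtain x0 where x0: "x0 \<in> B \<delta>0" by blast
  have x0P: "x0 \<in> P - {q}" using Bsub[OF \<delta>0(1)] x0 by blast
  define M where "M = Max (L ` (P - {q}))"
  have LM: "L x \<le> M" if "x \<in> P - {q}" for x unfolding M_def using finPq that by simp
  have "u \<delta>0 \<le> L x0" unfolding L_def using \<delta>0(1) x0 fin_around u0
    by (intro member_le_sum) (auto simp: around_def B_def)
  then have Mpos: "M > 0" using LM[OF x0P] \<delta>0(2) by simp
  define X where "X = {x \<in> P - {q}. L x = M}"
  have "M \<in> L ` (P - {q})" unfolding M_def using finPq x0P by (intro Max_in) auto
  then have Xne: "X \<noteq> {}" unfolding X_def by blast
  have fPq: "f x \<in> P - {q}" if "x \<in> P - {q}" for x using that P_inv[of x] fq[of x] P_sub by blast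
  have fX: "f ` X \<subseteq> X"
  proof (rule image_subsetI)
    fix x assume x: "x \<in> X"
    then have "L (f x) \<ge> M" "L (f x) \<le> M" using L_mono[of x] LM[OF fPq[of x]] unfolding X_def by auto
    then show "f x \<in> X" using fPq[of x] x unfolding X_def by simp
  qed
  have finX: "finite X" unfolding X_def using finPq by simp
  \<comment> \<open>On \<open>X'\<close> every point has a preimage in the set, so curves around its
    points can be pulled back again and again.\<close>
  obtain X' where X': "X' \<subseteq> X" "X' \<noteq> {}" "f ` X' = X'" by (rule exists_invariant_subset[OF finX Xne fX])
  define \<D> where "\<D> = {\<delta>\<in>\<Delta>. u \<delta> > 0 \<and> Dd \<delta> \<inter> X' \<noteq> {}}"
  have Dne: "\<D> \<noteq> {}"
  proof -
    obtain x where x: "x \<in> X'" using X'(2) by blast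
    then have "L x > 0" using X'(1) Mpos unfolding X_def by auto
    then obtain \<delta> where "\<delta> \<in> around x" "u \<delta> \<noteq> 0" unfolding L_def by (metis less_irrefl sum.neutral)
    then have "\<delta> \<in> \<D>" using x u0[of \<delta>] unfolding \<D>_def around_def by auto
    then show ?thesis by blast
  qed
  have step: "\<exists>\<delta>'\<in>\<D>. \<exists>\<alpha>. deg1 \<alpha> \<delta> \<and> homotopic_curves (S2 - P) \<alpha> \<delta>'" if d: "\<delta> \<in> \<D>" for \<delta>
  proof -
    obtain y where y: "y \<in> X'" "y \<in> Dd \<delta>" using d unfolding \<D>_def by blast
    have "y \<in> f ` X'" using y(1) unfolding X'(3) .
    then obtain x where x0: "x \<in> X'" "y = f x" by (elim imageE)
    have x: "x \<in> X'" "f x \<in> Dd \<delta>" "f x \<in> X'" using x0(1) y unfolding x0(2) by simp_all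
    have "x \<in> P - {q}" "L (f x) = L x" using x X'(1) unfolding X_def by auto
    then obtain \<delta>' where "\<delta>' \<in> around x" "u \<delta>' > 0" "\<exists>\<alpha>. deg1 \<alpha> \<delta> \<and> homotopic_curves (S2 - P) \<alpha> \<delta>'"
      using deg1_preimage[of x \<delta>] d x(2) unfolding \<D>_def by blast
    then show ?thesis using x(1) unfolding \<D>_def around_def by blast
  qed
  \<comment> \<open>A pullback of degree one maps the enclosed points of \<open>P\<close>
    injectively, so it never has more of them than the given curve. Starting from the least number
    forces equality, which makes the map of these points onto.\<close>
  obtain \<delta>1 where \<delta>1: "\<delta>1 \<in> \<D>" "\<And>\<delta>. \<delta> \<in> \<D> \<Longrightarrow> card (B \<delta>1) \<le> card (B \<delta>)"
    using ex_has_least_nat[of "\<lambda>\<delta>. \<delta> \<in> \<D>" _ "\<lambda>\<delta>. card (B \<delta>)"] Dne by blast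
  define \<E> where "\<E> = {\<delta>\<in>\<D>. card (B \<delta>) = card (B \<delta>1)}"
  have E\<Delta>: "\<delta> \<in> \<Delta>" if "\<delta> \<in> \<E>" for \<delta> using that unfolding \<E>_def \<D>_def by blast
  have stepE: "\<exists>\<delta>'\<in>\<E>. f ` B \<delta>' = B \<delta> \<and> (\<forall>x\<in>B \<delta>'. m x = 1)" if d: "\<delta> \<in> \<E>" for \<delta>
  proof -
    have dD: "\<delta> \<in> \<D>" using d unfolding \<E>_def by blast
    obtain \<delta>' \<alpha> where a: "\<delta>' \<in> \<D>" "deg1 \<alpha> \<delta>" "homotopic_curves (S2 - P) \<alpha> \<delta>'" using step[OF dD] by blast
    note s = deg1_B[OF E\<Delta>[OF d] a(2,3)]
    have "card (f ` B \<delta>') = card (B \<delta>')" by (rule card_image[OF s(1)])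
    moreover have "card (f ` B \<delta>') \<le> card (B \<delta>)" by (rule card_mono[OF finB s(2)])
    moreover have "card (B \<delta>) = card (B \<delta>1)" using d unfolding \<E>_def by blast
    moreover have "card (B \<delta>1) \<le> card (B \<delta>')" by (rule \<delta>1(2)[OF a(1)])
    ultimately have e: "card (B \<delta>') = card (B \<delta>1)" "card (f ` B \<delta>') = card (B \<delta>)" by linarith+
    have "f ` B \<delta>' = B \<delta>" by (rule card_subset_eq[OF finB s(2) e(2)])
    moreover have "\<delta>' \<in> \<E>" using a(1) e(1) unfolding \<E>_def by blast
    ultimately show ?thesis using s(3) by blast
  qed
  have finE: "finite (B ` \<E>)"
    using finite_subset[of \<E> \<Delta>] fin\<Delta> E\<Delta> by blast
  have pre: "\<exists>b'\<in>B ` \<E>. f ` b' = b \<and> (\<forall>x\<in>b'. m x = 1)" if "b \<in> B ` \<E>" for b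
    using stepE that by blast
  have closed: "f ` b \<in> B ` \<E> \<and> (\<forall>x\<in>b. m x = 1)" if "b \<in> B ` \<E>" for b
    by (rule finite_family_image_closed[OF finE _ that]) (rule pre)
  show ?thesis
  proof (rule that[of "B ` \<E>"])
    show "B ` \<E> \<noteq> {}" using \<delta>1(1) unfolding \<E>_def by blast
    show "b \<subseteq> P - {q} \<and> 2 \<le> card b \<and> (\<forall>x\<in>b. m x = 1)" if b: "b \<in> B ` \<E>" for b
      using closed[OF b] b Bsub[OF E\<Delta>] B2[OF E\<Delta>] by blast
    show "f ` b \<in> B ` \<E>" if "b \<in> B ` \<E>" for b using closed[OF that] by blast
    show "\<exists>b'\<in>B ` \<E>. f ` b' = b" if "b \<in> B ` \<E>" for b using pre[OF that] by blast
    show "b = b' \<or> b \<inter> b' = {}" if bb: "b \<in> B ` \<E>" "b' \<in> B ` \<E>" for b b'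
    proof -
      obtain \<delta> \<delta>' where d: "\<delta> \<in> \<E>" "b = B \<delta>" "\<delta>' \<in> \<E>" "b' = B \<delta>'" using bb by blast
      show ?thesis
      proof (cases "\<delta> = \<delta>'")
        case False
        then have "\<delta> \<inter> \<delta>' = {}" using \<Delta>_distinct E\<Delta> d(1,3) by blast
        from Dd_nested_or_disjoint[OF \<Delta>D(1)[OF E\<Delta>[OF d(1)]] \<Delta>D(1)[OF E\<Delta>[OF d(3)]] this]
        consider "B \<delta> \<inter> B \<delta>' = {}" | "B \<delta> \<subseteq> B \<delta>'" | "B \<delta>' \<subseteq> B \<delta>" unfolding B_def by blast
        moreover have "card (B \<delta>) = card (B \<delta>')" using d(1,3) unfolding \<E>_def by simp
        ultimately show ?thesis
          using d(2,4) card_subset_eq[OF finB, of "B \<delta>" \<delta>'] card_subset_eq[OF finB, of "B \<delta>'" \<delta>] by metis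
      qed (use d in simp)
    qed
    show "\<not> f ` {x\<in>S2. m x > 1} - {q} \<subseteq> b" if bE: "b \<in> B ` \<E>" for b
    proof
      assume all: "f ` {x\<in>S2. m x > 1} - {q} \<subseteq> b"
      obtain \<delta> where d: "\<delta> \<in> \<E>" "b = B \<delta>" using bE by blast
      obtain \<delta>' \<alpha> where a: "deg1 \<alpha> \<delta>" using step[of \<delta>] d(1) unfolding \<E>_def by blast
      have crit: "f x = q \<or> f x \<in> Dd \<delta>" if "x \<in> S2" "m x > 1" for x using all that unfolding d(2) B_def by blast
      obtain y where y: "y \<in> \<delta>" using jc_ne[OF \<Delta>D(1)[OF E\<Delta>[OF d(1)]]] by blast
      have "card {x\<in>\<alpha>. f x = y} \<noteq> 1"
        by (rule not_degree_one[OF \<Delta>D(1)[OF E\<Delta>[OF d(1)]] crit _ y]) (use a in \<open>auto simp: deg1_def\<close>)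
      then show False using a y unfolding deg1_def by blast
    qed
  qed
qed

end

section \<open>Portraits\<close>

lemma finite_injective_periodic:
  assumes fin: "finite U" and inj: "inj_on f U" and sub: "f ` U \<subseteq> U" and x: "x \<in> U"
  obtains n where "n > 0" "(f ^^ n) x = x" "\<And>i. (f ^^ i) x \<in> U"
proof -
  have it: "(f ^^ i) y \<in> U" if "y \<in> U" for i y using that sub by (induction i) auto
  have inji: "(f ^^ i) y = (f ^^ i) z \<Longrightarrow> y = z" if "y \<in> U" "z \<in> U" for i y z
  proof (induction i)
    case (Suc i)
    have "(f ^^ i) y = (f ^^ i) z" using inj_onD[OF inj _ it[OF that(1)] it[OF that(2)]] Suc.prems by simp
    then show ?case by (rule Suc.IH)
  qed simp
  have "\<not> inj_on (\<lambda>i. (f ^^ i) x) (UNIV :: nat set)"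
  proof
    assume inj: "inj_on (\<lambda>i. (f ^^ i) x) (UNIV :: nat set)"
    have "finite (range (\<lambda>i. (f ^^ i) x))" by (rule finite_subset[OF _ fin]) (use it[OF x] in blast)
    from finite_imageD[OF this inj] show False by simp
  qed
  then obtain i j where ij: "(f ^^ i) x = (f ^^ j) x" "i < j" unfolding inj_on_def by (metis linorder_neqE_nat)
  have "(f ^^ j) x = (f ^^ i) ((f ^^ (j - i)) x)" using ij(2) by (metis add_diff_inverse_nat comp_apply funpow_add less_imp_not_less)
  then have "x = (f ^^ (j - i)) x" using inji[OF x it[OF x]] ij(1) by metis
  then show ?thesis using that[of "j - i"] ij(2) it[OF x] by simp
qed

text \<open>A block containing \<open>0\<close> and \<open>j\<close> is stable under the shift by \<open>j\<close>, and a nontrivial subgroup of a cyclic group of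
  order \<open>p ^ k\<close> contains the subgroup of order \<open>p\<close>.\<close>

lemma cyclic_blocks:
  fixes y :: "nat \<Rightarrow> 'a"
  assumes p: "prime (p::nat)" and n: "n = p ^ k" and y: "\<And>i. y (Suc i) = f (y i)" and yn: "\<And>i. y (i + n) = y i"
    and ne: "\<B> \<noteq> {}" and fB: "\<And>b. b \<in> \<B> \<Longrightarrow> f ` b \<in> \<B>"
    and B: "\<And>b. b \<in> \<B> \<Longrightarrow> b \<subseteq> y ` {..<n} \<and> 2 \<le> card b"
    and disj: "\<And>b b'. b \<in> \<B> \<Longrightarrow> b' \<in> \<B> \<Longrightarrow> b = b' \<or> b \<inter> b' = {}"
  shows "\<exists>b\<in>\<B>. \<forall>r. y (p ^ (k - 1) * r) \<in> b"
proof -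
  have yf: "y (i + t) = (f ^^ t) (y i)" for i t using y by (induction t) auto
  have fBt: "(f ^^ t) ` b \<in> \<B>" if "b \<in> \<B>" for t b
  proof (induction t)
    case (Suc t)
    have "f ` (f ^^ t) ` b \<in> \<B>" by (rule fB[OF Suc.IH])
    then show ?case by (simp add: image_comp)
  qed (use that in simp)
  have ynl: "y (i + n * l) = y i" for i l
  proof (induction l)
    case (Suc l)
    have "y (i + n * Suc l) = y ((i + n * l) + n)" by (simp add: algebra_simps)
    then show ?case using yn Suc.IH by simp
  qed simp
  obtain b0 where b0: "b0 \<in> \<B>" using ne by blast
  have "\<not> card b0 \<le> Suc 0" using B[OF b0] by simp
  moreover have "finite b0" using B[OF b0] finite_subset by blast
  ultimately obtain u w where uw: "u \<in> b0" "w \<in> b0" "u \<noteq> w" using card_le_Suc0_iff_eq by blast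
  have "\<exists>a a'. a < a' \<and> a' < n \<and> y a \<in> b0 \<and> y a' \<in> b0"
  proof -
    obtain a a' where a: "a < n" "u = y a" "a' < n" "w = y a'" using uw B[OF b0] by blast
    then have "a \<noteq> a'" using uw by blast
    then show ?thesis using a uw by (metis linorder_neqE_nat)
  qed
  then obtain a a' where a: "a < a'" "a' < n" "y a \<in> b0" "y a' \<in> b0" by blast
  define j where "j = a' - a"
  have j: "0 < j" "j < n" using a by (auto simp: j_def)
  \<comment> \<open>The block is moved forward until \<open>y a\<close> becomes \<open>y n\<close>,
    which is \<open>y 0\<close>.\<close>
  define b where "b = (f ^^ (n - a)) ` b0"
  have b: "b \<in> \<B>" unfolding b_def by (rule fBt[OF b0])
  have "y (a + (n - a)) \<in> b" unfolding yf b_def using a(3) by (rule imageI)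
  moreover have "y (a + (n - a)) = y 0" using yn[of 0] a by simp
  ultimately have y0: "y 0 \<in> b" by simp
  have "y (a' + (n - a)) \<in> b" unfolding yf b_def using a(4) by (rule imageI)
  moreover have "a' + (n - a) = j + n" using a by (simp add: j_def)
  ultimately have yj: "y j \<in> b" using yn by simp
  \<comment> \<open>The translate of \<open>b\<close> by \<open>i\<close> steps contains
    \<open>y i\<close>, as does \<open>b\<close>, so by disjointness it is \<open>b\<close>.\<close>
  have shift: "y (i + j) \<in> b" if i: "y i \<in> b" for i
  proof -
    have "(f ^^ i) ` b \<in> \<B>" by (rule fBt[OF b])
    moreover have "y (0 + i) \<in> (f ^^ i) ` b" unfolding yf using y0 by (rule imageI)
    ultimately have "(f ^^ i) ` b = b" using disj[OF _ b] i by auto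
    moreover have "y (j + i) \<in> (f ^^ i) ` b" unfolding yf using yj by (rule imageI)
    ultimately show ?thesis by (simp add: add.commute)
  qed
  have mult: "y (j * s) \<in> b" for s
  proof (induction s)
    case (Suc s)
    show ?case using shift[OF Suc.IH] by (simp add: add.commute)
  qed (use y0 in simp)
  \<comment> \<open>Modulo \<open>n\<close> the multiples of \<open>j\<close> include all multiples
    of \<open>gcd j n\<close>. This is a power of \<open>p\<close> smaller than \<open>n\<close>, so
    it divides \<open>p ^ (k - 1)\<close>.\<close>
  have "gcd j n dvd p ^ k" unfolding n by simp
  then obtain e where e: "e \<le> k" "gcd j n = p ^ e" using divides_primepow_nat[OF p] by blast
  have "gcd j n \<le> j" using j(1) by (intro dvd_imp_le) auto
  then have "p ^ e < p ^ k" using j(2) e(2) n by simp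
  then have "e < k" using p prime_gt_1_nat power_less_imp_less_exp by blast
  then have "gcd j n dvd p ^ (k - 1)" unfolding e(2) by (intro le_imp_power_dvd) simp
  then obtain g where g: "p ^ (k - 1) = gcd j n * g" by (rule dvdE)
  obtain x z where xz: "j * x = n * z + gcd j n" using bezout_nat[of j n] j(1) by blast
  have "y (p ^ (k - 1) * r) \<in> b" for r
  proof -
    have "j * (x * (g * r)) = (n * z + gcd j n) * (g * r)" unfolding xz[symmetric] by (simp add: mult.assoc)
    also have "\<dots> = p ^ (k - 1) * r + n * (z * (g * r))" unfolding g by (simp add: algebra_simps)
    finally show ?thesis using mult[of "x * (g * r)"] ynl by simp
  qed
  then show ?thesis using b by blast
qed

section \<open>Comparing the map with its portrait\<close>

text \<open>\<open>N\<close> is the degree of the map and \<open>d\<close> that of the portrait. The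
  isomorphism \<open>h\<close> compares only local degrees, so the relation between \<open>N\<close>
  and \<open>d\<close> has to be derived.\<close>

locale portrait_cover = branched_cover +
  fixes \<Gamma> :: "'v portrait" and d :: nat and vinf :: 'v and h :: "real^3 \<Rightarrow> 'v"
  assumes app: "abstract_polynomial_portrait \<Gamma> d vinf"
    and finP: "finite (postcritical_set f)"
    and hbij: "bij_betw h (critical_points f \<union> postcritical_set f) (verts \<Gamma>)"
    and hiso: "\<And>x. x \<in> critical_points f \<union> postcritical_set f \<Longrightarrow> h (f x) = tau \<Gamma> (h x) \<and> m x = deg \<Gamma> (h x)"
begin

abbreviation V where "V \<equiv> critical_points f \<union> postcritical_set f"
abbreviation P where "P \<equiv> postcritical_set f"

lemma critical_points_eq: "critical_points f = {x\<in>S2. m x > 1}" unfolding critical_points_def ..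

lemma P_least:
  assumes "X \<subseteq> S2" "f ` critical_points f \<subseteq> X" "f ` X \<subseteq> X" shows "P \<subseteq> X"
  unfolding postcritical_set_def using assms by blast

lemma P_facts: "P \<subseteq> S2" "\<And>x. x \<in> P \<Longrightarrow> f x \<in> P" "\<And>x. x \<in> critical_points f \<Longrightarrow> f x \<in> P"
proof -
  have "S2 \<in> {X. X \<subseteq> S2 \<and> f ` critical_points f \<subseteq> X \<and> f ` X \<subseteq> X}" using fS2 unfolding critical_points_eq by blast
  then show "P \<subseteq> S2" unfolding postcritical_set_def by blast
  show "f x \<in> P" if "x \<in> P" for x using that unfolding postcritical_set_def by blast
  show "f x \<in> P" if "x \<in> critical_points f" for x using that unfolding postcritical_set_def by blast
qed

lemma V_sub_S2: "V \<subseteq> S2" using P_facts(1) unfolding critical_points_eq by blast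

lemma fV: "x \<in> V \<Longrightarrow> f x \<in> V" using P_facts(2,3) by blast

lemma hinj: "x \<in> V \<Longrightarrow> y \<in> V \<Longrightarrow> h x = h y \<Longrightarrow> x = y"
  using hbij unfolding bij_betw_def inj_on_def by blast

lemma hverts: "x \<in> V \<Longrightarrow> h x \<in> verts \<Gamma>" using hbij unfolding bij_betw_def by blast

lemma hsurj: "v \<in> verts \<Gamma> \<Longrightarrow> \<exists>x\<in>V. h x = v" unfolding bij_betw_imp_surj_on[OF hbij, symmetric] by blast

lemma iterate: "x \<in> V \<Longrightarrow> (f ^^ i) x \<in> V \<and> h ((f ^^ i) x) = (tau \<Gamma> ^^ i) (h x)"
proof (induction i)
  case (Suc i)
  then have "(f ^^ i) x \<in> V" "h ((f ^^ i) x) = (tau \<Gamma> ^^ i) (h x)" by blast+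
  then show ?case using fV hiso[of "(f ^^ i) x"] by simp
qed simp

lemma crit_iff: "x \<in> V \<Longrightarrow> x \<in> critical_points f \<longleftrightarrow> h x \<in> critical_verts \<Gamma>"
  using hiso[of x] hverts[of x] V_sub_S2 unfolding critical_points_eq critical_verts_def by auto

lemma portrait_facts: "finite (verts \<Gamma>)" "\<And>v. v \<in> verts \<Gamma> \<Longrightarrow> tau \<Gamma> v \<in> verts \<Gamma>" "d \<ge> 2"
  "(\<Sum>v\<in>critical_verts \<Gamma>. deg \<Gamma> v - 1) = 2 * d - 2" "vinf \<in> verts \<Gamma>" "tau \<Gamma> vinf = vinf" "deg \<Gamma> vinf = d"
  using app unfolding abstract_polynomial_portrait_def abstract_portrait_def weighted_graph_def by auto

lemma finV: "finite V" using bij_betw_finite[OF hbij] portrait_facts(1) by blast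

definition q where "q = (SOME x. x \<in> V \<and> h x = vinf)"

lemma q: "q \<in> V" "h q = vinf"
proof -
  have "\<exists>x. x \<in> V \<and> h x = vinf" using hsurj[OF portrait_facts(5)] by blast
  then have "q \<in> V \<and> h q = vinf" unfolding q_def by (rule someI_ex)
  then show "q \<in> V" "h q = vinf" by blast+
qed

lemma fq: "f q = q" and mq: "m q = d" and q_crit: "q \<in> critical_points f" and qP: "q \<in> P"
proof -
  show f: "f q = q" using hinj[OF fV[OF q(1)] q(1)] hiso[OF q(1)] q(2) portrait_facts(6) by simp
  show "m q = d" using hiso[OF q(1)] q(2) portrait_facts(7) by simp
  show c: "q \<in> critical_points f"
    using crit_iff[OF q(1)] q(2) portrait_facts(3,5,7) unfolding critical_verts_def by simp
  show "q \<in> P" using P_facts(3)[OF c] f by simp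
qed

text \<open>The total \<open>2 * d - 2\<close> of the portrait less the contribution
  \<open>d - 1\<close> of \<open>q\<close>.\<close>

lemma sum_crit: "(\<Sum>x\<in>critical_points f - {q}. m x - 1) = d - 1"
proof -
  have bij: "bij_betw h (critical_points f) (critical_verts \<Gamma>)"
  proof (rule bij_betw_imageI)
    show "inj_on h (critical_points f)" using hbij inj_on_subset unfolding bij_betw_def by blast
    show "h ` critical_points f = critical_verts \<Gamma>"
    proof (intro equalityI subsetI)
      fix v assume v: "v \<in> critical_verts \<Gamma>"
      then obtain x where "x \<in> V" "h x = v" using hsurj[of v] unfolding critical_verts_def by blast
      then show "v \<in> h ` critical_points f" using crit_iff[of x] v by blast
    qed (use crit_iff in blast)
  qed
  have "(\<Sum>x\<in>critical_points f. m x - 1) = (\<Sum>x\<in>critical_points f. deg \<Gamma> (h x) - 1)"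
    by (rule sum.cong) (use hiso in auto)
  also have "\<dots> = 2 * d - 2" using sum.reindex_bij_betw[OF bij, of "\<lambda>v. deg \<Gamma> v - 1"] portrait_facts(4) by simp
  finally have all: "(\<Sum>x\<in>critical_points f. m x - 1) = 2 * d - 2" .
  have fin: "finite (critical_points f)" using finV by simp
  have "(\<Sum>x\<in>critical_points f. m x - 1) = (m q - 1) + (\<Sum>x\<in>critical_points f - {q}. m x - 1)"
    by (rule sum.remove[OF fin q_crit])
  then show ?thesis using all mq by simp
qed

lemma N_le: "N \<le> d"
proof -
  have fin: "finite {x\<in>S2. m x > 1}" using finV unfolding critical_points_eq by simp
  have "N - 1 \<le> (\<Sum>x | x \<in> S2 \<and> m x > 1 \<and> f x \<noteq> q. m x - 1)"
    by (rule degree_bound[OF _ fin]) (use q V_sub_S2 in blast)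
  also have "\<dots> \<le> (\<Sum>x\<in>critical_points f - {q}. m x - 1)"
    by (rule sum_mono2) (use finV fq in \<open>auto simp: critical_points_eq\<close>)
  finally show ?thesis unfolding sum_crit using portrait_facts(3) by simp
qed

text \<open>The multiplicities in the fibre of \<open>q\<close> add up to \<open>N\<close>, and
  \<open>q\<close> alone contributes \<open>d \<ge> N\<close>.\<close>

lemma fibre_q: assumes "x \<in> S2" "f x = q" shows "x = q"
proof (rule ccontr)
  assume ne: "x \<noteq> q"
  have qS: "q \<in> S2" using q V_sub_S2 by blast
  have "(\<Sum>y\<in>{q, x}. m y) \<le> (\<Sum>y | y \<in> S2 \<and> f y = q. m y)"
    by (rule sum_mono2) (use fin_fibre[OF qS] assms fq qS in auto)
  then have "m q + m x \<le> N" using sum_fibre[OF qS] ne by simp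
  then show False using N_le mq m_pos[OF assms(1)] by simp
qed

lemma N_ge: "N \<ge> 2"
proof -
  have qS: "q \<in> S2" using q V_sub_S2 by blast
  have "(\<Sum>y\<in>{q}. m y) \<le> (\<Sum>y | y \<in> S2 \<and> f y = q. m y)"
    by (rule sum_mono2) (use fin_fibre[OF qS] fq qS in auto)
  then show ?thesis using sum_fibre[OF qS] mq portrait_facts(3) by simp
qed

text \<open>A map of a finite set onto itself is a permutation, so \<open>x\<close> is periodic, and
  its orbit stays in \<open>U\<close>, where no point is critical.\<close>

lemma in_non_attractor:
  assumes U: "finite U" "U \<subseteq> P" "f ` U = U" "\<And>x. x \<in> U \<Longrightarrow> m x = 1" and x: "x \<in> U"
  obtains Z where "non_attractor \<Gamma> Z" "h x \<in> Z"
proof -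
  have inj: "inj_on f U" using U(1,3) by (simp add: eq_card_imp_inj_on)
  obtain n where n: "n > 0" "(f ^^ n) x = x" "\<And>i. (f ^^ i) x \<in> U"
    using finite_injective_periodic[OF U(1) inj _ x] U(3) by blast
  have xV: "x \<in> V" using U(2) x by blast
  define Z where "Z = {(tau \<Gamma> ^^ i) (h x) | i. i < n}"
  have "(tau \<Gamma> ^^ n) (h x) = h x" using iterate[OF xV, of n] n(2) by simp
  then have "is_cycle \<Gamma> Z" unfolding is_cycle_def Z_def using hverts[OF xV] n(1) by blast
  moreover have "Z \<inter> critical_verts \<Gamma> = {}"
  proof -
    have "(tau \<Gamma> ^^ i) (h x) \<notin> critical_verts \<Gamma>" for i
    proof -
      have "m ((f ^^ i) x) = 1" by (rule U(4)[OF n(3)])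
      then have "(f ^^ i) x \<notin> critical_points f" unfolding critical_points_eq by simp
      then show ?thesis using crit_iff[of "(f ^^ i) x"] iterate[OF xV, of i] by simp
    qed
    then show ?thesis unfolding Z_def by blast
  qed
  ultimately have "non_attractor \<Gamma> Z" unfolding non_attractor_def by blast
  moreover have "h x \<in> Z" unfolding Z_def using n(1) by (intro CollectI exI[of _ 0]) simp
  ultimately show ?thesis by (rule that)
qed

text \<open>The iterates of critical points with exponent at least \<open>1\<close> form a forward
  invariant set that contains the critical values. So the least such set consists of iterates of the
  kind that defines \<open>postcritical_verts\<close>.\<close>

lemma P_portrait:
  assumes "x \<in> P - {q}" shows "h x \<in> postcritical_verts \<Gamma> - {vinf}"
proof -
  define X where "X = {y. \<exists>c\<in>critical_points f. \<exists>k\<ge>1. y = (f ^^ k) c}"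
  have "P \<subseteq> X"
  proof (rule P_least)
    have cV: "c \<in> V" if "c \<in> critical_points f" for c using that by blast
    show "X \<subseteq> S2" unfolding X_def using iterate[OF cV] V_sub_S2 by blast
    show "f ` critical_points f \<subseteq> X"
    proof (rule image_subsetI)
      fix c assume "c \<in> critical_points f"
      moreover have "f c = (f ^^ 1) c" by simp
      ultimately show "f c \<in> X" unfolding X_def by blast
    qed
    show "f ` X \<subseteq> X"
    proof (rule image_subsetI)
      fix y assume "y \<in> X"
      then obtain c k where "c \<in> critical_points f" "k \<ge> 1" "y = (f ^^ k) c" unfolding X_def by blast
      then have "c \<in> critical_points f" "Suc k \<ge> 1" "f y = (f ^^ Suc k) c" by auto
      then show "f y \<in> X" unfolding X_def by blast
    qed
  qed
  then obtain c k where c: "c \<in> critical_points f" "k \<ge> 1" "x = (f ^^ k) c" using assms unfolding X_def by blast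
  have cV: "c \<in> V" using c(1) by blast
  have "h x = (tau \<Gamma> ^^ k) (h c)" using iterate[OF cV, of k] c(3) by simp
  then have "h x \<in> postcritical_verts \<Gamma>"
    unfolding postcritical_verts_def using crit_iff[OF cV] c(1,2) by (intro CollectI bexI[of _ "h c"] exI[of _ k]) auto
  moreover have "h x \<noteq> vinf" using hinj[of x q] assms q by auto
  ultimately show ?thesis by blast
qed

lemma postcritical_sub: "postcritical_verts \<Gamma> \<subseteq> verts \<Gamma>"
proof
  fix v assume "v \<in> postcritical_verts \<Gamma>"
  then obtain w k where w: "w \<in> critical_verts \<Gamma>" "(tau \<Gamma> ^^ k) w = v" unfolding postcritical_verts_def by blast
  have "(tau \<Gamma> ^^ k) w \<in> verts \<Gamma>"
    using w(1) portrait_facts(2) by (induction k) (auto simp: critical_verts_def)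
  then show "v \<in> verts \<Gamma>" using w(2) by simp
qed

lemma blocks_contradiction:
  assumes hyp: "(\<exists>Z. {Z'. non_attractor \<Gamma> Z'} = {Z} \<and> card Z = 1) \<or>
         (\<exists>Z p k v. {Z'. non_attractor \<Gamma> Z'} = {Z} \<and>
            postcritical_verts \<Gamma> - {vinf} \<subseteq> Z \<and>
            prime (p::nat) \<and> k > 0 \<and> card Z = p ^ k \<and>
            bij_betw v {..<p ^ k} (postcritical_verts \<Gamma> - {vinf}) \<and>
            (\<forall>i<p ^ k. tau \<Gamma> (v i) = v ((i + 1) mod p ^ k)) \<and>
            (\<forall>j<p ^ k. v j \<in> critical_values \<Gamma> \<longrightarrow> p ^ (k - 1) dvd j))"
    and ne: "\<B> \<noteq> {}"
    and B: "\<And>b. b \<in> \<B> \<Longrightarrow> b \<subseteq> P - {q} \<and> 2 \<le> card b \<and> (\<forall>x\<in>b. m x = 1)"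
    and fB: "\<And>b. b \<in> \<B> \<Longrightarrow> f ` b \<in> \<B>"
    and preB: "\<And>b. b \<in> \<B> \<Longrightarrow> \<exists>b'\<in>\<B>. f ` b' = b"
    and disj: "\<And>b b'. b \<in> \<B> \<Longrightarrow> b' \<in> \<B> \<Longrightarrow> b = b' \<or> b \<inter> b' = {}"
    and crit: "\<And>b. b \<in> \<B> \<Longrightarrow> \<not> f ` {x\<in>S2. m x > 1} - {q} \<subseteq> b"
  shows False
  using hyp
proof
  assume "\<exists>Z. {Z'. non_attractor \<Gamma> Z'} = {Z} \<and> card Z = 1"
  then obtain Z where Z: "{Z'. non_attractor \<Gamma> Z'} = {Z}" "card Z = 1" by blast
  obtain z where z: "Z = {z}" using Z(2) card_1_singletonE by blast
  let ?U = "\<Union>\<B>"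
  have UP: "?U \<subseteq> P" using B by blast
  have "f ` ?U = ?U"
  proof (intro equalityI subsetI)
    fix y assume "y \<in> f ` ?U"
    then obtain b x where "b \<in> \<B>" "x \<in> b" "y = f x" by blast
    then show "y \<in> ?U" using fB by blast
  next
    fix y assume "y \<in> ?U"
    then obtain b where b: "b \<in> \<B>" "y \<in> b" by blast
    obtain b' where "b' \<in> \<B>" "f ` b' = b" using preB[OF b(1)] by blast
    then show "y \<in> f ` ?U" using b(2) by blast
  qed
  moreover have "m x = 1" if "x \<in> ?U" for x using that B by blast
  \<comment> \<open>The union of the blocks is permuted and unramified, so it lies in the only
    non-attractor cycle. This cycle is a single vertex, while a block has two points.\<close>
  ultimately have hz: "h x = z" if xU: "x \<in> ?U" for x
  proof -
    obtain Z' where "non_attractor \<Gamma> Z'" "h x \<in> Z'"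
      using in_non_attractor[OF finite_subset[OF UP finP] UP \<open>f ` ?U = ?U\<close> _ xU] B by blast
    then show ?thesis using Z(1) z by blast
  qed
  obtain b where b: "b \<in> \<B>" using ne by blast
  have "b \<subseteq> P" using B[OF b] by blast
  then have "finite b" using finP finite_subset by blast
  moreover have "\<not> card b \<le> Suc 0" using B[OF b] by simp
  ultimately obtain x y where xy: "x \<in> b" "y \<in> b" "x \<noteq> y" using card_le_Suc0_iff_eq by blast
  have "x \<in> ?U" "y \<in> ?U" using xy b by blast+
  then have "h x = h y" using hz by simp
  moreover have "x \<in> V" "y \<in> V" using xy \<open>b \<subseteq> P\<close> by blast+
  ultimately show False using hinj xy(3) by blast
next
  assume "\<exists>Z p k v. {Z'. non_attractor \<Gamma> Z'} = {Z} \<and>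
            postcritical_verts \<Gamma> - {vinf} \<subseteq> Z \<and>
            prime (p::nat) \<and> k > 0 \<and> card Z = p ^ k \<and>
            bij_betw v {..<p ^ k} (postcritical_verts \<Gamma> - {vinf}) \<and>
            (\<forall>i<p ^ k. tau \<Gamma> (v i) = v ((i + 1) mod p ^ k)) \<and>
            (\<forall>j<p ^ k. v j \<in> critical_values \<Gamma> \<longrightarrow> p ^ (k - 1) dvd j)"
  then obtain p k v where p: "prime (p::nat)"
    and v: "bij_betw v {..<p ^ k} (postcritical_verts \<Gamma> - {vinf})"
    and tv: "\<And>i. i < p ^ k \<Longrightarrow> tau \<Gamma> (v i) = v ((i + 1) mod p ^ k)"
    and cv: "\<And>j. j < p ^ k \<Longrightarrow> v j \<in> critical_values \<Gamma> \<Longrightarrow> p ^ (k - 1) dvd j" by blast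
  define n where "n = p ^ k"
  have n0: "n > 0" unfolding n_def using prime_gt_0_nat[OF p] by simp
  have vsurj: "\<exists>i<n. v i = w" if "w \<in> postcritical_verts \<Gamma> - {vinf}" for w
    using that unfolding bij_betw_imp_surj_on[OF v, symmetric] n_def by blast
  have "v 0 \<in> postcritical_verts \<Gamma> - {vinf}"
    unfolding bij_betw_imp_surj_on[OF v, symmetric] using n0 unfolding n_def by blast
  then have "v 0 \<in> verts \<Gamma>" using postcritical_sub by blast
  then obtain y0 where y0: "y0 \<in> V" "h y0 = v 0" using hsurj by blast
  \<comment> \<open>The orbit of the point that corresponds to \<open>v 0\<close>, indexed by all
    natural numbers; reduction of indices modulo \<open>n\<close> becomes periodicity of
    \<open>y\<close>.\<close>
  define y where "y = (\<lambda>i. (f ^^ i) y0)"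
  have yV: "y i \<in> V" for i unfolding y_def using iterate[OF y0(1)] by blast
  have hy: "h (y i) = v (i mod n)" for i
  proof (induction i)
    case 0
    then show ?case using y0(2) by (simp add: y_def)
  next
    case (Suc i)
    have "h (y (Suc i)) = tau \<Gamma> (h (y i))" using hiso[OF yV[of i]] by (simp add: y_def)
    also have "\<dots> = v ((i mod n + 1) mod n)" unfolding Suc.IH using tv[of "i mod n"] n0 unfolding n_def by simp
    also have "(i mod n + 1) mod n = Suc i mod n" by (simp add: mod_Suc_eq)
    finally show ?case .
  qed
  have yh: "x = y i" if "x \<in> V" "h x = v i" "i < n" for x i
    using hinj[OF that(1) yV[of i]] hy[of i] that by simp
  have "\<exists>b\<in>\<B>. \<forall>r. y (p ^ (k - 1) * r) \<in> b"
  proof (rule cyclic_blocks[OF p n_def _ _ ne fB _ disj])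
    show "y (Suc i) = f (y i)" for i by (simp add: y_def)
    show "y (i + n) = y i" for i using hinj[OF yV yV] hy[of "i + n"] hy[of i] by simp
    show "b \<subseteq> y ` {..<n} \<and> 2 \<le> card b" if b: "b \<in> \<B>" for b
    proof
      show "b \<subseteq> y ` {..<n}"
      proof
        fix x assume "x \<in> b"
        then have x: "x \<in> P - {q}" using B[OF b] by blast
        obtain i where i: "i < n" "v i = h x" using vsurj[OF P_portrait[OF x]] by blast
        have "x = y i" by (rule yh) (use x i in auto)
        then show "x \<in> y ` {..<n}" using i(1) by blast
      qed
      show "2 \<le> card b" using B[OF b] by blast
    qed
  qed auto
  then obtain b where b: "b \<in> \<B>" "\<And>r. y (p ^ (k - 1) * r) \<in> b" by blast
  have "f ` {x\<in>S2. m x > 1} - {q} \<subseteq> b"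
  proof
    fix z assume "z \<in> f ` {x\<in>S2. m x > 1} - {q}"
    then obtain c where c: "c \<in> critical_points f" "z = f c" "z \<noteq> q" unfolding critical_points_eq by blast
    have cV: "c \<in> V" using c(1) by blast
    have z: "z \<in> P - {q}" using P_facts(3)[OF c(1)] c by blast
    obtain i where i: "i < n" "v i = h z" using vsurj[OF P_portrait[OF z]] by blast
    have "h z = tau \<Gamma> (h c)" using hiso[OF cV] c(2) by simp
    then have "v i \<in> critical_values \<Gamma>" unfolding critical_values_def i(2) using crit_iff[OF cV] c(1) by blast
    then have "p ^ (k - 1) dvd i" using cv i(1) unfolding n_def by blast
    then obtain r where r: "i = p ^ (k - 1) * r" by (rule dvdE)
    have "z = y i" by (rule yh) (use z i in auto)
    then show "z \<in> b" using b(2)[of r] r by simp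
  qed
  then show False using crit[OF b(1)] by blast
qed

end

theorem theorem3:
  fixes \<Gamma> :: "'v portrait" and d :: nat and vinf :: 'v
    and f :: "real^3 \<Rightarrow> real^3"
  assumes "abstract_polynomial_portrait \<Gamma> d vinf"
    and "card (postcritical_verts \<Gamma>) \<ge> 4"
    and "(\<exists>Z. {Z'. non_attractor \<Gamma> Z'} = {Z} \<and> card Z = 1) \<or>
         (\<exists>Z p k v. {Z'. non_attractor \<Gamma> Z'} = {Z} \<and>
            postcritical_verts \<Gamma> - {vinf} \<subseteq> Z \<and>
            prime (p::nat) \<and> k > 0 \<and> card Z = p ^ k \<and>
            bij_betw v {..<p ^ k} (postcritical_verts \<Gamma> - {vinf}) \<and>
            (\<forall>i<p ^ k. tau \<Gamma> (v i) = v ((i + 1) mod p ^ k)) \<and>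
            (\<forall>j<p ^ k. v j \<in> critical_values \<Gamma> \<longrightarrow> p ^ (k - 1) dvd j))"
    and "thurston_map f"
    and "portrait_isomorphic (ramification_portrait f) \<Gamma>"
  shows "\<not> obstructed f"
proof
  assume "obstructed f"
  then obtain \<Delta> \<rho> where mc: "multicurve (postcritical_set f) \<Delta>" and \<rho>: "matrix_eigenvalue \<Delta> (thurston_matrix f) \<rho>" "\<rho> \<ge> 1"
    unfolding obstructed_def obstruction_def invariant_multicurve_def leading_eigenvalue_def by blast
  obtain N where N: "oriented_branched_cover f N" and fin: "finite (postcritical_set f)"
    using assms(4) unfolding thurston_map_def by blast
  obtain h where h: "bij_betw h (critical_points f \<union> postcritical_set f) (verts \<Gamma>)"
    "\<And>x. x \<in> critical_points f \<union> postcritical_set f \<Longrightarrow> h (f x) = tau \<Gamma> (h x) \<and> local_degree f x = deg \<Gamma> (h x)"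
    using assms(5) unfolding portrait_isomorphic_def ramification_portrait_def by auto
  interpret C: portrait_cover f N \<Gamma> d vinf h
    by unfold_locales (use N assms(1) fin h in auto)
  have qS: "C.q \<in> S2" using C.q C.V_sub_S2 by blast
  obtain \<sigma> \<sigma>' where "punctured C.q \<sigma> \<sigma>'" using exists_punctured[OF qS] by blast
  then interpret Q: punctured C.q \<sigma> \<sigma>' .
  obtain v where v: "\<exists>\<delta>\<in>\<Delta>. v \<delta> \<noteq> 0" "\<And>\<delta>. \<delta> \<in> \<Delta> \<Longrightarrow> (\<Sum>\<epsilon>\<in>\<Delta>. thurston_matrix f \<delta> \<epsilon> * v \<epsilon>) = \<rho> * v \<delta>"
    using \<rho>(1) unfolding matrix_eigenvalue_def by blast
  have A0: "thurston_matrix f \<delta> \<epsilon> \<ge> 0" for \<delta> \<epsilon> unfolding thurston_matrix_def by (intro sum_nonneg) simp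
  \<comment> \<open>The entries of the eigenvector may differ in sign. As the matrix is nonnegative
    and \<open>\<rho> \<ge> 1\<close>, the triangle inequality passes to their absolute
    values.\<close>
  have u_le: "\<bar>v \<delta>\<bar> \<le> (\<Sum>\<epsilon>\<in>\<Delta>. thurston_matrix f \<delta> \<epsilon> * \<bar>v \<epsilon>\<bar>)" if "\<delta> \<in> \<Delta>" for \<delta>
  proof -
    have "1 * \<bar>v \<delta>\<bar> \<le> \<rho> * \<bar>v \<delta>\<bar>" using \<rho>(2) by (intro mult_right_mono) auto
    also have "\<dots> = \<bar>\<Sum>\<epsilon>\<in>\<Delta>. thurston_matrix f \<delta> \<epsilon> * v \<epsilon>\<bar>" using v(2)[OF that] \<rho>(2) by (simp add: abs_mult)
    also have "\<dots> \<le> (\<Sum>\<epsilon>\<in>\<Delta>. \<bar>thurston_matrix f \<delta> \<epsilon> * v \<epsilon>\<bar>)" by (rule sum_abs)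
    also have "\<dots> = (\<Sum>\<epsilon>\<in>\<Delta>. thurston_matrix f \<delta> \<epsilon> * \<bar>v \<epsilon>\<bar>)" using A0 by (simp add: abs_mult)
    finally show ?thesis by simp
  qed
  interpret O: obstructed_cover f N C.q \<sigma> \<sigma>' "postcritical_set f" \<Delta> "\<lambda>\<delta>. \<bar>v \<delta>\<bar>"
  proof unfold_locales
    show "x = C.q" if "x \<in> S2" "f x = C.q" for x by (rule C.fibre_q[OF that])
    show "2 \<le> N" by (rule C.N_ge)
    show "C.q \<in> postcritical_set f" by (rule C.qP)
    show "\<exists>\<delta>\<in>\<Delta>. \<bar>v \<delta>\<bar> > 0" using v(1) by simp
  qed (use fin mc u_le in auto)
  obtain \<B> where B: "\<B> \<noteq> {}"
    "\<And>b. b \<in> \<B> \<Longrightarrow> b \<subseteq> postcritical_set f - {C.q} \<and> 2 \<le> card b \<and> (\<forall>x\<in>b. local_degree f x = 1)"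
    "\<And>b. b \<in> \<B> \<Longrightarrow> f ` b \<in> \<B>"
    "\<And>b. b \<in> \<B> \<Longrightarrow> \<exists>b'\<in>\<B>. f ` b' = b"
    "\<And>b b'. b \<in> \<B> \<Longrightarrow> b' \<in> \<B> \<Longrightarrow> b = b' \<or> b \<inter> b' = {}"
    "\<And>b. b \<in> \<B> \<Longrightarrow> \<not> f ` {x\<in>S2. local_degree f x > 1} - {C.q} \<subseteq> b"
    by (rule O.obstruction_blocks) blast
  show False by (rule C.blocks_contradiction[OF assms(3) B])
qed

end
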